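(* Let $C>0$ be arbitrary. For all integers $N \geq 3$ and all real $0<t \le (\log N)^C$, we have \[ \frac{1}{\varphi(N)} \left| \left\{ a \in \mathbb{Z}_N^* \, : \, \left| D \left( \frac{a}{N} \right) \right| \geq t \log N \right\} \right| \ll \frac{1}{t} \] with an implied constant depending only on $C$.
   Context: For an integer $N\ge 2$, $\mathbb{Z}_N^*$ denotes the set of integers $1\le a\le N$ coprime to $N$, and $\varphi$ is Euler's totient function. For $a\in\mathbb{Z}_N^*$, the Dedekind sum is \[ D \left( \frac{a}{N} \right) = \sum_{b=1}^{N-1} \left( \frac{b}{N} - \frac{1}{2} \right) \left( \left\{ \frac{ba}{N} \right\} - \frac{1}{2} \right), \] where $\{\cdot\}$ denotes the fractional part. *)

theory Defs
  imports Complex_Main "HOL-Number_Theory.Number_Theory"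
begin

definition dedekind_sum :: "nat \<Rightarrow> nat \<Rightarrow> real" where
  "dedekind_sum a N =
     (\<Sum>b = 1..N - 1. (real b / real N - 1 / 2) * (frac (real (b * a) / real N) - 1 / 2))"

end

theory Submission
  imports Defs "HOL-Real_Asymp.Real_Asymp"
begin

text \<open>
  Call \<open>(q, r)\<close> with \<open>q > 0\<close> and \<open>r = a q - p N \<noteq> 0\<close> a convergent vector of \<open>a/N\<close> if \<open>gcd(q, p) = 1\<close> and
  \<open>2 q |r| < N\<close>; then \<open>z = N / (q |r|)\<close> is within a constant of a partial quotient of \<open>a/N\<close>, and the
  reciprocity law gives that \<open>12 D(a/N)\<close> is the sum of \<open>sgn(r) z\<close> up to \<open>O(log N)\<close>.

  The number of pairs of \<open>a\<close> and a vector with \<open>z \<ge> T\<close> is \<open>O(\<phi>(N) log N / T)\<close>, so with \<open>T = t log N\<close> all \<open>a\<close>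
  having a vector with \<open>z \<ge> T\<close> may be discarded and \<open>z\<close> may be capped at \<open>T\<close>. Put
  \<open>R = sqrt N / (d(N) T)\<close> with \<open>d\<close> the divisor function and split the vectors into the late ones with
  \<open>|r| \<le> R\<close>, the early ones with \<open>q \<le> R\<close>, and the rest.

  For the late vectors the second moment is \<open>O(\<phi>(N) t log^2 N)\<close>. The diagonal terms have this size. For the
  other terms, fix \<open>(q, r)\<close>: the vectors with a larger denominator correspond to the convergent vectors of
  \<open>s/|r|\<close>, where \<open>q s = N\<close> modulo \<open>|r|\<close>, and their sum is an odd function of \<open>s\<close>. For fixed \<open>r\<close> the
  denominators \<open>q\<close> are so well distributed over the residue classes modulo \<open>|r|\<close> that \<open>s\<close> and \<open>-s\<close> cancel.
  The early vectors of \<open>a\<close> are the late vectors of the inverse of \<open>a\<close> modulo \<open>N\<close>.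

  The middle range is only \<open>O(log (d(N) T)) = O(log N / log log N)\<close> long on a logarithmic scale, and each unit
  of length contributes \<open>O(log T)\<close> to the first moment. Since \<open>t \<le> (log N)^C\<close> the product is \<open>O(log N)\<close>.
\<close>

section \<open>The reciprocity law\<close>

text \<open>A first moment over all vectors yields \<open>log N * log T\<close>, too much by the
  factor \<open>log T\<close>. So absolute values are affordable only on a short stretch, and
  elsewhere signs must cancel. The cancellation has a price: the denominators are equidistributed
  modulo \<open>|r|\<close> up to a sieve error \<open>2^omega(N) T\<close>, and over all units
  modulo \<open>|r|\<close> and all \<open>|r| \<le> R\<close> this adds up to about
  \<open>2^omega(N) T^2 R^2 log R\<close>. Since \<open>N \<le> 2^omega(N) phi(N)\<close> and
  \<open>2^omega(N) \<le> d(N)\<close>, the value of \<open>R\<close> brings it down to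
  \<open>O(phi(N) log N)\<close>. The remaining errors come from summing \<open>gcd(y, N)\<close>;
  they cost powers of \<open>d(N)\<close> and \<open>T\<close> against a saved
  \<open>sqrt N\<close>.

  Lattice vectors replace continued fraction digits because every operation used is then linear:
  reflection negates the residue, inversion swaps denominator and residue, and a change of basis
  cuts off the first convergents. The weights \<open>g\<close> are 1-Lipschitz and vanish up to 2,
  so a vector that stops being convergent under a change of basis contributes nothing.\<close>

lemma dedekind_sum_altdef:
  assumes "N > 0"
  shows "dedekind_sum a N =
    (\<Sum>b = 1..<N. (real b / real N - 1 / 2) * (real (b * a mod N) / real N - 1 / 2))"
proof -
  have "{1..N - 1} = {1..<N}" using assms by auto
  moreover have "frac (real (b * a) / real N) = real (b * a mod N) / real N" for b
  proof -
    have "real (b * a) = real (N * (b * a div N) + b * a mod N)"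
      by (simp only: mult_div_mod_eq)
    then have "real (b * a) / real N = real (b * a div N) + real (b * a mod N) / real N"
      unfolding of_nat_add of_nat_mult using assms by (simp add: field_simps)
    then show ?thesis
      using floor_divide_of_nat_eq[of "b * a" N, where ?'a = real] by (simp add: frac_def)
  qed
  ultimately show ?thesis by (simp add: dedekind_sum_def)
qed

lemma dedekind_sum_mod: "N > 0 \<Longrightarrow> dedekind_sum (a mod N) N = dedekind_sum a N"
  by (simp add: dedekind_sum_altdef mod_mult_right_eq)

lemma bij_betw_mult_mod:
  fixes h k :: nat
  assumes "coprime h k"
  shows "bij_betw (\<lambda>b. b * h mod k) {1..<k} {1..<k}"
proof -
  have inj: "inj_on (\<lambda>b. b * h mod k) {1..<k}"
  proof (rule inj_onI)
    fix x y assume xy: "x \<in> {1..<k}" "y \<in> {1..<k}" "x * h mod k = y * h mod k"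
    then have "[x * h = y * h] (mod k)" by (simp add: Cong.cong_def)
    then have "[x = y] (mod k)" using assms by (simp add: cong_mult_rcancel_nat)
    then show "x = y" using xy by (simp add: Cong.cong_def)
  qed
  have "b * h mod k \<in> {1..<k}" if "b \<in> {1..<k}" for b
  proof -
    have "\<not> k dvd b * h"
      using that assms by (auto simp: coprime_dvd_mult_left_iff coprime_commute dest: dvd_imp_le)
    then show ?thesis using that by (auto simp: dvd_eq_mod_eq_0)
  qed
  then have "(\<lambda>b. b * h mod k) ` {1..<k} \<subseteq> {1..<k}" by blast
  with inj show ?thesis
    by (simp add: bij_betw_def endo_inj_surj)
qed

lemma dedekind_sum_uminus:
  assumes "coprime a N" "a < N" "N > 1"
  shows "dedekind_sum (N - a) N = - dedekind_sum a N"
proof -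
  have "real (b * (N - a) mod N) = real N - real (b * a mod N)" if "b \<in> {1..<N}" for b
  proof -
    have "b * a mod N \<in> {1..<N}"
      using bij_betw_mult_mod[OF assms(1)] that by (auto simp: bij_betw_def)
    have "b * (N - a) + b * a = b * N"
      using assms by (simp flip: distrib_left)
    then have "(b * (N - a) mod N + b * a mod N) mod N = 0"
      by (metis mod_add_eq mod_mult_self2_is_0)
    then obtain j where j: "b * (N - a) mod N + b * a mod N = N * j"
      by (metis mod_0_imp_dvd dvdE)
    have "b * (N - a) mod N < N" using assms by simp
    moreover have "b * a mod N < N" "0 < b * a mod N" using \<open>b * a mod N \<in> {1..<N}\<close> by auto
    \<comment> \<open>Two nonzero residues add up to a multiple of \<open>N\<close> strictly between
      0 and \<open>2 * N\<close>, hence to \<open>N\<close>, and the sawtooth changes sign.\<close>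
    ultimately have "N * j < N * 2" "N * j > 0" using j by linarith+
    then have "j = 1" by auto
    then show ?thesis using j by simp
  qed
  then show ?thesis
    using assms unfolding dedekind_sum_altdef[OF order.strict_trans[OF zero_less_one assms(3)]] sum_negf[symmetric]
    by (intro sum.cong refl) (simp add: diff_divide_distrib flip: mult_minus_right)
qed

lemma sum_of_nat_real: "k > 0 \<Longrightarrow> (\<Sum>b=1..<k. real b) = real k * (real k - 1) / 2"
  by (induction k) (auto simp: sum.atLeastLessThan_Suc field_simps)

lemma sum_of_nat_sq_real:
  "k > 0 \<Longrightarrow> (\<Sum>b=1..<k. (real b)\<^sup>2) = real k * (real k - 1) * (2 * real k - 1) / 6"
proof (induction k)
  case (Suc k)
  then show ?case 
    by (cases "k = 0") (auto simp: sum.atLeastLessThan_Suc field_simps power2_eq_square)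
qed auto

lemma sum_twice_real: "(\<Sum>i=1..n. 2 * real i) = real n * (real n + 1)"
  by (induction n) (auto simp: field_simps)

text \<open>\<open>m * (m + 1)\<close> is the sum of \<open>2 * j\<close> over
  \<open>j \<le> m\<close>, so the left side weights the lattice points under the line of slope
  \<open>h / k\<close>. Summing by rows instead counts the points to the right of the line in row
  \<open>j\<close>; coprimality keeps lattice points off the line itself.\<close>

lemma sum_floor_lattice:
  fixes h k :: nat
  assumes "coprime h k" "h > 0" "k > 0"
  shows "(\<Sum>b=1..<k. real (b * h div k) * (real (b * h div k) + 1)) =
         (\<Sum>j=1..<h. 2 * real j * (real k - 1 - real (j * k div h)))"
proof -
  have lt: "b * h div k < h" if "b < k" for b
    using that assms by (simp add: less_mult_imp_div_less)
  have "(\<Sum>b=1..<k. real (b * h div k) * (real (b * h div k) + 1)) =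
        (\<Sum>b=1..<k. \<Sum>j=1..<h. if j * k \<le> b * h then 2 * real j else 0)"
  proof (intro sum.cong refl)
    fix b assume b: "b \<in> {1..<k}"
    have "{j \<in> {1..<h}. j * k \<le> b * h} = {1..b * h div k}"
    proof (rule Set.set_eqI)
      fix j
      have "j \<le> b * h div k \<longleftrightarrow> j * k \<le> b * h"
        using assms(3) by (rule less_eq_div_iff_mult_less_eq)
      moreover have "b * h div k < h" using lt b by simp
      ultimately show "j \<in> {j \<in> {1..<h}. j * k \<le> b * h} \<longleftrightarrow> j \<in> {1..b * h div k}"
        by (simp only: mem_Collect_eq atLeastLessThan_iff atLeastAtMost_iff) linarith
    qed
    then show "real (b * h div k) * (real (b * h div k) + 1) =
        (\<Sum>j=1..<h. if j * k \<le> b * h then 2 * real j else 0)"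
      using sum_twice_real[of "b * h div k"] by (simp add: sum.inter_filter[symmetric])
  qed
  also have "\<dots> = (\<Sum>j=1..<h. \<Sum>b=1..<k. if j * k \<le> b * h then 2 * real j else 0)"
    by (rule sum.swap)
  also have "\<dots> = (\<Sum>j=1..<h. 2 * real j * (real k - 1 - real (j * k div h)))"
  proof (intro sum.cong refl)
    fix j assume j: "j \<in> {1..<h}"
    have ne: "j * k \<noteq> b * h" if "b \<in> {1..<k}" for b
    proof
      assume "j * k = b * h"
      then have "h dvd j * k" by simp
      then have "h dvd j" using assms by (simp add: coprime_dvd_mult_left_iff)
      then show False using j by (auto dest: dvd_imp_le)
    qed
    have ltk: "j * k div h < k" using j assms by (simp add: less_mult_imp_div_less mult.commute)
    have "{b \<in> {1..<k}. j * k \<le> b * h} = {1..<k} - {1..j * k div h}"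
    proof (rule Set.set_eqI)
      fix b
      have "b \<le> j * k div h \<longleftrightarrow> b * h \<le> j * k" using assms by (simp add: less_eq_div_iff_mult_less_eq)
      then show "b \<in> {b \<in> {1..<k}. j * k \<le> b * h} \<longleftrightarrow> b \<in> {1..<k} - {1..j * k div h}"
        using ne[of b] by auto
    qed
    moreover have "card ({1..<k} - {1..j * k div h}) = (k - 1) - j * k div h"
      using ltk by (subst card_Diff_subset) auto
    ultimately have "card {b \<in> {1..<k}. j * k \<le> b * h} = (k - 1) - j * k div h" by simp
    then show "(\<Sum>b=1..<k. if j * k \<le> b * h then 2 * real j else 0) = 2 * real j * (real k - 1 - real (j * k div h))"
      using ltk by (simp add: sum.inter_filter[symmetric] of_nat_diff)
  qed
  finally show ?thesis .
qed

text \<open>Expanding the product leaves linear sums, and the residues \<open>b * h mod k\<close>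
  are a permutation of the \<open>b\<close>.\<close>

lemma dedekind_sum_moment:
  assumes "coprime h k" "h > 0" "k > 0"
  shows "(real k)\<^sup>2 * dedekind_sum h k = (\<Sum>b=1..<k. real b * real (b * h mod k)) - (real k)\<^sup>2 * (real k - 1) / 4"
proof -
  have s: "(\<Sum>b=1..<k. real (b * h mod k)) = (\<Sum>b=1..<k. real b)"
    by (rule sum.reindex_bij_betw[OF bij_betw_mult_mod[OF assms(1)]])
  have "(real k)\<^sup>2 * dedekind_sum h k = (\<Sum>b=1..<k. (real b - real k / 2) * (real (b * h mod k) - real k / 2))"
    unfolding dedekind_sum_altdef[OF assms(3)] sum_distrib_left using assms
    by (intro sum.cong refl) (simp add: field_simps power2_eq_square)
  also have "\<dots> = (\<Sum>b=1..<k. real b * real (b * h mod k) - real k / 2 * real b - real k / 2 * real (b * h mod k)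
       + (real k)\<^sup>2 / 4)"
    by (intro sum.cong refl) (simp add: field_simps power2_eq_square)
  also have "\<dots> = (\<Sum>b=1..<k. real b * real (b * h mod k)) - real k / 2 * (\<Sum>b=1..<k. real b)
       - real k / 2 * (\<Sum>b=1..<k. real (b * h mod k)) + (real k - 1) * (real k)\<^sup>2 / 4"
    using assms(3) by (simp add: sum.distrib sum_subtractf sum_distrib_left of_nat_diff)
  finally show ?thesis
    unfolding s sum_of_nat_real[OF assms(3)] by (simp add: field_simps power2_eq_square)
qed

text \<open>The permutation of residues also preserves the sum of squares. Substituting
  \<open>b * h - k * (b * h div k)\<close> for the residue expresses one Dedekind sum through
  \<open>F\<close> and the other through \<open>E\<close>. The lattice point count evaluates
  \<open>F + 2 * E\<close>, the only combination that occurs, so just power sums remain.\<close>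

theorem dedekind_reciprocity:
  assumes "coprime h k" "h > 0" "k > 0"
  shows "dedekind_sum h k + dedekind_sum k h =
    (real h / real k + real k / real h + 1 / (real h * real k)) / 12 - 1 / 4"
proof -
  define F where "F = (\<Sum>b=1..<k. (real (b * h div k))\<^sup>2)"
  define E where "E = (\<Sum>j=1..<h. real j * real (j * k div h))"
  have m: "real (b * h mod k) = real b * real h - real k * real (b * h div k)" for b h k
  proof -
    have "real (b * h) = real (k * (b * h div k) + b * h mod k)"
      by (simp only: mult_div_mod_eq)
    then show ?thesis unfolding of_nat_add of_nat_mult by linarith
  qed
  have s1: "(\<Sum>b=1..<k. real (b * h mod k)) = (\<Sum>b=1..<k. real b)"
    by (rule sum.reindex_bij_betw[OF bij_betw_mult_mod[OF assms(1)]])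
  have s2: "(\<Sum>b=1..<k. (real (b * h mod k))\<^sup>2) = (\<Sum>b=1..<k. (real b)\<^sup>2)"
    by (rule sum.reindex_bij_betw[OF bij_betw_mult_mod[OF assms(1)]])
  have f1: "(\<Sum>b=1..<k. real (b * h div k)) = (real h - 1) * (real k - 1) / 2"
  proof -
    have "(\<Sum>b=1..<k. real b) = real h * (\<Sum>b=1..<k. real b) - real k * (\<Sum>b=1..<k. real (b * h div k))"
      using s1 unfolding m by (simp add: sum_subtractf sum_distrib_left mult.commute)
    then have "real k * (\<Sum>b=1..<k. real (b * h div k)) = real k * ((real h - 1) * (real k - 1) / 2)"
      unfolding sum_of_nat_real[OF assms(3)] by (simp add: field_simps)
    then show ?thesis using assms(3) by simp
  qed
  have e: "F + (real h - 1) * (real k - 1) / 2 = (real k - 1) * real h * (real h - 1) - 2 * E"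
  proof -
    have "F + (real h - 1) * (real k - 1) / 2 = (\<Sum>b=1..<k. real (b * h div k) * (real (b * h div k) + 1))"
      unfolding F_def f1[symmetric] by (simp add: sum.distrib[symmetric] algebra_simps power2_eq_square)
    also have "\<dots> = 2 * (real k - 1) * (\<Sum>j=1..<h. real j) - 2 * E"
      unfolding sum_floor_lattice[OF assms] E_def
      by (simp add: sum_distrib_left sum_subtractf[symmetric] algebra_simps)
    finally show ?thesis unfolding sum_of_nat_real[OF assms(2)] by (simp add: field_simps)
  qed
  have d1: "2 * real h * ((real k)\<^sup>2 * dedekind_sum h k) =
     ((real h)\<^sup>2 + 1) * (\<Sum>b=1..<k. (real b)\<^sup>2) - (real k)\<^sup>2 * F - real h * (real k)\<^sup>2 * (real k - 1) / 2"
  proof -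
    have "2 * real h * (\<Sum>b=1..<k. real b * real (b * h mod k)) + (real k)\<^sup>2 * F =
      (real h)\<^sup>2 * (\<Sum>b=1..<k. (real b)\<^sup>2) + (\<Sum>b=1..<k. (real (b * h mod k))\<^sup>2)"
      unfolding F_def sum_distrib_left sum.distrib[symmetric] m
      by (intro sum.cong refl) (simp add: algebra_simps power2_eq_square)
    then show ?thesis unfolding dedekind_sum_moment[OF assms] s2 by (simp add: field_simps)
  qed
  have d2: "(real h)\<^sup>2 * dedekind_sum k h = real k * (\<Sum>j=1..<h. (real j)\<^sup>2) - real h * E - (real h)\<^sup>2 * (real h - 1) / 4"
  proof -
    have "(\<Sum>j=1..<h. real j * real (j * k mod h)) = real k * (\<Sum>j=1..<h. (real j)\<^sup>2) - real h * E"
      unfolding E_def sum_distrib_left sum_subtractf[symmetric] m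
      by (intro sum.cong refl) (simp add: algebra_simps power2_eq_square)
    then show ?thesis using dedekind_sum_moment[of k h] assms by (simp add: coprime_commute)
  qed
  let ?h = "real h" and ?k = "real k"
  have pos: "?h > 0" "?k > 0" using assms by auto
  have Fe: "F = (?k - 1) * ?h * (?h - 1) - 2 * E - (?h - 1) * (?k - 1) / 2" using e by simp
  have "2 * ?h\<^sup>2 * ?k\<^sup>2 * (dedekind_sum h k + dedekind_sum k h) =
        ?h * (2 * ?h * (?k\<^sup>2 * dedekind_sum h k)) + 2 * ?k\<^sup>2 * (?h\<^sup>2 * dedekind_sum k h)"
    by (simp add: algebra_simps power2_eq_square)
  also have "\<dots> = 2 * ?h\<^sup>2 * ?k\<^sup>2 * ((?h / ?k + ?k / ?h + 1 / (?h * ?k)) / 12 - 1 / 4)"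
    unfolding d1 d2 Fe sum_of_nat_sq_real[OF assms(2)] sum_of_nat_sq_real[OF assms(3)] using pos
    by (simp add: field_simps power2_eq_square)
  finally show ?thesis using pos by simp
qed

section \<open>Convergent vectors\<close>

text \<open>Meant for determinants: for two lattice vectors, \<open>q * r' - q' * r\<close> is a
  multiple of \<open>N\<close>, so a bound below \<open>N\<close> makes them parallel.\<close>

lemma abs_mult_less_imp_eq_0:
  fixes x N :: int
  assumes "\<bar>x * N\<bar> < N"
  shows "x = 0"
proof -
  have "\<bar>x\<bar> * \<bar>N\<bar> < 1 * \<bar>N\<bar>" using assms by (simp add: abs_mult)
  then have "\<bar>x\<bar> < 1" by (rule mult_right_less_imp_less) simp
  then show ?thesis by simp
qed

lemma coprime_if_bezout:
  fixes q p q0 p0 :: int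
  assumes "q0 * p - q * p0 = 1"
  shows "coprime q p" "coprime q q0"
proof -
  have "d dvd 1" if "d dvd q" "d dvd p \<or> d dvd q0" for d
    unfolding assms[symmetric] using that by auto
  then show "coprime q p" "coprime q q0" by (blast intro: coprimeI)+
qed

text \<open>A vector \<open>(q, r)\<close> is stored as the pair \<open>(q, p)\<close> with \<open>r = a q - p N\<close>, so that being primitive in the
  lattice of all \<open>(q, r)\<close> with \<open>r = a q\<close> modulo \<open>N\<close> is coprimality of the two components.\<close>

definition lattice_res :: "int \<Rightarrow> int \<Rightarrow> int \<times> int \<Rightarrow> int" where
  "lattice_res N a v = a * fst v - snd v * N"

text \<open>Since \<open>|a/N - p/q| = |r| / (q N)\<close>, the last condition is Legendre's
  criterion \<open>|a/N - p/q| < 1 / (2 q^2)\<close>. Residue 0 means \<open>p/q = a/N\<close>,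
  which has no finite quality.\<close>

definition conv_vecs :: "int \<Rightarrow> int \<Rightarrow> (int \<times> int) set" where
  "conv_vecs N a = {v. fst v > 0 \<and> coprime (fst v) (snd v) \<and> lattice_res N a v \<noteq> 0
      \<and> 2 * (fst v * \<bar>lattice_res N a v\<bar>) < N}"

definition quality :: "int \<Rightarrow> int \<Rightarrow> int \<times> int \<Rightarrow> real" where
  "quality N a v = real_of_int N / real_of_int (fst v * \<bar>lattice_res N a v\<bar>)"

definition signed_term :: "(real \<Rightarrow> real) \<Rightarrow> int \<Rightarrow> int \<Rightarrow> int \<times> int \<Rightarrow> real" where
  "signed_term g N a v = real_of_int (sgn (lattice_res N a v)) * g (quality N a v)"

definition conv_sum :: "(real \<Rightarrow> real) \<Rightarrow> int \<Rightarrow> int \<Rightarrow> real" where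
  "conv_sum g N a = (\<Sum>v\<in>conv_vecs N a. signed_term g N a v)"

lemma conv_vecsD:
  assumes "v \<in> conv_vecs N a"
  shows "fst v \<ge> 1" "coprime (fst v) (snd v)" "\<bar>lattice_res N a v\<bar> \<ge> 1"
    "2 * (fst v * \<bar>lattice_res N a v\<bar>) < N" "2 * fst v < N" "2 * \<bar>lattice_res N a v\<bar> < N"
proof -
  have v: "fst v \<ge> 1" "coprime (fst v) (snd v)" "\<bar>lattice_res N a v\<bar> \<ge> 1"
    "2 * (fst v * \<bar>lattice_res N a v\<bar>) < N"
    using assms by (auto simp: conv_vecs_def)
  have "fst v * 1 \<le> fst v * \<bar>lattice_res N a v\<bar>" using v by (intro mult_left_mono) auto
  moreover have "1 * \<bar>lattice_res N a v\<bar> \<le> fst v * \<bar>lattice_res N a v\<bar>"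
    using v by (intro mult_right_mono) auto
  ultimately show "2 * fst v < N" "2 * \<bar>lattice_res N a v\<bar> < N" using v by linarith+
qed (use assms in \<open>auto simp: conv_vecs_def\<close>)

text \<open>Weights vanish up to 2, so sums over convergent vectors may be extended to other
  primitive vectors with positive denominator and nonzero residue.\<close>

lemma quality_le_2:
  assumes "fst v > 0" "coprime (fst v) (snd v)" "lattice_res N a v \<noteq> 0" "v \<notin> conv_vecs N a"
  shows "quality N a v \<le> 2"
proof -
  have "N \<le> 2 * (fst v * \<bar>lattice_res N a v\<bar>)" "fst v * \<bar>lattice_res N a v\<bar> > 0"
    using assms by (auto simp: conv_vecs_def)
  then have "real_of_int N \<le> 2 * real_of_int (fst v * \<bar>lattice_res N a v\<bar>)"
    "real_of_int (fst v * \<bar>lattice_res N a v\<bar>) > 0" by linarith+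
  then show ?thesis unfolding quality_def by (subst divide_le_eq) simp
qed

lemma finite_conv_vecs [simp, intro]: "finite (conv_vecs N a)"
proof (rule finite_subset)
  show "conv_vecs N a \<subseteq> {0..N} \<times> {-(\<bar>a\<bar> * N + N)..\<bar>a\<bar> * N + N}"
  proof
    fix v assume v: "v \<in> conv_vecs N a"
    note D = conv_vecsD[OF v]
    have N: "N > 0" using D by linarith
    have "\<bar>y\<bar> \<le> \<bar>x\<bar> + N" if "2 * \<bar>x - y\<bar> < N" for x y :: int
      using that N by (smt (verit))
    then have "\<bar>snd v * N\<bar> \<le> \<bar>a * fst v\<bar> + N"
      using D(6) unfolding lattice_res_def by blast
    also have "\<bar>a * fst v\<bar> \<le> \<bar>a\<bar> * N"
      unfolding abs_mult using D by (intro mult_left_mono) auto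
    finally have *: "\<bar>snd v * N\<bar> \<le> \<bar>a\<bar> * N + N" by simp
    have "\<bar>snd v\<bar> * 1 \<le> \<bar>snd v * N\<bar>" unfolding abs_mult using N by (intro mult_left_mono) auto
    with * have "\<bar>snd v\<bar> \<le> \<bar>a\<bar> * N + N" by linarith
    then show "v \<in> {0..N} \<times> {-(\<bar>a\<bar> * N + N)..\<bar>a\<bar> * N + N}"
      using D by (cases v) auto
  qed
qed auto

text \<open>With equal denominators the residues differ by a multiple of \<open>N\<close>, while
  both are below \<open>N / 2\<close> in absolute value.\<close>

lemma conv_vecs_inj_fst: "inj_on fst (conv_vecs N a)"
proof (rule inj_onI)
  fix v v' assume v: "v \<in> conv_vecs N a" "v' \<in> conv_vecs N a" "fst v = fst v'"
  have "lattice_res N a v - lattice_res N a v' = (snd v' - snd v) * N"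
    using v(3) by (simp add: lattice_res_def algebra_simps)
  moreover have "2 * \<bar>lattice_res N a v\<bar> < N" "2 * \<bar>lattice_res N a v'\<bar> < N"
    using conv_vecsD v by blast+
  ultimately have "\<bar>(snd v' - snd v) * N\<bar> < N" by linarith
  then have "snd v' - snd v = 0" by (rule abs_mult_less_imp_eq_0)
  then show "v = v'" using v(3) by (simp add: prod_eq_iff)
qed

text \<open>Otherwise the determinant of the two vectors is at most \<open>2 * q' * |r'| < N\<close>
  in absolute value, hence zero, and primitive parallel vectors have equal denominators. The
  convergent vectors thus form a chain, as convergents should.\<close>

lemma conv_vecs_res_decreasing:
  assumes v: "v \<in> conv_vecs N a" "v' \<in> conv_vecs N a" "fst v < fst v'"
  shows "\<bar>lattice_res N a v'\<bar> < \<bar>lattice_res N a v\<bar>"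
proof (rule ccontr)
  assume *: "\<not> ?thesis"
  define r where "r = lattice_res N a v"
  define r' where "r' = lattice_res N a v'"
  define l where "l = fst v' * snd v - fst v * snd v'"
  note D = conv_vecsD[OF v(1)] and D' = conv_vecsD[OF v(2)]
  have l: "l * N = fst v * r' - fst v' * r" by (simp add: l_def r_def r'_def lattice_res_def algebra_simps)
  have "fst v' * \<bar>r\<bar> \<le> fst v' * \<bar>r'\<bar>" using * D' by (intro mult_left_mono) (auto simp: r_def r'_def)
  moreover have "fst v * \<bar>r'\<bar> \<le> fst v' * \<bar>r'\<bar>" using v by (intro mult_right_mono) auto
  moreover have "2 * (fst v' * \<bar>r'\<bar>) < N" using D' by (simp add: r'_def)
  moreover have "\<bar>fst v' * r\<bar> = fst v' * \<bar>r\<bar>" "\<bar>fst v * r'\<bar> = fst v * \<bar>r'\<bar>"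
    using D D' by (simp_all add: abs_mult)
  ultimately have "\<bar>fst v * r' - fst v' * r\<bar> < N" by linarith
  then have "l = 0" unfolding l[symmetric] by (rule abs_mult_less_imp_eq_0)
  then have e: "fst v' * snd v = fst v * snd v'" by (simp add: l_def)
  then have "fst v dvd fst v' * snd v" "fst v' dvd fst v * snd v'" by (metis dvd_triv_left)+
  then have "fst v dvd fst v'" "fst v' dvd fst v" using D(2) D'(2)
    by (auto simp: coprime_dvd_mult_left_iff)
  then have "fst v = fst v'" using D(1) D'(1) by (simp add: zdvd_antisym_nonneg)
  then show False using v by simp
qed

section \<open>Symmetries: shifting \<open>a\<close> by \<open>N\<close> and reflecting
  \<open>a\<close>\<close>

lemma bij_betw_conv_vecs_periodic:
  "bij_betw (\<lambda>v. (fst v, snd v + k * fst v)) (conv_vecs N a) (conv_vecs N (a + k * N))"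
proof (rule bij_betw_byWitness[where f' = "\<lambda>v. (fst v, snd v - k * fst v)"])
  have res: "lattice_res N (a + k * N) (fst v, snd v + k * fst v) = lattice_res N a v" for v a k
    by (simp add: lattice_res_def algebra_simps)
  have cop: "coprime q (p + k * q) \<longleftrightarrow> coprime q p" for p q k :: int
    by (metis coprime_iff_gcd_eq_1 gcd_add_mult add.commute)
  show "(\<lambda>v. (fst v, snd v + k * fst v)) ` conv_vecs N a \<subseteq> conv_vecs N (a + k * N)"
    using res[of a k] by (auto simp: conv_vecs_def cop)
  show "(\<lambda>v. (fst v, snd v - k * fst v)) ` conv_vecs N (a + k * N) \<subseteq> conv_vecs N a"
    using res[of "a + k * N" "-k"] cop[of _ _ "-k"] by (auto simp: conv_vecs_def)
qed auto

lemma conv_sum_periodic: "conv_sum g N (a + k * N) = conv_sum g N a"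
proof -
  have "lattice_res N (a + k * N) (fst v, snd v + k * fst v) = lattice_res N a v" for v
    by (simp add: lattice_res_def algebra_simps)
  then have "signed_term g N (a + k * N) (fst v, snd v + k * fst v) = signed_term g N a v" for v
    by (simp add: signed_term_def quality_def)
  then show ?thesis
    unfolding conv_sum_def
    using sum.reindex_bij_betw[OF bij_betw_conv_vecs_periodic, of "signed_term g N (a + k * N)" k N a]
    by simp
qed

lemma conv_sum_mod: "conv_sum g N (a mod N) = conv_sum g N a"
  using conv_sum_periodic[of g N "a mod N" "a div N"] by (simp add: mod_div_mult_eq)

definition flip_vec :: "int \<times> int \<Rightarrow> int \<times> int" where
  "flip_vec v = (fst v, fst v - snd v)"

lemma flip_vec:
  "fst (flip_vec v) = fst v" "flip_vec (flip_vec v) = v"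
  "lattice_res N (N - a) (flip_vec v) = - lattice_res N a v"
  "v \<in> conv_vecs N a \<Longrightarrow> flip_vec v \<in> conv_vecs N (N - a)"
  "signed_term g N (N - a) (flip_vec v) = - signed_term g N a v"
proof -
  show f: "fst (flip_vec v) = fst v" and "flip_vec (flip_vec v) = v" by (simp_all add: flip_vec_def)
  show r: "lattice_res N (N - a) (flip_vec v) = - lattice_res N a v"
    by (simp add: flip_vec_def lattice_res_def algebra_simps)
  show "signed_term g N (N - a) (flip_vec v) = - signed_term g N a v"
    by (simp add: signed_term_def quality_def r f sgn_minus)
  assume v: "v \<in> conv_vecs N a"
  have "coprime (fst v) (fst v - snd v)"
  proof (rule coprimeI)
    fix d assume "d dvd fst v" "d dvd fst v - snd v"
    then have "d dvd fst v" "d dvd fst v - (fst v - snd v)" by (blast intro: dvd_diff)+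
    then show "is_unit d" using coprime_common_divisor[OF conv_vecsD(2)[OF v]] by simp
  qed
  then show "flip_vec v \<in> conv_vecs N (N - a)"
    using v r f by (simp add: conv_vecs_def) (simp add: flip_vec_def)
qed

lemma bij_betw_flip_vec:
  "bij_betw flip_vec {v \<in> conv_vecs N a. P (fst v)} {v \<in> conv_vecs N (N - a). P (fst v)}"
proof (rule bij_betw_byWitness[where f' = flip_vec])
  show "flip_vec ` {v \<in> conv_vecs N (N - a). P (fst v)} \<subseteq> {v \<in> conv_vecs N a. P (fst v)}"
    using flip_vec(4)[of _ N "N - a"] by (auto simp: flip_vec)
qed (auto simp: flip_vec)

lemma conv_sum_uminus: "conv_sum g N (- a) = - conv_sum g N a"
proof -
  have "conv_sum g N (- a) = conv_sum g N (N - a)" using conv_sum_periodic[of g N "- a" 1] by simp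
  also have "\<dots> = (\<Sum>v\<in>conv_vecs N a. signed_term g N (N - a) (flip_vec v))"
    unfolding conv_sum_def
    using sum.reindex_bij_betw[OF bij_betw_flip_vec[where P = "\<lambda>_. True"], of "signed_term g N (N - a)" N a] by simp
  finally show ?thesis by (simp add: flip_vec conv_sum_def sum_negf)
qed

lemma sum_inverse_squares_le: "(\<Sum>l=1..n. 1 / (real l)\<^sup>2) \<le> 2"
proof -
  have "(\<Sum>l=1..n. 1 / (real l)\<^sup>2) \<le> 2 - 1 / real n" if "n > 0" for n
    using that
  proof (induction n rule: nat_induct_non_zero)
    case (Suc n)
    have "1 / (real (Suc n))\<^sup>2 \<le> 1 / (real n * real (Suc n))"
      using Suc by (intro divide_left_mono) (auto simp: power2_eq_square)
    also have "\<dots> = 1 / real n - 1 / real (Suc n)" using Suc by (simp add: field_simps)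
    finally show ?case using Suc by simp
  qed auto
  note * = this
  show ?thesis
  proof (cases "n = 0")
    case False
    then have "(\<Sum>l=1..n. 1 / (real l)\<^sup>2) \<le> 2 - 1 / real n" using * by blast
    also have "\<dots> \<le> 2" by simp
    finally show ?thesis .
  qed auto
qed

lemma card_residues_near_zero:
  fixes x y :: int
  assumes "y > 0"
  shows "finite {c. \<bar>x - c * y\<bar> < y}" "card {c. \<bar>x - c * y\<bar> < y} \<le> 2"
proof -
  have sub: "{c. \<bar>x - c * y\<bar> < y} \<subseteq> {x div y, x div y + 1}"
  proof
    fix c assume c: "c \<in> {c. \<bar>x - c * y\<bar> < y}"
    define m where "m = x mod y"
    define k where "k = x div y"
    have "x - c * y = (k - c) * y + m"
      using mult_div_mod_eq[of y x] by (simp add: m_def k_def algebra_simps)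
    then have "\<bar>(k - c) * y + m\<bar> < y" using c by simp
    moreover have "0 \<le> m" "m < y" using assms by (auto simp: m_def)
    ultimately have "(k - c) * y < 1 * y" "(-2) * y < (k - c) * y" by linarith+
    then have "k - c < 1" "-2 < k - c" using assms by (auto simp only: mult_less_cancel_right_pos)
    then show "c \<in> {x div y, x div y + 1}" unfolding k_def by auto
  qed
  then show "finite {c. \<bar>x - c * y\<bar> < y}" by (rule finite_subset) auto
  have "card {c. \<bar>x - c * y\<bar> < y} \<le> card {x div y, x div y + 1}"
    using sub by (intro card_mono) auto
  also have "\<dots> \<le> 2" by (simp add: card_insert_if)
  finally show "card {c. \<bar>x - c * y\<bar> < y} \<le> 2" .
qed

text \<open>Each first coordinate \<open>l\<close> admits at most two second coordinates, and the
  sum of \<open>1 / l^2\<close> is at most 2. This is the origin of the 4 in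
  \<open>tail_sum_approx\<close>.\<close>

lemma sum_inverse_squares_lattice_le:
  fixes y s :: int
  assumes "finite U" "y > 0" "\<And>w. w \<in> U \<Longrightarrow> fst w \<ge> 1 \<and> \<bar>s * fst w - snd w * y\<bar> < y"
  shows "(\<Sum>w\<in>U. 1 / (real_of_int (fst w))\<^sup>2) \<le> 4"
proof -
  define n where "n = nat (Max (insert 1 (fst ` U)))"
  define C where "C = (\<lambda>l::nat. {c. \<bar>s * int l - c * y\<bar> < y})"
  have "U \<subseteq> (\<lambda>(l, c). (int l, c)) ` Sigma {1..n} C"
  proof
    fix w assume w: "w \<in> U"
    have "fst w \<le> Max (insert 1 (fst ` U))" using w assms(1) by (intro Max_ge) auto
    then have "nat (fst w) \<in> {1..n}" "int (nat (fst w)) = fst w"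
      using assms(3)[OF w] by (auto simp: n_def)
    moreover have "snd w \<in> C (nat (fst w))" using assms(3)[OF w] by (auto simp: C_def)
    ultimately show "w \<in> (\<lambda>(l, c). (int l, c)) ` Sigma {1..n} C"
      by (intro image_eqI[of _ _ "(nat (fst w), snd w)"]) auto
  qed
  moreover have fin: "finite (C l)" "card (C l) \<le> 2" for l
    unfolding C_def using card_residues_near_zero[OF assms(2)] by auto
  ultimately have "(\<Sum>w\<in>U. 1 / (real_of_int (fst w))\<^sup>2) \<le>
      (\<Sum>w\<in>(\<lambda>(l, c). (int l, c)) ` Sigma {1..n} C. 1 / (real_of_int (fst w))\<^sup>2)"
    by (intro sum_mono2) auto
  also have "\<dots> = (\<Sum>w\<in>Sigma {1..n} C. 1 / (real (fst w))\<^sup>2)"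
    by (subst sum.reindex) (auto simp: inj_on_def case_prod_beta)
  also have "\<dots> = (\<Sum>l=1..n. \<Sum>c\<in>C l. 1 / (real l)\<^sup>2)"
    using fin by (subst sum.Sigma) (auto simp: case_prod_beta)
  also have "\<dots> \<le> (\<Sum>l=1..n. 2 * (1 / (real l)\<^sup>2))"
  proof (intro sum_mono)
    fix l
    have "real (card (C l)) * (1 / (real l)\<^sup>2) \<le> 2 * (1 / (real l)\<^sup>2)"
      using fin(2)[of l] by (intro mult_right_mono) auto
    then show "(\<Sum>c\<in>C l. 1 / (real l)\<^sup>2) \<le> 2 * (1 / (real l)\<^sup>2)" by simp
  qed
  also have "\<dots> \<le> 2 * 2"
    unfolding sum_distrib_left[symmetric] using sum_inverse_squares_le[of n] by (intro mult_left_mono) auto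
  finally show ?thesis by simp
qed

text \<open>In the basis \<open>(q, p)\<close>, \<open>(q0, p0)\<close> of the integer plane, the vectors following \<open>(q, p)\<close> become the convergent
  vectors of \<open>-s/y\<close>; the residues stay the same and the qualities move by at most \<open>1/l^2\<close>, where \<open>l\<close> is the
  new denominator.\<close>

lemma tail_sum_approx:
  fixes g :: "real \<Rightarrow> real"
  assumes lip: "\<And>x y. \<bar>g x - g y\<bar> \<le> \<bar>x - y\<bar>" and zero: "\<And>x. x \<le> 2 \<Longrightarrow> g x = 0"
    and qp: "(q, p) \<in> conv_vecs N a" and y: "y = a * q - p * N" "y > 0"
    and bez: "q0 * p - q * p0 = 1" and s: "s = a * q0 - p0 * N"
  shows "\<bar>(\<Sum>v | v \<in> conv_vecs N a \<and> fst v > q. signed_term g N a v) - conv_sum g y (- s)\<bar> \<le> 4"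
proof -
  have q: "q \<ge> 1" and qy: "2 * (q * y) < N"
    using conv_vecsD[OF qp] y by (auto simp: lattice_res_def)
  have N: "N > 0" using q qy y(2) by (smt (verit) mult_pos_pos)
  have Ns: "N = q * s - q0 * y"
  proof -
    have "q * s - q0 * y = N * (q0 * p - q * p0)" unfolding s y by (simp add: algebra_simps)
    then show ?thesis using bez by simp
  qed
  \<comment> \<open>\<open>\<psi> (l, c)\<close> is \<open>-(l * (q0, p0) + c * (q, p))\<close>, a
    unimodular change of coordinates. The sign gives it the residue
    \<open>(- s) * l - c * y\<close>, the form that belongs to modulus \<open>y\<close> and
    numerator \<open>- s\<close>.\<close>
  define \<psi> where "\<psi> = (\<lambda>w::int\<times>int. (- fst w * q0 - snd w * q, - fst w * p0 - snd w * p))"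
  define \<phi> where "\<phi> = (\<lambda>v::int\<times>int. (q * snd v - fst v * p, fst v * p0 - snd v * q0))"
  have \<psi>\<phi>: "\<psi> (\<phi> v) = v" for v
  proof -
    have "fst (\<psi> (\<phi> v)) = fst v * (q0 * p - q * p0)" "snd (\<psi> (\<phi> v)) = snd v * (q0 * p - q * p0)"
      by (simp_all add: \<psi>_def \<phi>_def algebra_simps)
    then show ?thesis using bez by (simp add: prod_eq_iff)
  qed
  have \<phi>\<psi>: "\<phi> (\<psi> w) = w" for w
  proof -
    have "fst (\<phi> (\<psi> w)) = fst w * (q0 * p - q * p0)" "snd (\<phi> (\<psi> w)) = snd w * (q0 * p - q * p0)"
      by (simp_all add: \<psi>_def \<phi>_def algebra_simps)
    then show ?thesis using bez by (simp add: prod_eq_iff)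
  qed
  have res: "lattice_res N a (\<psi> w) = lattice_res y (-s) w" for w
    by (simp add: lattice_res_def \<psi>_def s y algebra_simps)
  have cop\<psi>: "coprime (fst (\<psi> w)) (snd (\<psi> w)) \<longleftrightarrow> coprime (fst w) (snd w)" for w
  proof -
    have "d dvd fst w \<and> d dvd snd w \<longleftrightarrow> d dvd fst (\<psi> w) \<and> d dvd snd (\<psi> w)" for d
    proof
      assume "d dvd fst (\<psi> w) \<and> d dvd snd (\<psi> w)"
      then have "d dvd fst (\<phi> (\<psi> w)) \<and> d dvd snd (\<phi> (\<psi> w))" unfolding \<phi>_def by auto
      then show "d dvd fst w \<and> d dvd snd w" by (simp add: \<phi>\<psi>)
    qed (auto simp: \<psi>_def)
    then show ?thesis unfolding coprime_def by metis
  qed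
  have key: "fst (\<psi> w) * y = fst w * N + q * lattice_res y (-s) w" for w
    unfolding Ns by (simp add: \<psi>_def lattice_res_def algebra_simps)

  define V1 where "V1 = {v \<in> conv_vecs N a. fst v > q}"
  \<comment> \<open>The two index sets need not correspond exactly. A vector in only one of them has
    quality at most 2 on the other side, where its weight is 0, so both sums may run over the
    union.\<close>
  define U where "U = conv_vecs y (-s) \<union> \<phi> ` V1"
  have U: "fst w \<ge> 1 \<and> \<bar>lattice_res y (-s) w\<bar> < y \<and> lattice_res y (-s) w \<noteq> 0 \<and>
      coprime (fst w) (snd w) \<and> fst (\<psi> w) > q" if "w \<in> U" for w
    using that unfolding U_def
  proof
    assume w: "w \<in> conv_vecs y (-s)"
    note D = conv_vecsD[OF w]
    have "fst w * N \<ge> 1 * N" using D N by (intro mult_right_mono) auto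
    moreover have "q * lattice_res y (-s) w \<ge> q * (- y)"
      using D q by (intro mult_left_mono) auto
    ultimately have "fst (\<psi> w) * y \<ge> N - q * y" using key[of w] by simp
    then have "q * y < fst (\<psi> w) * y" using qy by linarith
    then have "q < fst (\<psi> w)" using y by simp
    then show ?thesis using D by auto
  next
    assume "w \<in> \<phi> ` V1"
    then obtain v where vw: "v \<in> V1" "w = \<phi> v" by auto
    then have v: "v \<in> conv_vecs N a" "fst v > q" and \<psi>w: "\<psi> w = v" by (auto simp: V1_def \<psi>\<phi>)
    note D = conv_vecsD[OF v(1)]
    define r where "r = lattice_res N a v"
    have r: "r = lattice_res y (-s) w" using res[of w] \<psi>w by (simp add: r_def)
    have k: "fst v * y = fst w * N + q * r" using key[of w] \<psi>w r by simp
    have ry: "\<bar>r\<bar> < y"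
      using conv_vecs_res_decreasing[OF qp v(1)] v(2) y by (simp add: r_def lattice_res_def)
    have "q * \<bar>r\<bar> < fst v * y" using ry v(2) q by (intro mult_strict_mono) auto
    moreover have "\<bar>q * r\<bar> = q * \<bar>r\<bar>" using q by (simp add: abs_mult)
    ultimately have "fst w * N > 0" using k by linarith
    then have "fst w > 0" using N by (simp add: zero_less_mult_iff)
    then show ?thesis using ry r D v(2) \<psi>w cop\<psi>[of w] by (auto simp: r_def)
  qed
  have finU: "finite U" by (auto simp: U_def V1_def)
  have inj: "inj_on \<phi> V1" by (metis inj_on_inverseI \<psi>\<phi>)
  have e1: "(\<Sum>v\<in>V1. signed_term g N a v) = (\<Sum>w\<in>U. signed_term g N a (\<psi> w))"
  proof -
    have "(\<Sum>v\<in>V1. signed_term g N a v) = (\<Sum>w\<in>\<phi> ` V1. signed_term g N a (\<psi> w))"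
      by (subst sum.reindex[OF inj]) (simp add: \<psi>\<phi>)
    also have "\<dots> = (\<Sum>w\<in>U. signed_term g N a (\<psi> w))"
    proof (rule sum.mono_neutral_left[OF finU])
      show "\<forall>w\<in>U - \<phi> ` V1. signed_term g N a (\<psi> w) = 0"
      proof
        fix w assume w: "w \<in> U - \<phi> ` V1"
        then have "\<psi> w \<notin> V1" by (metis DiffE \<phi>\<psi> image_eqI)
        moreover have "fst (\<psi> w) > q" using U w by auto
        ultimately have "\<psi> w \<notin> conv_vecs N a" by (simp add: V1_def)
        then have "quality N a (\<psi> w) \<le> 2" using U[of w] w q res[of w] cop\<psi>[of w]
          by (intro quality_le_2) auto
        then show "signed_term g N a (\<psi> w) = 0" by (simp add: signed_term_def zero)
      qed
    qed (auto simp: U_def)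
    finally show ?thesis .
  qed
  have e2: "conv_sum g y (-s) = (\<Sum>w\<in>U. signed_term g y (-s) w)"
    unfolding conv_sum_def
  proof (rule sum.mono_neutral_left[OF finU])
    show "\<forall>w\<in>U - conv_vecs y (-s). signed_term g y (-s) w = 0"
    proof
      fix w assume w: "w \<in> U - conv_vecs y (-s)"
      then have "quality y (-s) w \<le> 2" using U[of w] by (intro quality_le_2) auto
      then show "signed_term g y (-s) w = 0" by (simp add: signed_term_def zero)
    qed
  qed (auto simp: U_def)
  have termb: "\<bar>signed_term g N a (\<psi> w) - signed_term g y (-s) w\<bar> \<le> 1 / (real_of_int (fst w))\<^sup>2" if "w \<in> U" for w
  proof -
    note W = U[OF that]
    define r where "r = lattice_res y (-s) w"
    define l where "l = fst w"
    define q' where "q' = fst (\<psi> w)"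
    have r: "r \<noteq> 0" "\<bar>r\<bar> < y" and l: "l \<ge> 1" and q': "q' > q" using W by (auto simp: r_def l_def q'_def)
    have k: "q' * y = l * N + q * r" using key by (simp add: q'_def l_def r_def)
    \<comment> \<open>Since \<open>2 * q * y < N\<close>, the term \<open>l * N\<close> in
      \<open>k\<close> is at least \<open>2 * l * q * y\<close>; half of it absorbs the loss
      \<open>q * |r| < q * y\<close>.\<close>
    have "l * q \<le> q'"
    proof -
      have "l * (q * y) \<ge> 1 * (q * y)" using l q y by (intro mult_right_mono) auto
      moreover have "l * (2 * (q * y)) \<le> l * N" using qy l by (intro mult_left_mono) auto
      moreover have "(l * q) * y = l * (2 * (q * y)) - l * (q * y)" by (simp add: algebra_simps)
      ultimately have "(l * q) * y \<le> l * N - q * y" by linarith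
      moreover have "q * (- y) \<le> q * r" using r q by (intro mult_left_mono) auto
      ultimately have "(l * q) * y \<le> q' * y" using k by simp
      then show ?thesis using y by simp
    qed
    have pos: "real_of_int l > 0" "real_of_int q' > 0" "real_of_int \<bar>r\<bar> > 0" using l q' q r by auto
    have kr: "real_of_int q' * real_of_int y = real_of_int l * real_of_int N + real_of_int q * real_of_int r"
      using k by (metis of_int_add of_int_mult)
    have "quality N a (\<psi> w) - quality y (-s) w =
        real_of_int N / (real_of_int q' * real_of_int \<bar>r\<bar>) - real_of_int y / (real_of_int l * real_of_int \<bar>r\<bar>)"
      unfolding quality_def res by (simp add: l_def q'_def r_def)
    also have "\<dots> = (real_of_int l * real_of_int N - real_of_int q' * real_of_int y) /
        (real_of_int l * real_of_int q' * real_of_int \<bar>r\<bar>)"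
      using pos by (simp add: field_simps)
    also have "\<dots> = - (real_of_int q * real_of_int r) / (real_of_int l * real_of_int q' * real_of_int \<bar>r\<bar>)"
      unfolding kr by simp
    finally have "\<bar>quality N a (\<psi> w) - quality y (-s) w\<bar> =
        real_of_int q * \<bar>real_of_int r\<bar> / (real_of_int l * real_of_int q' * real_of_int \<bar>r\<bar>)"
      using pos q by (simp add: abs_mult)
    also have "\<dots> = real_of_int q / (real_of_int l * real_of_int q')" using pos by simp
    also have "\<dots> \<le> real_of_int q / (real_of_int l * real_of_int (l * q))"
      using \<open>l * q \<le> q'\<close> pos q l by (intro divide_left_mono mult_left_mono) (auto simp del: of_int_mult)
    also have "\<dots> = 1 / (real_of_int l)\<^sup>2" using q by (simp add: power2_eq_square)
    finally have diff: "\<bar>quality N a (\<psi> w) - quality y (-s) w\<bar> \<le> 1 / (real_of_int l)\<^sup>2" .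
    have "\<bar>signed_term g N a (\<psi> w) - signed_term g y (-s) w\<bar> =
        \<bar>real_of_int (sgn r) * (g (quality N a (\<psi> w)) - g (quality y (-s) w))\<bar>"
      unfolding signed_term_def res r_def by (simp add: algebra_simps)
    also have "\<dots> = \<bar>g (quality N a (\<psi> w)) - g (quality y (-s) w)\<bar>"
      using r by (simp add: abs_mult sgn_if)
    also have "\<dots> \<le> 1 / (real_of_int l)\<^sup>2" using lip diff order_trans by blast
    finally show ?thesis by (simp add: l_def)
  qed
  have "\<bar>(\<Sum>v\<in>V1. signed_term g N a v) - conv_sum g y (- s)\<bar> =
      \<bar>\<Sum>w\<in>U. signed_term g N a (\<psi> w) - signed_term g y (-s) w\<bar>"
    unfolding e1 e2 sum_subtractf ..
  also have "\<dots> \<le> (\<Sum>w\<in>U. 1 / (real_of_int (fst w))\<^sup>2)"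
    by (rule order_trans[OF sum_abs sum_mono]) (rule termb)
  also have "\<dots> \<le> 4"
    using U finU y by (intro sum_inverse_squares_lattice_le[of _ y "-s"]) (auto simp: lattice_res_def)
  finally show ?thesis by (simp add: V1_def)
qed

text \<open>Induction along the Euclidean algorithm. Periodicity and oddness reduce to
  \<open>0 < 2 * a < N\<close>; there the vector \<open>(1, 0)\<close> carries the term
  \<open>N / a\<close> of the reciprocity law and the other vectors form the sum for modulus
  \<open>a\<close>. The modulus at least halves while the error grows by at most 6.\<close>

lemma dedekind_sum_conv_sum:
  assumes "N > 0" "coprime a N"
  shows "\<bar>12 * dedekind_sum a N - conv_sum (\<lambda>z. max 0 (z - 2)) (int N) (int a)\<bar> \<le> 6 * log 2 (real N)"
  using assms
proof (induction N arbitrary: a rule: less_induct)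
  case (less N)
  define g :: "real \<Rightarrow> real" where "g = (\<lambda>z. max 0 (z - 2))"
  define E where "E = (\<lambda>a N. 12 * dedekind_sum a N - conv_sum g (int N) (int a))"
  have main: "\<bar>E a N\<bar> \<le> 6 * log 2 (real N)" if a: "0 < a" "2 * a < N" "coprime a N" for a
  proof -
    have N: "N > 0" using a by simp
    have lip: "\<bar>g x - g y\<bar> \<le> \<bar>x - y\<bar>" for x y by (auto simp: g_def)
    have zero: "g x = 0" if "x \<le> 2" for x using that by (simp add: g_def)
    have res1: "lattice_res (int N) (int a) (1, 0) = int a" by (simp add: lattice_res_def)
    have v1: "(1, 0) \<in> conv_vecs (int N) (int a)"
      using a by (auto simp: conv_vecs_def res1)
    have "conv_vecs (int N) (int a) = {(1,0)} \<union> {v. v \<in> conv_vecs (int N) (int a) \<and> fst v > 1}"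
    proof -
      have "v = (1, 0)" if v: "v \<in> conv_vecs (int N) (int a)" "\<not> fst v > 1" for v
      proof -
        have f: "fst v = 1" using conv_vecsD(1)[OF v(1)] v(2) by simp
        have "2 * \<bar>int a - snd v * int N\<bar> < int N"
          using conv_vecsD(6)[OF v(1)] f by (simp add: lattice_res_def)
        moreover have "2 * int a < int N" "0 \<le> int a" using a by simp_all
        ultimately have "\<bar>snd v * int N\<bar> < int N" by (smt (verit))
        then have "snd v = 0" by (rule abs_mult_less_imp_eq_0)
        then show ?thesis using f by (simp add: prod_eq_iff)
      qed
      then show ?thesis using v1 by blast
    qed
    then have "conv_sum g (int N) (int a) = (\<Sum>v\<in>{(1,0)} \<union> {v. v \<in> conv_vecs (int N) (int a) \<and> fst v > 1}. signed_term g (int N) (int a) v)"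
      unfolding conv_sum_def by (rule sum.cong) simp
    also have "\<dots> = signed_term g (int N) (int a) (1,0) + (\<Sum>v | v \<in> conv_vecs (int N) (int a) \<and> fst v > 1. signed_term g (int N) (int a) v)"
      by (subst sum.union_disjoint) auto
    also have "signed_term g (int N) (int a) (1,0) = real N / real a - 2"
    proof -
      have "real N / real a > 2" using a by (simp add: field_simps)
      then show ?thesis using a by (simp add: signed_term_def quality_def res1 g_def)
    qed
    finally have c: "conv_sum g (int N) (int a) = real N / real a - 2 + (\<Sum>v | v \<in> conv_vecs (int N) (int a) \<and> fst v > 1. signed_term g (int N) (int a) v)" .
    \<comment> \<open>The companion \<open>(0, -1)\<close> of \<open>(1, 0)\<close> has residue
      \<open>N\<close>, so the tail belongs to modulus \<open>a\<close> and numerator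
      \<open>- N\<close>, in step with \<open>dedekind_sum N a\<close> in the reciprocity
      law.\<close>
    have "\<bar>(\<Sum>v | v \<in> conv_vecs (int N) (int a) \<and> fst v > 1. signed_term g (int N) (int a) v) - conv_sum g (int a) (- int N)\<bar> \<le> 4"
      by (rule tail_sum_approx[OF lip zero v1, where ?q0.0 = 0 and ?p0.0 = "-1"]) (use a in auto)
    then have t: "\<bar>conv_sum g (int N) (int a) - (real N / real a - 2) + conv_sum g (int a) (int N)\<bar> \<le> 4"
      unfolding c conv_sum_uminus by simp
    have rec: "12 * dedekind_sum a N = - 12 * dedekind_sum N a + (real a / real N + real N / real a + 1 / (real a * real N)) - 3"
      using dedekind_reciprocity[of a N] a N by (simp add: field_simps)
    have IH: "\<bar>E N a\<bar> \<le> 6 * log 2 (real a)"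
      using less.IH[of a N] a unfolding E_def g_def by (simp add: coprime_commute)
    have "0 \<le> real a / real N" "real a / real N \<le> 1" "0 \<le> 1 / (real a * real N)"
      using a by (auto simp: field_simps)
    moreover have "1 / (real a * real N) \<le> 1"
    proof -
      have "1 \<le> a * N" using a by simp
      then have "1 \<le> real a * real N" by (metis of_nat_1 of_nat_le_iff of_nat_mult)
      then show ?thesis by simp
    qed
    \<comment> \<open>The terms \<open>N / a\<close> cancel. What remains is the tail error 4 and
      \<open>a / N + 1 / (a * N) - 1\<close>, which is at most 1 in absolute value.\<close>
    ultimately have "\<bar>E a N\<bar> \<le> \<bar>E N a\<bar> + 6"
      using t unfolding E_def rec by linarith
    also have "\<dots> \<le> 6 * (log 2 (real a) + 1)" using IH by simp
    also have "log 2 (real a) + 1 = log 2 (2 * real a)" using a by (simp add: log_mult)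
    also have "\<dots> \<le> log 2 (real N)" using a by (intro log_mono) auto
    finally show ?thesis by simp
  qed
  have "\<bar>E a N\<bar> \<le> 6 * log 2 (real N)"
  proof (cases "N \<le> 2")
    case True
    have "conv_vecs (int N) (int a) = {}"
    proof -
      have False if v: "v \<in> conv_vecs (int N) (int a)" for v
        using conv_vecsD(1,5)[OF v] True by linarith
      then show ?thesis by blast
    qed
    moreover have "dedekind_sum a N = 0"
    proof -
      consider "N = 1" | "N = 2" using True less.prems by linarith
      then show ?thesis by cases (auto simp: dedekind_sum_def)
    qed
    ultimately show ?thesis using less.prems by (simp add: E_def conv_sum_def)
  next
    case False
    define b where "b = a mod N"
    have N: "N > 0" using False by simp
    have b: "coprime b N" "b < N" using less.prems by (auto simp: b_def coprime_commute)
    have Eb: "E a N = E b N"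
      using conv_sum_mod[of g "int N" "int a"] dedekind_sum_mod[OF N, of a]
      by (simp add: E_def b_def zmod_int)
    have b0: "b > 0" using b False by (cases "b = 0") auto
    have bn: "2 * b \<noteq> N"
    proof
      assume "2 * b = N"
      then have "b dvd N" by auto
      then have "b = 1" using b by (metis coprime_absorb_left nat_dvd_1_iff_1)
      then show False using \<open>2 * b = N\<close> False by simp
    qed
    show ?thesis
    proof (cases "2 * b < N")
      case True
      then show ?thesis using main[of b] b b0 Eb by simp
    next
      case F: False
      have "E (N - b) N = - E b N"
      proof -
        have "int (N - b) = - int b + 1 * int N" using b by (simp add: of_nat_diff)
        then have "conv_sum g (int N) (int (N - b)) = - conv_sum g (int N) (int b)"
          by (simp only: conv_sum_periodic conv_sum_uminus)
        then show ?thesis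
          using dedekind_sum_uminus[OF b] False by (simp add: E_def)
      qed
      moreover have "\<bar>E (N - b) N\<bar> \<le> 6 * log 2 (real N)"
      proof (rule main)
        show "coprime (N - b) N"
          using gcd_diff2_nat[of b N] b by (simp only: coprime_iff_gcd_eq_1)
      qed (use F bn b in linarith)+
      ultimately show ?thesis using Eb by simp
    qed
  qed
  then show ?case by (simp add: E_def g_def)
qed

section \<open>Inversion modulo N exchanges denominators and residues\<close>

lemma lattice_res_invert:
  assumes "a * b = 1 + c * N"
  shows "lattice_res N b (e * lattice_res N a v, e * (c * fst v - b * snd v)) = e * fst v"
proof -
  have "lattice_res N b (e * lattice_res N a v, e * (c * fst v - b * snd v)) = e * fst v * (a * b - c * N)"
    by (simp add: lattice_res_def algebra_simps)
  then show ?thesis using assms by simp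
qed

text \<open>The relation \<open>r = a * q\<close> modulo \<open>N\<close> reads
  \<open>q = b * r\<close> when \<open>b\<close> is inverse to \<open>a\<close>, so \<open>q\<close>
  and \<open>r\<close> trade places. The factor \<open>e\<close> makes the new denominator
  \<open>|r|\<close>; the second entry is the one that produces the residue
  \<open>e * q\<close>.\<close>

definition invert_vec :: "int \<Rightarrow> int \<Rightarrow> int \<Rightarrow> int \<Rightarrow> int \<times> int \<Rightarrow> int \<times> int" where
  "invert_vec N a b c v = (let e = sgn (lattice_res N a v) in
     (e * lattice_res N a v, e * (c * fst v - b * snd v)))"

lemma invert_vec:
  assumes ab: "a * b = 1 + c * N" and v: "v \<in> conv_vecs N a"
  shows "invert_vec N a b c v \<in> conv_vecs N b"
    "fst (invert_vec N a b c v) = \<bar>lattice_res N a v\<bar>"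
    "lattice_res N b (invert_vec N a b c v) = sgn (lattice_res N a v) * fst v"
    "invert_vec N b a c (invert_vec N a b c v) = v"
proof -
  define e where "e = sgn (lattice_res N a v)"
  define r where "r = lattice_res N a v"
  define w where "w = invert_vec N a b c v"
  note D = conv_vecsD[OF v]
  have r: "r \<noteq> 0" using D(3) by (auto simp: r_def)
  have e: "e * e = 1" "e = 1 \<or> e = -1" using r by (auto simp: e_def r_def sgn_if)
  have w: "w = (e * r, e * (c * fst v - b * snd v))" by (simp add: w_def invert_vec_def Let_def e_def r_def)
  have er: "e * r = \<bar>r\<bar>" by (simp add: e_def r_def abs_sgn mult.commute)
  show f: "fst (invert_vec N a b c v) = \<bar>lattice_res N a v\<bar>"
    using w er by (simp add: w_def r_def)
  have "lattice_res N b w = e * fst v" unfolding w r_def by (rule lattice_res_invert[OF ab])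
  then show res: "lattice_res N b (invert_vec N a b c v) = sgn (lattice_res N a v) * fst v"
    by (simp add: w_def e_def)
  have sw: "sgn (lattice_res N b w) = e" using res D(1) by (simp add: w_def sgn_mult e_def)
  have inv: "invert_vec N b a c w = v"
  proof -
    have "invert_vec N b a c w = (e * lattice_res N b w, e * (c * fst w - a * snd w))"
      by (simp add: invert_vec_def Let_def sw)
    also have "e * lattice_res N b w = (e * e) * fst v" using res by (simp add: w_def e_def)
    also have "e * (c * fst w - a * snd w) = (e * e) * (snd v * (a * b - c * N))"
      by (simp add: w r_def lattice_res_def algebra_simps)
    finally show ?thesis using e ab by simp
  qed
  then show "invert_vec N b a c (invert_vec N a b c v) = v" by (simp add: w_def)
  have "coprime (fst w) (snd w)"
  proof (rule coprimeI)
    fix d assume d: "d dvd fst w" "d dvd snd w"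
    then have "d dvd lattice_res N b w" by (simp add: lattice_res_def)
    then have "d dvd fst (invert_vec N b a c w)" "d dvd snd (invert_vec N b a c w)"
      using d by (auto simp: invert_vec_def Let_def)
    then show "is_unit d" using coprime_common_divisor[OF D(2)] inv by simp
  qed
  moreover have "\<bar>lattice_res N b w\<bar> = fst v" using res D(1) e by (auto simp: w_def e_def[symmetric])
  ultimately show "invert_vec N a b c v \<in> conv_vecs N b"
    using f D r unfolding conv_vecs_def w_def r_def mem_Collect_eq by (auto simp: mult.commute)
qed

lemma bij_betw_invert_vec:
  assumes ab: "a * b = 1 + c * N"
  shows "bij_betw (invert_vec N a b c) {v \<in> conv_vecs N a. P (fst v) \<bar>lattice_res N a v\<bar>}
     {v \<in> conv_vecs N b. P \<bar>lattice_res N b v\<bar> (fst v)}"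
proof -
  have ba: "b * a = 1 + c * N" using ab by (simp add: mult.commute)
  have abs: "\<bar>lattice_res N b (invert_vec N a b c v)\<bar> = fst v" if "a * b = 1 + c * N" "v \<in> conv_vecs N a" for v a b
    using invert_vec(3)[OF that] conv_vecsD[OF that(2)] by (auto simp: abs_mult)
  show ?thesis
    by (rule bij_betw_byWitness[where f' = "invert_vec N b a c"])
       (use invert_vec[OF ab] invert_vec[OF ba] abs[OF ab] abs[OF ba] in auto)
qed

lemma signed_term_invert_vec:
  assumes ab: "a * b = 1 + c * N" and v: "v \<in> conv_vecs N a"
  shows "signed_term g N b (invert_vec N a b c v) = signed_term g N a v"
proof -
  have "lattice_res N a v \<noteq> 0" "fst v \<ge> 1" using conv_vecsD[OF v] by auto
  then have "\<bar>sgn (lattice_res N a v) * fst v\<bar> = fst v"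
    "sgn (sgn (lattice_res N a v) * fst v) = sgn (lattice_res N a v)"
    by (auto simp: sgn_if)
  then show ?thesis
    unfolding signed_term_def quality_def invert_vec(2,3)[OF assms] by (simp add: mult.commute)
qed

section \<open>Sieve and divisor bounds\<close>

lemma sum_inclusion_exclusion:
  fixes h :: "'a \<Rightarrow> real"
  assumes "finite A" "finite P"
  shows "(\<Sum>x | x \<in> A \<and> (\<forall>p\<in>P. \<not> b p x). h x) =
    (\<Sum>X\<in>Pow P. (-1) ^ card X * (\<Sum>x | x \<in> A \<and> (\<forall>p\<in>X. b p x). h x))"
proof -
  have prod_bool: "(\<Prod>p\<in>X. of_bool (c p) :: real) = of_bool (\<forall>p\<in>X. c p)" if "finite X" for X and c :: "'b \<Rightarrow> bool"
    using that by (induction X rule: finite_induct) auto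
  have ind: "of_bool (\<forall>p\<in>P. \<not> b p x) = (\<Sum>X\<in>Pow P. (-1) ^ card X * of_bool (\<forall>p\<in>X. b p x) :: real)" for x
  proof -
    have "of_bool (\<forall>p\<in>P. \<not> b p x) = (\<Prod>p\<in>P. of_bool (\<not> b p x) :: real)"
      using prod_bool[OF assms(2)] by metis
    also have "\<dots> = (\<Prod>p\<in>P. 1 - of_bool (b p x))" by (intro prod.cong) auto
    also have "\<dots> = (\<Sum>X\<in>Pow P. (-1) ^ card X * (\<Prod>p\<in>X. of_bool (b p x)) * (\<Prod>p\<in>P - X. 1))"
      by (rule prod_diff_conv_sum[OF assms(2)])
    also have "\<dots> = (\<Sum>X\<in>Pow P. (-1) ^ card X * of_bool (\<forall>p\<in>X. b p x))"
      using assms(2) by (intro sum.cong refl) (auto simp: prod_bool finite_subset)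
    finally show ?thesis .
  qed
  have "(\<Sum>x | x \<in> A \<and> (\<forall>p\<in>P. \<not> b p x). h x) = (\<Sum>x\<in>A. of_bool (\<forall>p\<in>P. \<not> b p x) * h x)"
    using assms(1) by (simp add: sum.inter_filter of_bool_def if_distrib[of "\<lambda>c. c * _"] cong: if_cong)
  also have "\<dots> = (\<Sum>x\<in>A. \<Sum>X\<in>Pow P. (-1) ^ card X * (of_bool (\<forall>p\<in>X. b p x) * h x))"
    unfolding ind by (simp add: sum_distrib_right mult.assoc)
  also have "\<dots> = (\<Sum>X\<in>Pow P. (-1) ^ card X * (\<Sum>x\<in>A. of_bool (\<forall>p\<in>X. b p x) * h x))"
    by (subst sum.swap) (simp add: sum_distrib_left)
  also have "\<dots> = (\<Sum>X\<in>Pow P. (-1) ^ card X * (\<Sum>x | x \<in> A \<and> (\<forall>p\<in>X. b p x). h x))"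
    using assms(1) by (simp add: sum.inter_filter of_bool_def if_distrib[of "\<lambda>c. c * _"] cong: if_cong)
  finally show ?thesis .
qed

lemma prod_primes_dvd_iff:
  fixes X :: "nat set"
  assumes "finite X" "\<And>p. p \<in> X \<Longrightarrow> prime p"
  shows "\<Prod>X dvd n \<longleftrightarrow> (\<forall>p\<in>X. p dvd n)"
  using assms
proof (induction X rule: finite_induct)
  case (insert p X)
  have "coprime p (\<Prod>X)"
    using insert.hyps insert.prems by (intro prod_coprime_right) (auto intro: primes_coprime)
  then show ?case using insert by (auto intro: divides_mult)
qed auto

lemma prime_dvd_prod_primes_iff:
  fixes X :: "nat set"
  assumes "finite X" "\<And>p. p \<in> X \<Longrightarrow> prime p" "prime p"
  shows "p dvd \<Prod>X \<longleftrightarrow> p \<in> X"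
proof
  assume "p dvd \<Prod>X"
  then obtain x where "x \<in> X" "p dvd x" using assms by (auto simp: prime_dvd_prod_iff)
  then show "p \<in> X" using assms primes_dvd_imp_eq[of p x] by auto
qed (use assms in \<open>auto intro: dvd_prodI\<close>)

lemma card_multiples:
  assumes "d > 0"
  shows "card {x \<in> {1..n}. d dvd x} = n div (d::nat)"
proof -
  have "{x \<in> {1..n}. d dvd x} = (\<lambda>j. d * j) ` {1..n div d}"
    using assms by (auto simp: less_eq_div_iff_mult_less_eq mult.commute elim!: dvdE) 
  then show ?thesis using assms by (simp add: card_image inj_on_def)
qed

lemma real_div_bounds:
  shows "real (n div d) \<le> real n / real d" "real n / real d - 1 \<le> real (n div d)"
proof -
  have *: "real n / real d = real (n div d) + real (n mod d) / real d"
  proof (cases "d = 0")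
    case False
    have "real n = real d * real (n div d) + real (n mod d)"
      by (metis mult_div_mod_eq of_nat_add of_nat_mult)
    then have "real n / real d = (real d * real (n div d) + real (n mod d)) / real d" by simp
    then show ?thesis using False by (simp only: add_divide_distrib) simp
  qed simp
  have "real (n mod d) / real d \<le> 1" "0 \<le> real (n mod d) / real d"
    by (cases "d = 0"; simp add: less_imp_le)+
  then show "real (n div d) \<le> real n / real d" "real n / real d - 1 \<le> real (n div d)"
    unfolding * by linarith+
qed

text \<open>For \<open>N > 0\<close>, the number of squarefree divisors of \<open>N\<close>, hence
  the number of terms in a sieve by its primes.\<close>

definition omega_pow :: "nat \<Rightarrow> real" where
  "omega_pow N = 2 ^ card (prime_factors N)"

text \<open>Legendre's sieve: rounding costs at most 1 in each of the \<open>2 ^ card P\<close>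
  terms, and the main terms multiply out to the Euler product of the totient.\<close>

lemma card_coprime_le:
  assumes "M > 0"
  shows "real (card {x \<in> {1..n}. coprime x M}) \<le> real n * (real (totient M) / real M) + omega_pow M"
proof -
  define P where "P = prime_factors M"
  have P: "finite P" "\<And>p. p \<in> P \<Longrightarrow> prime p" by (auto simp: P_def)
  have cop: "coprime x M \<longleftrightarrow> (\<forall>p\<in>P. \<not> p dvd x)" for x
  proof
    assume c: "coprime x M"
    show "\<forall>p\<in>P. \<not> p dvd x"
    proof
      fix p assume "p \<in> P"
      then have "prime p" "p dvd M" by (auto simp: P_def)
      then show "\<not> p dvd x" using c by (metis coprime_common_divisor not_prime_unit)
    qed
  next
    assume c: "\<forall>p\<in>P. \<not> p dvd x"
    show "coprime x M"
    proof (rule ccontr)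
      assume "\<not> coprime x M"
      then obtain p where "prime p" "p dvd x" "p dvd M"
        by (metis coprime_iff_gcd_eq_1 gcd_nat.bounded_iff prime_factor_nat)
      then show False using c assms by (auto simp: P_def in_prime_factors_iff)
    qed
  qed
  have "real (card {x \<in> {1..n}. coprime x M}) = (\<Sum>x | x \<in> {1..n} \<and> (\<forall>p\<in>P. \<not> p dvd x). 1)"
    by (simp add: cop)
  also have "\<dots> = (\<Sum>X\<in>Pow P. (-1) ^ card X * (\<Sum>x | x \<in> {1..n} \<and> (\<forall>p\<in>X. p dvd x). 1))"
    using P by (intro sum_inclusion_exclusion) auto
  also have "\<dots> = (\<Sum>X\<in>Pow P. (-1) ^ card X * real (n div \<Prod>X))"
  proof (intro sum.cong refl)
    fix X assume X: "X \<in> Pow P"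
    then have X': "finite X" "\<And>p. p \<in> X \<Longrightarrow> prime p" using P finite_subset by auto
    have "\<Prod>X > 0" using X'(2) by (auto intro!: prod_pos simp: prime_gt_0_nat)
    moreover have "{x \<in> {1..n}. \<forall>p\<in>X. p dvd x} = {x \<in> {1..n}. \<Prod>X dvd x}"
      by (simp add: prod_primes_dvd_iff[OF X'])
    ultimately have "real (card {x \<in> {1..n}. \<forall>p\<in>X. p dvd x}) = real (n div \<Prod>X)"
      by (simp only: card_multiples)
    then show "(-1) ^ card X * (\<Sum>x | x \<in> {1..n} \<and> (\<forall>p\<in>X. p dvd x). 1) = (-1) ^ card X * real (n div \<Prod>X)"
      by simp
  qed
  also have "\<dots> \<le> (\<Sum>X\<in>Pow P. (-1) ^ card X * (real n / real (\<Prod>X)) + 1)"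
  proof (intro sum_mono)
    fix X assume X: "X \<in> Pow P"
    have b: "real (n div \<Prod>X) \<le> real n / real (\<Prod>X)" "real n / real (\<Prod>X) - 1 \<le> real (n div \<Prod>X)"
      by (rule real_div_bounds)+
    consider "(-1::real) ^ card X = 1" | "(-1::real) ^ card X = -1"
      by (cases "even (card X)") auto
    then show "(-1) ^ card X * real (n div \<Prod>X) \<le> (-1) ^ card X * (real n / real (\<Prod>X)) + 1"
    proof cases
      case 1
      show ?thesis unfolding 1 using b by linarith
    next
      case 2
      show ?thesis unfolding 2 using b by linarith
    qed
  qed
  also have "\<dots> = real n * (\<Sum>X\<in>Pow P. (-1) ^ card X * (\<Prod>p\<in>X. 1 / real p)) + 2 ^ card P"
    using P by (simp add: sum.distrib card_Pow sum_distrib_left prod_dividef mult_ac)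
  also have "(\<Sum>X\<in>Pow P. (-1) ^ card X * (\<Prod>p\<in>X. 1 / real p)) = (\<Prod>p\<in>P. 1 - 1 / real p)"
    using prod_diff_conv_sum[OF P(1), of "\<lambda>_. 1" "\<lambda>p. 1 / real p"] by simp
  also have "\<dots> = real (totient M) / real M"
    unfolding totient_formula2 P_def using assms by simp
  finally show ?thesis by (simp add: omega_pow_def P_def)
qed

lemma omega_pow_mono: "M dvd N \<Longrightarrow> N > 0 \<Longrightarrow> omega_pow M \<le> omega_pow N"
  unfolding omega_pow_def
  by (intro power_increasing card_mono dvd_prime_factors) auto

lemma totient_ratio_mono:
  assumes "M dvd N" "N > 0"
  shows "real (totient N) / real N \<le> real (totient M) / real M"
proof -
  have M: "M > 0" using assms by (auto intro: Nat.gr0I)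
  have sub: "prime_factors M \<subseteq> prime_factors N" using assms by (intro dvd_prime_factors) auto
  have b: "0 \<le> 1 - 1 / real p \<and> 1 - 1 / real p \<le> 1" if "p \<in> prime_factors N" for p
    using that prime_ge_1_nat[of p] by (auto simp: in_prime_factors_iff)
  have "(\<Prod>p\<in>prime_factors N. 1 - 1 / real p) =
      (\<Prod>p\<in>prime_factors N - prime_factors M. 1 - 1 / real p) * (\<Prod>p\<in>prime_factors M. 1 - 1 / real p)"
    by (rule prod.subset_diff[OF sub]) auto
  also have "\<dots> \<le> 1 * (\<Prod>p\<in>prime_factors M. 1 - 1 / real p)"
    using b sub by (intro mult_right_mono prod_le_1 prod_nonneg) auto
  finally show ?thesis unfolding totient_formula2 using assms M by simp
qed

text \<open>Each Euler factor \<open>1 - 1 / p\<close> is at least \<open>1 / 2\<close>.\<close>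

lemma totient_lower: "N > 0 \<Longrightarrow> real N \<le> omega_pow N * real (totient N)"
proof -
  assume N: "N > 0"
  have "(\<Prod>p\<in>prime_factors N. 1 / 2) \<le> (\<Prod>p\<in>prime_factors N. 1 - 1 / real p)"
  proof (intro prod_mono conjI)
    fix p assume "p \<in> prime_factors N"
    then have "p \<ge> 2" by (auto simp: in_prime_factors_iff prime_ge_2_nat)
    then show "1 / 2 \<le> 1 - 1 / real p" by (simp add: field_simps)
  qed auto
  then have "1 / omega_pow N \<le> (\<Prod>p\<in>prime_factors N. 1 - 1 / real p)"
    by (simp add: omega_pow_def power_divide)
  then have "real N * (1 / omega_pow N) \<le> real (totient N)"
    unfolding totient_formula2 by (intro mult_left_mono) auto
  moreover have "omega_pow N > 0" by (simp add: omega_pow_def)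
  ultimately show ?thesis by (simp add: field_simps)
qed

text \<open>Units modulo \<open>M\<close> lift to units modulo \<open>N\<close>. With
  \<open>k\<close> the product of the primes of \<open>N\<close> not dividing \<open>c\<close>,
  every prime of \<open>N\<close> divides exactly one of \<open>c\<close> and \<open>k * M\<close>,
  hence not \<open>c + k * M\<close>.\<close>

lemma coprime_lift:
  fixes c M N :: nat
  assumes "coprime c M" "N > 0"
  obtains u where "coprime u N" "[u = c] (mod M)"
proof
  define X where "X = {p \<in> prime_factors N. \<not> p dvd c}"
  define k where "k = \<Prod>X"
  have X: "finite X" "\<And>p. p \<in> X \<Longrightarrow> prime p" by (auto simp: X_def)
  have kp: "p dvd k \<longleftrightarrow> p \<in> X" if "prime p" for p
    unfolding k_def by (rule prime_dvd_prod_primes_iff[OF X that])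
  show "[c + k * M = c] (mod M)" by (simp add: Cong.cong_def)
  show "coprime (c + k * M) N"
  proof (rule ccontr)
    assume "\<not> coprime (c + k * M) N"
    then obtain p where p: "prime p" "p dvd c + k * M" "p dvd N"
      by (metis coprime_iff_gcd_eq_1 gcd_nat.bounded_iff prime_factor_nat)
    show False
    proof (cases "p dvd c")
      case True
      then have "p dvd k * M" using p(2) by (simp add: dvd_add_right_iff)
      moreover have "\<not> p dvd M" using True assms(1) p(1) by (metis coprime_common_divisor not_prime_unit)
      moreover have "\<not> p dvd k" using kp[OF p(1)] True by (simp add: X_def)
      ultimately show False using p(1) prime_dvd_mult_iff by blast
    next
      case False
      then have "p dvd k" using kp[OF p(1)] p assms by (simp add: X_def in_prime_factors_iff)
      then show False using False p(2) by (metis dvd_add_left_iff dvd_mult2)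
    qed
  qed
qed

text \<open>All classes of units modulo \<open>M\<close> are equally full: multiplication by a unit
  modulo \<open>N\<close> that lifts \<open>c' / c\<close> injects the class of \<open>c\<close>
  into that of \<open>c'\<close>, and conversely.\<close>

lemma card_totatives_cong:
  assumes "M dvd N" "N > 0" "coprime c M"
  shows "card {a \<in> totatives N. [a = c] (mod M)} * totient M = totient N"
proof (cases "N = 1")
  case True
  then have "M = 1" using assms by simp
  moreover have "{a \<in> totatives N. [a = c] (mod M)} = {1}"
    using True \<open>M = 1\<close> by (auto simp: totatives_def)
  ultimately show ?thesis using True by simp
next
  case False
  then have N: "N > 1" using assms by simp
  have M: "M > 0" using assms by (auto intro: Nat.gr0I)
  define F where "F = (\<lambda>c. {a \<in> totatives N. [a = c] (mod M)})"
  have finF: "finite (F c)" for c by (auto simp: F_def)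
  have le: "card (F c) \<le> card (F c')" if c: "coprime c M" "coprime c' M" for c c'
  proof -
    obtain i where i: "[c * i = 1] (mod M)" using cong_solve_coprime_nat[OF c(1)] by auto
    then have "coprime i M" by (metis cong_solve_coprime_nat coprime_iff_invertible_nat mult.commute One_nat_def)
    then have "coprime (c' * i) M" using c by simp
    then obtain u where u: "coprime u N" "[u = c' * i] (mod M)" using coprime_lift assms(2) by metis
    have inj: "inj_on (\<lambda>a. u * a mod N) (F c)"
    proof (rule inj_onI)
      fix x y assume xy: "x \<in> F c" "y \<in> F c" "u * x mod N = u * y mod N"
      then have "[u * x = u * y] (mod N)" by (simp add: Cong.cong_def)
      then have "[x = y] (mod N)" using u by (simp add: cong_mult_lcancel_nat)
      moreover have "x < N" "y < N" using xy N totatives_less by (auto simp: F_def)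
      ultimately show "x = y" by (simp add: Cong.cong_def)
    qed
    have "u * a mod N \<in> F c'" if a: "a \<in> F c" for a
    proof -
      have a': "coprime a N" "[a = c] (mod M)" using a by (auto simp: F_def in_totatives_iff)
      have "coprime (u * a mod N) N" using a' u N by simp
      moreover from this have "u * a mod N > 0" using N by (intro Nat.gr0I) auto
      moreover have "u * a mod N \<le> N" using N by (simp add: less_imp_le)
      moreover have "[u * a mod N = c'] (mod M)"
      proof -
        have "[u * a mod N = u * a] (mod M)" using assms(1)
          by (metis Cong.cong_def mod_mod_cancel)
        also have "[u * a = (c' * i) * c] (mod M)" using u a' by (intro cong_mult)
        also have "(c' * i) * c = c' * (c * i)" by simp
        also have "[c' * (c * i) = c' * 1] (mod M)" using i by (intro cong_mult) auto
        finally show ?thesis by simp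
      qed
      ultimately show ?thesis by (simp add: F_def in_totatives_iff)
    qed
    then show ?thesis using card_inj_on_le[OF inj _ finF] by blast
  qed
  have "totatives N = (\<Union>d\<in>totatives M. F d)"
  proof (intro equalityI subsetI)
    fix a assume a: "a \<in> totatives N"
    then have ca: "coprime a M" using assms by (metis in_totatives_iff coprime_divisors dvd_refl)
    show "a \<in> (\<Union>d\<in>totatives M. F d)"
    proof (cases "M = 1")
      case True
      then show ?thesis using a by (auto simp: F_def)
    next
      case False
      then have "a mod M \<in> totatives M" using ca M by (auto simp: in_totatives_iff intro!: Nat.gr0I less_imp_le)
      moreover have "a \<in> F (a mod M)" using a by (simp add: F_def Cong.cong_def)
      ultimately show ?thesis by blast
    qed
  qed (auto simp: F_def)
  moreover have "card (\<Union>d\<in>totatives M. F d) = (\<Sum>d\<in>totatives M. card (F d))"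
  proof (rule card_UN_disjoint)
    show "\<forall>i\<in>totatives M. \<forall>j\<in>totatives M. i \<noteq> j \<longrightarrow> F i \<inter> F j = {}"
    proof (intro ballI impI)
      fix i j assume ij: "i \<in> totatives M" "j \<in> totatives M" "i \<noteq> j"
      have "i = j" if "[i = j] (mod M)"
      proof (cases "M = 1")
        case False
        then show ?thesis using that ij M totatives_less[of _ M] by (auto simp: Cong.cong_def)
      qed (use ij in auto)
      then show "F i \<inter> F j = {}" using ij by (auto simp: F_def) (metis cong_sym cong_trans)
    qed
  qed (use finF in auto)
  moreover have "(\<Sum>d\<in>totatives M. card (F d)) = (\<Sum>d\<in>totatives M. card (F c))"
    using le assms(3) by (intro sum.cong refl antisym) (auto simp: in_totatives_iff)
  ultimately show ?thesis by (simp add: totient_def F_def mult.commute)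
qed

text \<open>A solution has \<open>gcd q N = gcd y N = d\<close>, so \<open>q = d * x\<close> with
  \<open>x\<close> coprime to \<open>M = N / d\<close>. For given \<open>x\<close> the unit
  \<open>a\<close> is determined modulo \<open>M\<close>, which leaves at most \<open>f\<close>
  choices modulo \<open>N\<close>. Sieving \<open>x \<le> n / d\<close> makes the main term exactly
  \<open>totient N * n / N\<close>; as \<open>f \<le> d\<close>, the sieve error grows only by the
  gcd.\<close>

lemma card_lattice_pairs_le:
  assumes N: "N > 0" and y: "y > 0"
  shows "real (card {aq \<in> totatives N \<times> {1..n}. [fst aq * snd aq = y] (mod N)}) \<le>
    real (totient N) * real n / real N + real (gcd y N) * omega_pow N"
proof -
  define d where "d = gcd y N"
  define M where "M = N div d"
  have d: "d > 0" "d dvd N" "d dvd y" using N by (auto simp: d_def)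
  have NM: "N = d * M" using d by (simp add: M_def)
  have M: "M > 0" "M dvd N" using N NM by auto
  define f where "f = real (totient N) / real (totient M)"
  have tM: "real (totient M) > 0" using M by simp
  have f: "0 \<le> f" "f \<le> real d"
  proof -
    have "real (totient N) / real N \<le> real (totient M) / real M" using totient_ratio_mono M N by simp
    then have "real (totient N) * real M \<le> real (totient M) * real N" using M N by (simp add: field_simps)
    also have "\<dots> = real (totient M) * real d * real M" by (simp add: NM)
    finally have "real (totient N) \<le> real d * real (totient M)" using M by (simp add: mult.commute)
    then show "f \<le> real d" using tM by (simp add: f_def divide_le_eq)
  qed (simp add: f_def)
  define Q where "Q = {x \<in> {1..n div d}. coprime x M}"
  define A where "A = (\<lambda>q. {a \<in> totatives N. [a * q = y] (mod N)})"
  have A: "real (card (A (d * x))) \<le> f" if x: "x \<in> Q" for x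
  proof (cases "A (d * x) = {}")
    case False
    then obtain a0 where a0: "a0 \<in> A (d * x)" by auto
    have c0: "coprime a0 M" using a0 M by (metis (mono_tags, lifting) A_def coprime_divisors dvd_refl in_totatives_iff mem_Collect_eq)
    have "A (d * x) \<subseteq> {a \<in> totatives N. [a = a0] (mod M)}"
    proof
      fix a assume a: "a \<in> A (d * x)"
      then have "[a * (d * x) = a0 * (d * x)] (mod N)"
        using a0 by (auto simp: A_def) (metis cong_sym cong_trans)
      then have "[d * (a * x) = d * (a0 * x)] (mod (d * M))" by (simp add: NM mult_ac)
      then have "[a * x = a0 * x] (mod M)" using d(1) by (simp add: Cong.cong_def mod_mult_mult1)
      then have "[a = a0] (mod M)" using x by (simp add: Q_def cong_mult_rcancel_nat)
      then show "a \<in> {a \<in> totatives N. [a = a0] (mod M)}" using a by (simp add: A_def)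
    qed
    then have "card (A (d * x)) \<le> card {a \<in> totatives N. [a = a0] (mod M)}"
      by (intro card_mono) auto
    also have "real \<dots> = f"
      using card_totatives_cong[OF M(2) N c0] tM unfolding f_def
      by (simp add: field_simps flip: of_nat_mult)
    finally show ?thesis by simp
  qed (use f in simp)
  have "{aq \<in> totatives N \<times> {1..n}. [fst aq * snd aq = y] (mod N)} \<subseteq> (\<Union>x\<in>Q. A (d * x) \<times> {d * x})"
  proof
    fix aq assume aq: "aq \<in> {aq \<in> totatives N \<times> {1..n}. [fst aq * snd aq = y] (mod N)}"
    obtain a q where aqe: "aq = (a, q)" by (cases aq)
    have a: "a \<in> totatives N" "1 \<le> q" "q \<le> n" "[a * q = y] (mod N)" using aq aqe by auto
    have "gcd q N = gcd (a * q) N"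
      using a(1) by (simp add: in_totatives_iff gcd_mult_left_left_cancel coprime_commute)
    also have "\<dots> = d" using a(4) by (simp add: d_def cong_gcd_eq)
    finally have g: "gcd q N = d" .
    then obtain x where x: "q = d * x" by (metis dvdE gcd_dvd1)
    have "d * gcd x M = gcd (d * x) (d * M)" by (rule gcd_mult_distrib_nat)
    also have "\<dots> = d * 1" using g x NM by simp
    finally have "gcd x M = 1" using d(1) by (simp only: mult_cancel1) simp
    then have "coprime x M" by (simp only: coprime_iff_gcd_eq_1)
    moreover have "x \<ge> 1" using a x by (cases x) auto
    moreover have "x \<le> n div d" using a x d by (simp add: less_eq_div_iff_mult_less_eq mult.commute)
    ultimately have "x \<in> Q" by (simp add: Q_def)
    then show "aq \<in> (\<Union>x\<in>Q. A (d * x) \<times> {d * x})" using a x aqe by (auto simp: A_def)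
  qed
  then have "card {aq \<in> totatives N \<times> {1..n}. [fst aq * snd aq = y] (mod N)} \<le> card (\<Union>x\<in>Q. A (d * x) \<times> {d * x})"
    by (intro card_mono) (auto simp: Q_def A_def)
  also have "\<dots> \<le> (\<Sum>x\<in>Q. card (A (d * x) \<times> {d * x}))"
    by (intro card_UN_le) (auto simp: Q_def)
  finally have "real (card {aq \<in> totatives N \<times> {1..n}. [fst aq * snd aq = y] (mod N)}) \<le> (\<Sum>x\<in>Q. real (card (A (d * x))))"
    by (simp add: card_cartesian_product flip: of_nat_sum)
  also have "\<dots> \<le> (\<Sum>x\<in>Q. f)" using A by (intro sum_mono)
  also have "\<dots> = f * real (card Q)" by simp
  also have "\<dots> \<le> f * (real (n div d) * (real (totient M) / real M) + omega_pow M)"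
    unfolding Q_def using f by (intro mult_left_mono card_coprime_le M)
  also have "\<dots> \<le> f * (real n / real d * (real (totient M) / real M) + omega_pow M)"
    using f real_div_bounds(1)[of n d] by (intro mult_left_mono add_mono mult_right_mono) auto
  also have "\<dots> = real (totient N) * real n / real N + f * omega_pow M"
    using tM M d by (simp add: f_def NM field_simps)
  also have "f * omega_pow M \<le> real d * omega_pow N"
    using f omega_pow_mono[OF M(2) N] by (intro mult_mono) (auto simp: omega_pow_def)
  finally show ?thesis by (simp add: d_def)
qed

section \<open>Bounds for the divisor function\<close>

definition ndiv :: "nat \<Rightarrow> nat" where "ndiv N = card {d. d dvd N}"

lemma omega_pow_le_ndiv:
  assumes "N > 0"
  shows "omega_pow N \<le> real (ndiv N)"
proof -
  define P where "P = prime_factors N"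
  have P: "finite P" "\<And>p. p \<in> P \<Longrightarrow> prime p" by (auto simp: P_def)
  have dv: "p dvd \<Prod>X \<longleftrightarrow> p \<in> X" if "prime p" "X \<subseteq> P" for p X
    using that P finite_subset[OF that(2) P(1)] by (intro prime_dvd_prod_primes_iff) auto
  have "inj_on (\<lambda>X. \<Prod>X) (Pow P)"
  proof (rule inj_onI)
    fix X Y assume XY: "X \<in> Pow P" "Y \<in> Pow P" "\<Prod>X = \<Prod>Y"
    show "X = Y" using XY P dv by (metis PowD subsetD subsetI subset_antisym)
  qed
  moreover have "(\<lambda>X. \<Prod>X) ` Pow P \<subseteq> {d. d dvd N}"
  proof
    fix d assume "d \<in> (\<lambda>X. \<Prod>X) ` Pow P"
    then obtain X where X: "X \<subseteq> P" "d = \<Prod>X" by auto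
    have "finite X" using X P finite_subset by auto
    then show "d \<in> {d. d dvd N}"
      using X P prod_primes_dvd_iff[of X N] by (auto simp: P_def)
  qed
  ultimately have "card (Pow P) \<le> ndiv N"
    unfolding ndiv_def using finite_divisors_nat[OF assms] by (intro card_inj_on_le)
  then have "real (2 ^ card P) \<le> real (ndiv N)" using P(1) by (simp only: card_Pow of_nat_le_iff)
  then show ?thesis by (simp add: omega_pow_def P_def)
qed

text \<open>Bound \<open>gcd y N\<close> by the sum of all \<open>d\<close> dividing both numbers;
  each divisor \<open>d\<close> of \<open>N\<close> then contributes
  \<open>d * (n div d) \<le> n\<close>.\<close>

lemma sum_gcd_le:
  assumes "N > 0"
  shows "(\<Sum>y=1..n. gcd y N) \<le> n * ndiv N"
proof -
  have "(\<Sum>y=1..n. gcd y N) \<le> (\<Sum>y=1..n. \<Sum>d | d dvd N. if d dvd y then d else 0)"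
  proof (intro sum_mono)
    fix y
    have "gcd y N = (\<Sum>d\<in>{gcd y N}. if d dvd y then d else 0)" by simp
    also have "\<dots> \<le> (\<Sum>d | d dvd N. if d dvd y then d else 0)"
      using finite_divisors_nat[OF assms] by (intro sum_mono2) auto
    finally show "gcd y N \<le> (\<Sum>d | d dvd N. if d dvd y then d else 0)" .
  qed
  also have "\<dots> = (\<Sum>d | d dvd N. \<Sum>y=1..n. if d dvd y then d else 0)" by (rule sum.swap)
  also have "\<dots> \<le> (\<Sum>d | d dvd N. n)"
  proof (intro sum_mono)
    fix d assume "d \<in> {d. d dvd N}"
    then have d: "d > 0" using assms by (auto intro: Nat.gr0I)
    have "(\<Sum>y=1..n. if d dvd y then d else 0) = card {y \<in> {1..n}. d dvd y} * d"
      by (simp add: sum.inter_filter[symmetric])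
    also have "\<dots> \<le> n" unfolding card_multiples[OF d] by simp
    finally show "(\<Sum>y=1..n. if d dvd y then d else 0) \<le> n" .
  qed
  also have "\<dots> = n * ndiv N" by (simp add: ndiv_def)
  finally show ?thesis .
qed

lemma ndiv_mult_le:
  assumes "m > 0" "n > 0"
  shows "ndiv (m * n) \<le> ndiv m * ndiv n"
proof -
  have "{d. d dvd m * n} \<subseteq> (\<lambda>(x, y). x * y) ` ({d. d dvd m} \<times> {d. d dvd n})"
    by (auto dest!: division_decomp)
  then have "ndiv (m * n) \<le> card ((\<lambda>(x, y). x * y) ` ({d. d dvd m} \<times> {d. d dvd n}))"
    unfolding ndiv_def using assms by (intro card_mono) (auto simp: finite_divisors_nat)
  also have "\<dots> \<le> card ({d. d dvd m} \<times> {d. d dvd n})"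
    using assms by (intro card_image_le) (auto simp: finite_divisors_nat)
  finally show ?thesis by (simp add: ndiv_def card_cartesian_product)
qed

lemma ndiv_prod_le:
  assumes "finite I" "\<And>i. i \<in> I \<Longrightarrow> f i > (0::nat)"
  shows "ndiv (\<Prod>i\<in>I. f i) \<le> (\<Prod>i\<in>I. ndiv (f i))"
  using assms
proof (induction I rule: finite_induct)
  case (insert i I)
  have "(\<Prod>i\<in>I. f i) > 0" using insert.prems by (auto intro!: prod_pos)
  then have "ndiv (f i * (\<Prod>i\<in>I. f i)) \<le> ndiv (f i) * ndiv (\<Prod>i\<in>I. f i)"
    using insert.prems by (intro ndiv_mult_le) auto
  also have "\<dots> \<le> ndiv (f i) * (\<Prod>i\<in>I. ndiv (f i))"
    using insert by (intro mult_left_mono) auto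
  finally show ?case using insert.hyps by simp
qed (simp add: ndiv_def)

lemma ndiv_prime_power_le:
  assumes "prime p"
  shows "ndiv (p ^ m) \<le> m + 1"
proof -
  have "{d. d dvd p ^ m} \<subseteq> (\<lambda>i. p ^ i) ` {..m}"
    using assms by (auto simp: divides_primepow_nat)
  then have "ndiv (p ^ m) \<le> card ((\<lambda>i. p ^ i) ` {..m})"
    unfolding ndiv_def by (intro card_mono) auto
  also have "\<dots> \<le> card {..m}" by (rule card_image_le) auto
  finally show ?thesis by simp
qed

text \<open>Primes below \<open>x\<close> are fewer than \<open>x\<close> and have exponents at most
  \<open>log 2 N\<close>. For the others \<open>m + 1 \<le> 2 ^ m\<close>, and their exponents add
  up to at most \<open>log x N\<close>. The threshold \<open>x\<close> is set to
  \<open>sqrt (ln N)\<close> in \<open>ln_ndiv_le\<close>.\<close>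

lemma ndiv_bound:
  assumes N: "N > 0" and x: "x > (1::real)"
  shows "real (ndiv N) \<le> (1 + log 2 (real N)) powr x * 2 powr (log x (real N))"
proof -
  define P where "P = prime_factors N"
  define m where "m = (\<lambda>p. multiplicity p N)"
  have P: "finite P" "\<And>p. p \<in> P \<Longrightarrow> prime p" by (auto simp: P_def)
  have fac: "N = (\<Prod>p\<in>P. p ^ m p)" unfolding P_def m_def
    using N prime_factorization_nat by blast
  have m1: "real (m p + 1) \<le> 1 + log 2 (real N)" if "p \<in> P" for p
  proof -
    have "2 ^ m p \<le> p ^ m p" using P(2)[OF that] prime_ge_2_nat by (intro power_mono) auto
    also have "\<dots> \<le> N" using N by (intro dvd_imp_le) (auto simp: m_def multiplicity_dvd)
    finally have "2 ^ m p \<le> real N" by (metis of_nat_le_iff of_nat_numeral of_nat_power)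
    then have "log 2 (2 ^ m p) \<le> log 2 (real N)" using N by (intro log_mono) auto
    then show ?thesis by simp
  qed
  have L: "1 \<le> 1 + log 2 (real N)" using N by simp
  define P1 where "P1 = {p \<in> P. real p < x}"
  define P2 where "P2 = {p \<in> P. real p \<ge> x}"
  have P12: "P = P1 \<union> P2" "P1 \<inter> P2 = {}" "finite P1" "finite P2" using P by (auto simp: P1_def P2_def)
  have "ndiv N \<le> (\<Prod>p\<in>P. ndiv (p ^ m p))"
    using ndiv_prod_le[of P "\<lambda>p. p ^ m p"] P by (simp flip: fac add: prime_gt_0_nat)
  also have "\<dots> \<le> (\<Prod>p\<in>P. m p + 1)"
    using P by (intro prod_mono) (auto intro: order_trans[OF ndiv_prime_power_le])
  finally have "real (ndiv N) \<le> (\<Prod>p\<in>P. real (m p + 1))" by (metis of_nat_le_iff of_nat_prod)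
  also have "\<dots> = (\<Prod>p\<in>P1. real (m p + 1)) * (\<Prod>p\<in>P2. real (m p + 1))"
    unfolding P12(1) using P12 by (intro prod.union_disjoint)
  also have "\<dots> \<le> (1 + log 2 (real N)) powr x * 2 powr (log x (real N))"
  proof (rule mult_mono)
    have "(\<Prod>p\<in>P1. real (m p + 1)) \<le> (\<Prod>p\<in>P1. 1 + log 2 (real N))"
      using m1 P12 by (intro prod_mono) auto
    also have "\<dots> = (1 + log 2 (real N)) powr real (card P1)" using L by (simp add: powr_realpow)
    also have "\<dots> \<le> (1 + log 2 (real N)) powr x"
    proof (rule powr_mono[OF _ L])
      have "P1 \<subseteq> {1..nat \<lfloor>x\<rfloor>}"
      proof
        fix p assume "p \<in> P1"
        then have "prime p" "real p \<le> x" using P by (auto simp: P1_def)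
        then show "p \<in> {1..nat \<lfloor>x\<rfloor>}" using prime_ge_1_nat[of p] by (simp add: le_nat_floor)
      qed
      then have "card P1 \<le> card {1..nat \<lfloor>x\<rfloor>}" by (intro card_mono) auto
      then have "real (card P1) \<le> real (nat \<lfloor>x\<rfloor>)" by simp
      also have "\<dots> \<le> x" using x by simp
      finally show "real (card P1) \<le> x" .
    qed
    finally show "(\<Prod>p\<in>P1. real (m p + 1)) \<le> (1 + log 2 (real N)) powr x" .
    define k where "k = (\<Sum>p\<in>P2. m p)"
    have "x ^ k = (\<Prod>p\<in>P2. x ^ m p)" by (simp add: k_def power_sum)
    also have "\<dots> \<le> (\<Prod>p\<in>P2. real p ^ m p)"
      using x by (intro prod_mono) (auto simp: P2_def intro!: power_mono)
    also have "\<dots> = real (\<Prod>p\<in>P2. p ^ m p)" by simp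
    also have "\<dots> \<le> real N"
    proof -
      have "(\<Prod>p\<in>P2. p ^ m p) dvd (\<Prod>p\<in>P. p ^ m p)"
        using P P12 by (intro prod_dvd_prod_subset) auto
      then show ?thesis using N fac by (metis dvd_imp_le of_nat_le_iff)
    qed
    finally have "x powr real k \<le> real N" using x by (simp add: powr_realpow)
    then have k: "real k \<le> log x (real N)" using N x by (simp add: le_log_iff)
    have "(\<Prod>p\<in>P2. real (m p + 1)) \<le> (\<Prod>p\<in>P2. 2 ^ m p)"
    proof (intro prod_mono conjI)
      fix p
      have "m p + 1 \<le> 2 ^ m p" using Suc_leI[OF less_exp[of "m p"]] by simp
      then show "real (m p + 1) \<le> 2 ^ m p" by (metis of_nat_le_iff of_nat_numeral of_nat_power)
    qed auto
    also have "\<dots> = 2 powr real k" by (simp add: k_def power_sum powr_realpow flip: of_nat_sum)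
    also have "\<dots> \<le> 2 powr (log x (real N))" using k by (intro powr_mono) auto
    finally show "(\<Prod>p\<in>P2. real (m p + 1)) \<le> 2 powr (log x (real N))" .
  qed (auto intro!: prod_nonneg)
  finally show ?thesis .
qed

section \<open>Cancellation of the off-diagonal terms\<close>

text \<open>Representatives start at 0, so that modulus 1 has a unit and \<open>(- s) mod y\<close>
  is again a representative.\<close>

definition units_mod :: "int \<Rightarrow> int set" where
  "units_mod y = {s \<in> {0..<y}. coprime s y}"

lemma finite_units_mod [simp, intro]: "finite (units_mod y)"
  by (rule finite_subset[of _ "{0..<y}"]) (auto simp: units_mod_def)

text \<open>Only positive residues occur here; negative ones are brought to this case by
  \<open>flip_vec\<close>.\<close>

definition conv_triples :: "int \<Rightarrow> int \<Rightarrow> (int \<times> int \<times> int) set" where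
  "conv_triples N y = {(a, q, p). a \<in> units_mod N \<and> q > 0 \<and> coprime q p \<and> a * q - p * N = y \<and> 2 * (q * y) < N}"

text \<open>Completes \<open>(q, p)\<close> to a basis. The candidates differ by multiples of
  \<open>(q, p)\<close>, whose residue is \<open>y\<close>, so exactly one has its residue in the
  range from 0 to \<open>y - 1\<close>. That residue, \<open>tail_res\<close>, is the
  \<open>s\<close> with \<open>q * s = N\<close> modulo \<open>y\<close>.\<close>

definition bezout_pair :: "int \<Rightarrow> int \<Rightarrow> int \<Rightarrow> int \<Rightarrow> int \<Rightarrow> int \<times> int" where
  "bezout_pair N a q p y = (SOME b. fst b * p - q * snd b = 1 \<and> 0 \<le> a * fst b - snd b * N \<and> a * fst b - snd b * N < y)"

definition tail_res :: "int \<Rightarrow> int \<Rightarrow> int \<Rightarrow> int \<Rightarrow> int \<Rightarrow> int" where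
  "tail_res N a q p y = a * fst (bezout_pair N a q p y) - snd (bezout_pair N a q p y) * N"

lemma bezout_pair:
  assumes "coprime q p" "a * q - p * N = y" "y > 0"
  shows "fst (bezout_pair N a q p y) * p - q * snd (bezout_pair N a q p y) = 1"
    "0 \<le> tail_res N a q p y" "tail_res N a q p y < y"
proof -
  obtain u w where "u * p + w * q = 1"
    using assms(1) bezout_int[of p q] by (auto simp: coprime_iff_gcd_eq_1 gcd.commute)
  then have uw: "u * p - q * (- w) = 1" by (simp add: algebra_simps)
  define s where "s = a * u - (- w) * N"
  define k where "k = s div y"
  define b where "b = (u - k * q, - w - k * p)"
  have b1: "fst b * p - q * snd b = 1" using uw by (simp add: b_def algebra_simps)
  have "a * fst b - snd b * N = s - k * (a * q - p * N)" by (simp add: b_def s_def algebra_simps)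
  also have "\<dots> = s mod y" using assms by (simp add: k_def minus_div_mult_eq_mod)
  finally have "fst b * p - q * snd b = 1 \<and> 0 \<le> a * fst b - snd b * N \<and> a * fst b - snd b * N < y"
    using b1 assms(3) by simp
  from someI[of "\<lambda>b. fst b * p - q * snd b = 1 \<and> 0 \<le> a * fst b - snd b * N \<and> a * fst b - snd b * N < y", OF this]
  show "fst (bezout_pair N a q p y) * p - q * snd (bezout_pair N a q p y) = 1"
    "0 \<le> tail_res N a q p y" "tail_res N a q p y < y"
    by (simp_all add: bezout_pair_def tail_res_def)
qed

lemma bezout_diff:
  fixes q p :: int
  assumes "q0 * p - q * p0 = 1" "q0' * p - q * p0' = 1" "q > 0"
  obtains j where "q0' = q0 + j * q" "p0' = p0 + j * p"
proof -
  have cop: "coprime q p" using coprime_if_bezout assms(1) by blast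
  have e: "(q0' - q0) * p = q * (p0' - p0)" using assms by (simp add: algebra_simps)
  then have "q dvd (q0' - q0) * p" by simp
  then have "q dvd q0' - q0" using cop by (simp add: coprime_dvd_mult_left_iff)
  then obtain j where j: "q0' - q0 = q * j" by auto
  then have "q * (p0' - p0) = q * (j * p)" using e by (simp add: algebra_simps)
  then have "p0' - p0 = j * p" using assms(3) by simp
  then show ?thesis using j that[of j] by (simp add: algebra_simps)
qed

lemma tail_res_unique:
  assumes "coprime q p" "a * q - p * N = y" "y > 0" "q > 0"
    and "q0 * p - q * p0 = 1" "0 \<le> a * q0 - p0 * N" "a * q0 - p0 * N < y"
  shows "bezout_pair N a q p y = (q0, p0)"
proof -
  note B = bezout_pair[OF assms(1-3)]
  obtain j where j: "fst (bezout_pair N a q p y) = q0 + j * q" "snd (bezout_pair N a q p y) = p0 + j * p"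
    using bezout_diff[OF assms(5) B(1) assms(4)] by metis
  have "tail_res N a q p y = (a * q0 - p0 * N) + j * (a * q - p * N)"
    unfolding tail_res_def j by (simp add: algebra_simps)
  then have t: "tail_res N a q p y = (a * q0 - p0 * N) + j * y" using assms(2) by simp
  then have "j * y < 1 * y" "(-1) * y < j * y" using B assms by linarith+
  then have "j < 1" "-1 < j" using assms(3) by (simp_all only: mult_less_cancel_right_pos)
  then show ?thesis using j by (simp add: prod_eq_iff)
qed

text \<open>The denominators that lead to a given tail residue \<open>s\<close>: the quotient
  \<open>(q * s - N) div y\<close> is the companion denominator \<open>q0\<close>, and its
  coprimality to \<open>q\<close> is what allows a basis to be rebuilt.\<close>

definition tail_denoms :: "int \<Rightarrow> int \<Rightarrow> int \<Rightarrow> int set" where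
  "tail_denoms N y s = {q. q > 0 \<and> 2 * (q * y) < N \<and> y dvd q * s - N \<and> coprime q ((q * s - N) div y)}"

text \<open>The inverse map sends \<open>(s, q)\<close> to \<open>a = s p - y p0\<close>, where \<open>q0 = (q s - N) / y\<close> and
  \<open>q0 p - q p0 = 1\<close>.\<close>

lemma bij_betw_conv_triples:
  assumes N: "N > 0" and y: "y > 0"
  shows "bij_betw (\<lambda>(a, q, p). (tail_res N a q p y, q)) (conv_triples N y)
     (Sigma (units_mod y) (tail_denoms N y))"
proof (rule bij_betwI')
  define f where "f = (\<lambda>(a, q, p). (tail_res N a q p y, q))"
  have key: "\<exists>q0 p0. q0 * p - q * p0 = 1 \<and> tail_res N a q p y = a * q0 - p0 * N \<and>
      q * tail_res N a q p y - N = q0 * y \<and> a = tail_res N a q p y * p - y * p0 \<and> coprime q q0"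
    if t: "(a, q, p) \<in> conv_triples N y" for a q p
  proof -
    have T: "q > 0" "coprime q p" "a * q - p * N = y" using t by (auto simp: conv_triples_def)
    define q0 where "q0 = fst (bezout_pair N a q p y)"
    define p0 where "p0 = snd (bezout_pair N a q p y)"
    have b: "q0 * p - q * p0 = 1" using bezout_pair[OF T(2,3) y] by (simp add: q0_def p0_def)
    have s: "tail_res N a q p y = a * q0 - p0 * N" by (simp add: tail_res_def q0_def p0_def)
    have "q * (a * q0 - p0 * N) - q0 * (a * q - p * N) = N * (q0 * p - q * p0)" by (simp add: algebra_simps)
    then have e1: "q * (a * q0 - p0 * N) - N = q0 * y" unfolding b T by simp
    have "(a * q0 - p0 * N) * p - (a * q - p * N) * p0 = a * (q0 * p - q * p0)" by (simp add: algebra_simps)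
    then have e2: "a = (a * q0 - p0 * N) * p - y * p0" using b T by simp
    have "coprime q q0" using coprime_if_bezout b by blast
    then show ?thesis using b s e1 e2 by metis
  qed
  show "(f t = f t') = (t = t')" if tt: "t \<in> conv_triples N y" "t' \<in> conv_triples N y" for t t'
  proof
    assume f: "f t = f t'"
    obtain a q p where t: "t = (a, q, p)" by (cases t)
    obtain a' q' p' where t': "t' = (a', q', p')" by (cases t')
    have q: "q' = q" "q > 0" using f t t' tt by (auto simp: f_def conv_triples_def)
    define s where "s = tail_res N a q p y"
    have s': "s = tail_res N a' q p' y" using f t t' q by (simp add: f_def s_def)
    obtain q0 p0 where 1: "q0 * p - q * p0 = 1" "q * s - N = q0 * y" "a = s * p - y * p0" "coprime q q0"
      using key tt(1) t s_def by metis
    obtain q0' p0' where 2: "q0' * p' - q * p0' = 1" "q * s - N = q0' * y" "a' = s * p' - y * p0'"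
      using key tt(2) t' q s' by metis
    have "q0' = q0" using 1 2 y by simp
    then have e: "q0 * (p' - p) = q * (p0' - p0)" using 1 2 by (simp add: algebra_simps)
    then have "q dvd q0 * (p' - p)" by simp
    then have "q dvd p' - p" using 1(4) by (simp add: coprime_dvd_mult_right_iff)
    then obtain k where k: "p' - p = q * k" by auto
    then have "q * (p0' - p0) = q * (k * q0)" using e by (simp add: algebra_simps)
    then have k2: "p0' - p0 = k * q0" using q by simp
    \<comment> \<open>Two choices of \<open>(p, p0)\<close> differ by \<open>k\<close> times
      \<open>(q, q0)\<close>, which moves \<open>a\<close> by \<open>k * N\<close>; the range of the
      representatives leaves only \<open>k = 0\<close>.\<close>
    have "a' - a = s * (p' - p) - y * (p0' - p0)" unfolding 1 2 by (simp add: algebra_simps)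
    also have "\<dots> = k * (q * s - q0 * y)" unfolding k k2 by (simp add: algebra_simps)
    also have "q * s - q0 * y = N" using 1(2) by simp
    finally have aa: "a' - a = k * N" .
    have "0 \<le> a" "a < N" "0 \<le> a'" "a' < N" using tt t t' by (auto simp: conv_triples_def units_mod_def)
    then have "k * N < 1 * N" "(-1) * N < k * N" using aa by linarith+
    then have "k < 1" "-1 < k" using N by (simp_all only: mult_less_cancel_right_pos)
    then have "k = 0" by simp
    then show "t = t'" using aa k t t' q by simp
  qed auto
  show "f t \<in> Sigma (units_mod y) (tail_denoms N y)" if tt: "t \<in> conv_triples N y" for t
  proof -
    obtain a q p where t: "t = (a, q, p)" by (cases t)
    have T: "q > 0" "coprime q p" "a * q - p * N = y" "2 * (q * y) < N" "coprime a N"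
      using t tt by (auto simp: conv_triples_def units_mod_def)
    define s where "s = tail_res N a q p y"
    obtain q0 p0 where 1: "q0 * p - q * p0 = 1" "q * s - N = q0 * y" "a = s * p - y * p0" "coprime q q0"
      using key tt(1) t s_def by metis
    have "coprime s y"
    proof (rule coprimeI)
      fix d assume d: "d dvd s" "d dvd y"
      then have "d dvd a" using 1(3) by simp
      moreover have "d dvd q * s - q0 * y" using d by simp
      then have "d dvd N" using 1(2) by (simp add: algebra_simps)
      ultimately show "is_unit d" using T(5) coprime_common_divisor by blast
    qed
    moreover have "0 \<le> s" "s < y" using bezout_pair[OF T(2,3) y] by (auto simp: s_def)
    ultimately have "s \<in> units_mod y" by (simp add: units_mod_def)
    moreover have "q \<in> tail_denoms N y s" using T 1 y by (simp add: tail_denoms_def)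
    ultimately show ?thesis using t by (simp add: f_def s_def)
  qed
  show "\<exists>t\<in>conv_triples N y. sq = f t" if sq: "sq \<in> Sigma (units_mod y) (tail_denoms N y)" for sq
  proof -
    obtain s q where sqe: "sq = (s, q)" by (cases sq)
    have s: "0 \<le> s" "s < y" "coprime s y" and q: "q > 0" "2 * (q * y) < N" "y dvd q * s - N"
      "coprime q ((q * s - N) div y)"
      using sq sqe by (auto simp: units_mod_def tail_denoms_def)
    define q0 where "q0 = (q * s - N) div y"
    have q0: "q * s - N = q0 * y" using q(3) by (simp add: q0_def)
    obtain u w where "u * q0 + w * q = 1"
      using q(4) bezout_int[of q0 q] by (auto simp: coprime_iff_gcd_eq_1 gcd.commute q0_def)
    then have uw: "q0 * u - q * (- w) = 1" by (simp add: algebra_simps)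
    \<comment> \<open>Any solution of the determinant equation yields some \<open>a\<close>;
      subtracting \<open>k\<close> times \<open>(q, q0)\<close> from it lowers \<open>a\<close> by
      \<open>k * N\<close> into the range of representatives.\<close>
    define k where "k = (s * u - y * (- w)) div N"
    define p where "p = u - k * q"
    define p0 where "p0 = - w - k * q0"
    define a where "a = s * p - y * p0"
    have b: "q0 * p - q * p0 = 1" using uw by (simp add: p_def p0_def algebra_simps)
    have "a = (s * u - y * (- w)) - k * (q * s - q0 * y)" by (simp add: a_def p_def p0_def algebra_simps)
    also have "q * s - q0 * y = N" using q0 by simp
    finally have "a = (s * u - y * (- w)) mod N" by (simp add: k_def minus_div_mult_eq_mod)
    then have a: "0 \<le> a" "a < N" using N by auto
    have Ne: "N = q * s - q0 * y" using q0 by simp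
    have "a * q - p * N = y * (q0 * p - q * p0)" by (simp add: a_def Ne algebra_simps)
    then have r: "a * q - p * N = y" using b by simp
    have "a * q0 - p0 * N = s * (q0 * p - q * p0)" by (simp add: a_def Ne algebra_simps)
    then have r0: "a * q0 - p0 * N = s" using b by simp
    have "coprime a N"
    proof (rule coprimeI)
      fix d assume d: "d dvd a" "d dvd N"
      then have "d dvd a * q - p * N" "d dvd a * q0 - p0 * N" by simp_all
      then show "is_unit d" using r r0 s(3) coprime_common_divisor by metis
    qed
    have cop: "coprime q p" using coprime_if_bezout b by blast
    have "bezout_pair N a q p y = (q0, p0)"
      using tail_res_unique[OF cop r y q(1) b] r0 s by simp
    then have "tail_res N a q p y = s" using r0 by (simp add: tail_res_def)
    moreover have "(a, q, p) \<in> conv_triples N y"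
      using a \<open>coprime a N\<close> cop r q by (simp add: conv_triples_def units_mod_def)
    ultimately show ?thesis using sqe by (intro bexI[of _ "(a, q, p)"]) (simp_all add: f_def)
  qed
qed

section \<open>Monotone weights on residue classes\<close>

lemma sum_AP:
  fixes y c :: int and H :: "int \<Rightarrow> real"
  assumes "y > 0" "1 \<le> c" "c \<le> y"
  shows "(\<Sum>q | q \<in> {1..y * int J} \<and> y dvd q - c. H q) = (\<Sum>j<J. H (c + y * int j))"
proof (rule sum.reindex_bij_witness[where i = "\<lambda>j. c + y * int j" and j = "\<lambda>q. nat ((q - c) div y)"])
  fix q assume q: "q \<in> {q. q \<in> {1..y * int J} \<and> y dvd q - c}"
  then obtain k where "q - c = y * k" by (auto elim: dvdE)
  then have k: "q = c + y * k" by simp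
  have q': "1 \<le> q" "q \<le> y * int J" using q by auto
  have "y * (-1) < y * k" using k q' assms by linarith
  then have "-1 < k" using assms(1) by (simp only: mult_less_cancel_left_pos)
  moreover have "y * k < y * int J" using k q' assms by linarith
  then have "k < int J" using assms(1) by (simp only: mult_less_cancel_left_pos)
  moreover have "(q - c) div y = k" using k assms by simp
  ultimately show "c + y * int (nat ((q - c) div y)) = q" "nat ((q - c) div y) \<in> {..<J}"
    "H (c + y * int (nat ((q - c) div y))) = H q"
    using k by auto
next
  fix j assume j: "j \<in> {..<J}"
  have "y * (int j + 1) \<le> y * int J" using j assms by (intro mult_left_mono) auto
  then have "y * int j + y \<le> y * int J" by (simp add: algebra_simps)
  moreover have "0 \<le> y * int j" using assms by simp
  ultimately have "1 \<le> c + y * int j" "c + y * int j \<le> y * int J" using assms by linarith+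
  then show "c + y * int j \<in> {q. q \<in> {1..y * int J} \<and> y dvd q - c}" by simp
  show "nat ((c + y * int j - c) div y) = j" using assms by simp
qed

text \<open>Progressions with the same difference interlace. For a decreasing \<open>H\<close>, the
  sum with the larger start is the smaller one, and shifting the other by one term reverses the
  comparison, so they differ by at most one value of \<open>H\<close>.\<close>

lemma AP_interlace:
  fixes y c c' :: int and H :: "int \<Rightarrow> real"
  assumes y: "y > 0" and c: "1 \<le> c" "c \<le> y" and c': "1 \<le> c'" "c' \<le> y"
    and H: "\<And>q. q > 0 \<Longrightarrow> 0 \<le> H q \<and> H q \<le> T" "\<And>q q'. 0 < q \<Longrightarrow> q \<le> q' \<Longrightarrow> H q' \<le> H q"
    and T: "T \<ge> 0"
  shows "\<bar>(\<Sum>j<J. H (c + y * int j)) - (\<Sum>j<J. H (c' + y * int j))\<bar> \<le> T"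
proof -
  have main: "0 \<le> (\<Sum>j<J. H (c + y * int j)) - (\<Sum>j<J. H (c' + y * int j)) \<and>
       (\<Sum>j<J. H (c + y * int j)) - (\<Sum>j<J. H (c' + y * int j)) \<le> T"
    if c: "1 \<le> c" "c \<le> c'" and c': "c' \<le> y" for c c'
  proof (intro conjI)
    have pos: "0 < c + y * int j" "0 < c' + y * int j" for j using that y by (auto intro: add_pos_nonneg)
    have "(\<Sum>j<J. H (c' + y * int j)) \<le> (\<Sum>j<J. H (c + y * int j))"
      using that pos by (intro sum_mono H) auto
    then show "0 \<le> (\<Sum>j<J. H (c + y * int j)) - (\<Sum>j<J. H (c' + y * int j))" by simp
    show "(\<Sum>j<J. H (c + y * int j)) - (\<Sum>j<J. H (c' + y * int j)) \<le> T"
    proof (cases J)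
      case (Suc K)
      have "(\<Sum>j<J. H (c + y * int j)) = H c + (\<Sum>j<K. H (c + y * int (Suc j)))"
        unfolding Suc by (subst sum.lessThan_Suc_shift) simp
      also have "\<dots> \<le> T + (\<Sum>j<K. H (c' + y * int j))"
      proof (rule add_mono)
        show "H c \<le> T" using H(1)[of c] that by simp
        have "H (c + y * int (Suc j)) \<le> H (c' + y * int j)" for j
        proof (rule H(2)[OF pos(2)])
          have "y * int (Suc j) = y + y * int j" by (simp add: algebra_simps)
          then show "c' + y * int j \<le> c + y * int (Suc j)" using that by linarith
        qed
        then show "(\<Sum>j<K. H (c + y * int (Suc j))) \<le> (\<Sum>j<K. H (c' + y * int j))" by (intro sum_mono)
      qed
      also have "(\<Sum>j<K. H (c' + y * int j)) \<le> (\<Sum>j<J. H (c' + y * int j))"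
        unfolding Suc using H(1) pos by simp
      finally show ?thesis by simp
    qed (use T in simp)
  qed
  show ?thesis
  proof (cases "c \<le> c'")
    case True
    then show ?thesis using main[of c c'] c c' by linarith
  next
    case False
    then show ?thesis using main[of c' c] c c' by linarith
  qed
qed

lemma congruence_class_rep:
  fixes s y n :: int
  assumes "coprime s y" "y > 0"
  obtains c where "1 \<le> c" "c \<le> y" "\<And>q. y dvd q * s - n \<longleftrightarrow> y dvd q - c"
proof -
  obtain u w where uw: "u * s + w * y = 1"
    using assms(1) bezout_int[of s y] by (auto simp: coprime_iff_gcd_eq_1)
  \<comment> \<open>The representative is taken from 1 to \<open>y\<close>, so that all terms
    \<open>c + y * j\<close> are positive denominators.\<close>
  define c where "c = (n * u - 1) mod y + 1"
  have "0 \<le> (n * u - 1) mod y" "(n * u - 1) mod y < y" using assms(2) by auto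
  then have c: "1 \<le> c" "c \<le> y" unfolding c_def by linarith+
  have "y dvd c - n * u"
  proof -
    have "c - n * u = - (y * ((n * u - 1) div y))"
      using mult_div_mod_eq[of y "n * u - 1"] by (simp add: c_def algebra_simps)
    then show ?thesis by simp
  qed
  then have "y dvd (c - n * u) * s" by simp
  moreover have "(c - n * u) * s = (c * s - n) + n * (w * y)"
  proof -
    have "u * s = 1 - w * y" using uw by linarith
    then have "n * (u * s) = n * (1 - w * y)" by simp
    then show ?thesis by (simp add: algebra_simps)
  qed
  ultimately have cs: "y dvd c * s - n" by (simp add: dvd_add_left_iff)
  have "y dvd q * s - n \<longleftrightarrow> y dvd q - c" for q
  proof -
    have "q * s - n = (q - c) * s + (c * s - n)" by (simp add: algebra_simps)
    then have "y dvd q * s - n \<longleftrightarrow> y dvd (q - c) * s" by (simp only: dvd_add_left_iff[OF cs])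
    also have "\<dots> \<longleftrightarrow> y dvd q - c" using assms(1) by (simp add: coprime_dvd_mult_left_iff coprime_commute)
    finally show ?thesis .
  qed
  then show ?thesis using c that by blast
qed

definition denom_weight :: "(real \<Rightarrow> real) \<Rightarrow> int \<Rightarrow> int \<Rightarrow> int \<Rightarrow> real" where
  "denom_weight g N y s = (\<Sum>q\<in>tail_denoms N y s. g (real_of_int N / real_of_int (q * y)))"

text \<open>A sieve removes the condition that \<open>q\<close> and \<open>q0\<close> be coprime.
  Each of its terms is a sum of a decreasing function over one residue class modulo
  \<open>y\<close>, and changing \<open>s\<close> only changes the class, at a cost of at most
  \<open>T\<close>.\<close>

lemma denom_weight_diff:
  fixes g :: "real \<Rightarrow> real"
  assumes N: "N > 0" and y: "y > 0" and s: "coprime s y" "coprime s' y"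
    and g: "mono g" "\<And>z. 0 \<le> g z \<and> g z \<le> T" "\<And>z. z \<le> 2 \<Longrightarrow> g z = 0"
  shows "\<bar>denom_weight g N y s - denom_weight g N y s'\<bar> \<le> omega_pow (nat N) * T"
proof -
  have T: "T \<ge> 0" using g(2)[of 0] by linarith
  \<comment> \<open>\<open>M\<close> is a multiple of \<open>y\<close> beyond the support of
    \<open>h\<close>, so every class modulo \<open>y\<close> has exactly \<open>J\<close> members up
    to \<open>M\<close>.\<close>
  define J where "J = nat N"
  define M where "M = y * int J"
  have MN: "N \<le> M"
  proof -
    have "1 * N \<le> y * N" using y N by (intro mult_right_mono) auto
    then show ?thesis using N by (simp add: M_def J_def)
  qed
  define P where "P = prime_factors (nat N)"
  have Pdvd: "p dvd nat N \<longleftrightarrow> int p dvd N" for p using dvd_nat_abs_iff[of p N] N by simp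
  have P: "finite P" "\<And>p. p \<in> P \<Longrightarrow> prime p" "\<And>p. p \<in> P \<Longrightarrow> int p dvd N"
    using N by (auto simp: P_def in_prime_factors_iff Pdvd)
  define h where "h = (\<lambda>q. g (real_of_int N / real_of_int (q * y)))"
  have h0: "h q = 0" if "q > 0" "N \<le> 2 * (q * y)" for q
  proof -
    have "real_of_int N \<le> 2 * real_of_int (q * y)" using that(2) by linarith
    moreover have "real_of_int (q * y) > 0" using that y by simp
    ultimately have "real_of_int N / real_of_int (q * y) \<le> 2" by (simp add: divide_le_eq)
    then show ?thesis by (simp add: h_def g(3))
  qed
  have hM: "h q = 0" if "q > M" for q
  proof (rule h0)
    show q0: "q > 0" using that MN N by linarith
    have "q * 1 \<le> q * y" using y q0 by (intro mult_left_mono) auto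
    then show "N \<le> 2 * (q * y)" using that MN q0 by linarith
  qed
  have hmono: "h q' \<le> h q" if "0 < q" "q \<le> q'" for q q'
  proof -
    have "q * y > 0" "q * y \<le> q' * y" using that y by (auto intro: mult_right_mono)
    then have "real_of_int (q * y) \<le> real_of_int (q' * y)" "0 < real_of_int (q * y)"
      by (simp_all only: of_int_le_iff of_int_0_less_iff)
    then have "real_of_int N / real_of_int (q' * y) \<le> real_of_int N / real_of_int (q * y)"
      using N by (intro divide_left_mono mult_pos_pos) auto
    then show ?thesis unfolding h_def using g(1) by (rule monoD[rotated])
  qed
  define inner where "inner = (\<lambda>s X. \<Sum>q | q \<in> {q \<in> {1..M}. y dvd q * s - N} \<and>
      (\<forall>p\<in>X. int p dvd q \<and> int p dvd (q * s - N) div y). h q)"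
  have W: "denom_weight g N y s = (\<Sum>X\<in>Pow P. (-1) ^ card X * inner s X)" if s: "coprime s y" for s
  proof -
    have cop: "coprime q ((q * s - N) div y) \<longleftrightarrow> (\<forall>p\<in>P. \<not> (int p dvd q \<and> int p dvd (q * s - N) div y))"
      if q: "y dvd q * s - N" for q
    proof
      assume c: "coprime q ((q * s - N) div y)"
      show "\<forall>p\<in>P. \<not> (int p dvd q \<and> int p dvd (q * s - N) div y)"
      proof (intro ballI notI)
        fix p assume "p \<in> P" "int p dvd q \<and> int p dvd (q * s - N) div y"
        then have "is_unit (int p)" "prime p" using c P coprime_common_divisor by blast+
        then show False by simp
      qed
    next
      assume c: "\<forall>p\<in>P. \<not> (int p dvd q \<and> int p dvd (q * s - N) div y)"
      show "coprime q ((q * s - N) div y)"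
      proof (rule ccontr)
        assume "\<not> coprime q ((q * s - N) div y)"
        then have "gcd q ((q * s - N) div y) \<noteq> 1" by (simp add: coprime_iff_gcd_eq_1)
        then have "nat (gcd q ((q * s - N) div y)) \<noteq> 1" by (simp add: nat_eq_iff)
        then obtain p where p: "prime p" "p dvd nat (gcd q ((q * s - N) div y))"
          using prime_factor_nat by blast
        then have "p dvd nat \<bar>gcd q ((q * s - N) div y)\<bar>" by (simp only: abs_gcd_int)
        then have "int p dvd gcd q ((q * s - N) div y)" by (simp only: dvd_nat_abs_iff)
        then have d: "int p dvd q" "int p dvd (q * s - N) div y" by (meson dvd_trans gcd_dvd1 gcd_dvd2)+
        \<comment> \<open>A common prime of \<open>q\<close> and \<open>q0\<close> divides
          \<open>N\<close>; hence one finite set of primes serves the sieve for every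
          \<open>s\<close>.\<close>
        have "N = q * s - y * ((q * s - N) div y)" using q by simp
        then have "int p dvd N" using d by (metis dvd_diff dvd_mult dvd_mult2)
        then have "p \<in> P" using p N by (auto simp: P_def in_prime_factors_iff Pdvd)
        then show False using c d by blast
      qed
    qed
    have "denom_weight g N y s = (\<Sum>q | q \<in> {q \<in> {1..M}. y dvd q * s - N} \<and>
      (\<forall>p\<in>P. \<not> (int p dvd q \<and> int p dvd (q * s - N) div y)). h q)"
      unfolding denom_weight_def h_def[symmetric]
    proof (rule sum.mono_neutral_left)
      show "tail_denoms N y s \<subseteq> {q. q \<in> {q \<in> {1..M}. y dvd q * s - N} \<and>
         (\<forall>p\<in>P. \<not> (int p dvd q \<and> int p dvd (q * s - N) div y))}"
      proof
        fix q assume "q \<in> tail_denoms N y s"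
        then have q: "q > 0" "2 * (q * y) < N" "y dvd q * s - N" "coprime q ((q * s - N) div y)"
          by (auto simp: tail_denoms_def)
        have "q * 1 \<le> q * y" using y q by (intro mult_left_mono) auto
        then have "q \<le> M" using q MN by linarith
        then show "q \<in> {q. q \<in> {q \<in> {1..M}. y dvd q * s - N} \<and>
         (\<forall>p\<in>P. \<not> (int p dvd q \<and> int p dvd (q * s - N) div y))}"
          using q cop[OF q(3)] by auto
      qed
      show "\<forall>q\<in>{q. q \<in> {q \<in> {1..M}. y dvd q * s - N} \<and>
         (\<forall>p\<in>P. \<not> (int p dvd q \<and> int p dvd (q * s - N) div y))} - tail_denoms N y s. h q = 0"
      proof
        fix q assume q: "q \<in> {q. q \<in> {q \<in> {1..M}. y dvd q * s - N} \<and>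
         (\<forall>p\<in>P. \<not> (int p dvd q \<and> int p dvd (q * s - N) div y))} - tail_denoms N y s"
        then have "q > 0" "\<not> 2 * (q * y) < N" using cop[of q] by (auto simp: tail_denoms_def)
        then show "h q = 0" by (intro h0) auto
      qed
    qed (rule finite_subset[of _ "{1..M}"], auto)
    also have "\<dots> = (\<Sum>X\<in>Pow P. (-1) ^ card X * inner s X)"
      unfolding inner_def using P(1)
      by (intro sum_inclusion_exclusion) (rule finite_subset[of _ "{1..M}"], auto)
    finally show ?thesis .
  qed
  have inner: "\<bar>inner s X - inner s' X\<bar> \<le> T" if X: "X \<in> Pow P" for X
  proof -
    have X': "finite X" "\<And>p. p \<in> X \<Longrightarrow> prime p" using X P finite_subset by auto
    define e where "e = int (\<Prod>X)"
    have e0: "e > 0" using X'(2) unfolding e_def by (auto intro!: prod_pos simp: prime_gt_0_nat)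
    have ed: "(\<forall>p\<in>X. int p dvd m) \<longleftrightarrow> e dvd m" for m
    proof -
      have "(\<forall>p\<in>X. p dvd nat \<bar>m\<bar>) \<longleftrightarrow> \<Prod>X dvd nat \<bar>m\<bar>" using prod_primes_dvd_iff[OF X'] by metis
      then show ?thesis unfolding e_def dvd_nat_abs_iff .
    qed
    have "\<forall>p\<in>X. int p dvd N" using X P by auto
    then obtain n where n: "N = e * n" using ed by (auto elim: dvdE)
    \<comment> \<open>With \<open>q = e * x\<close> the two divisibility conditions say that
      \<open>y * e\<close> divides \<open>e * (x * s - n)\<close>, so \<open>e\<close> cancels and a
      single congruence modulo \<open>y\<close> is left. Values \<open>e * x\<close> beyond
      \<open>M\<close> carry weight 0.\<close>
    have red: "inner s X = (\<Sum>q | q \<in> {1..M} \<and> y dvd q * s - n. h (e * q))" if s: "coprime s y" for s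
    proof -
      define I where "I = {q. q \<in> {q \<in> {1..M}. y dvd q * s - N} \<and> (\<forall>p\<in>X. int p dvd q \<and> int p dvd (q * s - N) div y)}"
      define K where "K = {q. q \<in> {1..M} \<and> y dvd q * s - n}"
      have I: "q \<in> I \<longleftrightarrow> q \<in> {1..M} \<and> y dvd q * s - N \<and> e dvd q \<and> e dvd (q * s - N) div y" for q
        unfolding I_def using ed[of q] ed[of "(q * s - N) div y"] by auto
      have finK: "finite K" by (rule finite_subset[of _ "{1..M}"]) (auto simp: K_def)
      have "(\<Sum>q\<in>I. h q) = (\<Sum>q\<in>(\<lambda>x. e * x) ` K. h q)"
      proof (rule sum.mono_neutral_left)
        show "I \<subseteq> (\<lambda>x. e * x) ` K"
        proof
          fix q assume "q \<in> I"
          then have q: "q \<in> {1..M}" "y dvd q * s - N" "e dvd q" "e dvd (q * s - N) div y" using I by auto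
          obtain x where x: "q = e * x" using q(3) by (auto elim: dvdE)
          have "e * x > 0" using x q(1) by simp
          then have "x > 0" using e0 by (simp add: zero_less_mult_iff)
          moreover from this have "x \<le> e * x" using e0 mult_right_mono[of 1 e x] by simp
          moreover have "y dvd x * s - n"
          proof -
            have "y * e dvd y * ((q * s - N) div y)" using q(4) by simp
            moreover have "y * ((q * s - N) div y) = q * s - N" using q(2) by (rule dvd_mult_div_cancel)
            moreover have "q * s - N = e * (x * s - n)" by (simp add: x n algebra_simps)
            ultimately have "y * e dvd e * (x * s - n)" by metis
            then have "e * y dvd e * (x * s - n)" by (simp only: mult.commute)
            then show ?thesis using e0 by simp
          qed
          moreover have "e * x \<le> M" using q(1) x by simp
          ultimately have "x \<in> {1..M}" "y dvd x * s - n" by (simp only: atLeastAtMost_iff, linarith, blast)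
          then have "x \<in> K" by (simp add: K_def)
          then show "q \<in> (\<lambda>x. e * x) ` K" using x by blast
        qed
        show "\<forall>q\<in>(\<lambda>x. e * x) ` K - I. h q = 0"
        proof
          fix q assume q: "q \<in> (\<lambda>x. e * x) ` K - I"
          then obtain x where x: "q = e * x" "x \<in> K" by auto
          then have x1: "x \<ge> 1" "y dvd x * s - n" by (auto simp: K_def)
          have qs: "q * s - N = e * (x * s - n)" by (simp add: x n algebra_simps)
          have q1: "q \<ge> 1" using x(1) x1 e0 by (simp add: int_one_le_iff_zero_less)
          have "y dvd q * s - N" using x1(2) qs by simp
          moreover have "e dvd (q * s - N) div y" using x1(2) unfolding qs
            by (metis div_mult_swap dvd_triv_left)
          moreover have "e dvd q" using x by simp
          ultimately have "q \<notin> {1..M}" using q I by blast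
          then have "q > M" using q1 by simp
          then show "h q = 0" by (rule hM)
        qed
      qed (use finK in auto)
      also have "\<dots> = (\<Sum>x\<in>K. h (e * x))"
        using e0 by (subst sum.reindex) (auto simp: inj_on_def)
      finally show ?thesis unfolding inner_def I_def K_def .
    qed
    have AP: "\<exists>c. 1 \<le> c \<and> c \<le> y \<and> inner s X = (\<Sum>j<J. h (e * (c + y * int j)))" if s: "coprime s y" for s
    proof -
      obtain c where c: "1 \<le> c" "c \<le> y" "\<And>q. y dvd q * s - n \<longleftrightarrow> y dvd q - c"
        using congruence_class_rep[OF s y] by metis
      have "inner s X = (\<Sum>q | q \<in> {1..M} \<and> y dvd q - c. h (e * q))" unfolding red[OF s] c(3) ..
      also have "\<dots> = (\<Sum>j<J. h (e * (c + y * int j)))"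
        unfolding M_def by (rule sum_AP[OF y c(1,2)])
      finally show ?thesis using c by blast
    qed
    obtain c where c: "1 \<le> c" "c \<le> y" "inner s X = (\<Sum>j<J. h (e * (c + y * int j)))" using AP[OF s(1)] by blast
    obtain c' where c': "1 \<le> c'" "c' \<le> y" "inner s' X = (\<Sum>j<J. h (e * (c' + y * int j)))" using AP[OF s(2)] by blast
    show ?thesis unfolding c(3) c'(3)
    proof (rule AP_interlace[OF y c(1,2) c'(1,2), where H = "\<lambda>x. h (e * x)"])
      show "h (e * q') \<le> h (e * q)" if "0 < q" "q \<le> q'" for q q'
        using that e0 by (intro hmono) auto
    qed (use T g(2) in \<open>auto simp: h_def\<close>)
  qed
  have "\<bar>denom_weight g N y s - denom_weight g N y s'\<bar> = \<bar>\<Sum>X\<in>Pow P. (-1) ^ card X * (inner s X - inner s' X)\<bar>"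
    unfolding W[OF s(1)] W[OF s(2)] by (simp add: sum_subtractf algebra_simps)
  also have "\<dots> \<le> (\<Sum>X\<in>Pow P. \<bar>(-1) ^ card X * (inner s X - inner s' X)\<bar>)" by (rule sum_abs)
  also have "\<dots> \<le> (\<Sum>X\<in>Pow P. T)"
    using inner by (intro sum_mono) (simp add: abs_mult)
  also have "\<dots> = omega_pow (nat N) * T" using P by (simp add: omega_pow_def P_def card_Pow)
  finally show ?thesis .
qed

lemma bij_betw_units_mod_uminus:
  assumes "y > 0"
  shows "bij_betw (\<lambda>s. (- s) mod y) (units_mod y) (units_mod y)"
proof (rule bij_betw_byWitness[where f' = "\<lambda>s. (- s) mod y"])
  have "(- ((- s) mod y)) mod y = s" if "s \<in> units_mod y" for s
    using that by (simp add: mod_minus_eq units_mod_def)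
  then show "\<forall>s\<in>units_mod y. (- ((- s) mod y)) mod y = s" "\<forall>s\<in>units_mod y. (- ((- s) mod y)) mod y = s"
    by blast+
  have "coprime ((- s) mod y) y" if "coprime s y" for s
    using that assms by simp
  then show "(\<lambda>s. (- s) mod y) ` units_mod y \<subseteq> units_mod y" "(\<lambda>s. (- s) mod y) ` units_mod y \<subseteq> units_mod y"
    using assms by (auto simp: units_mod_def)
qed

text \<open>Grouped by \<open>s\<close>, the sum is minus that of \<open>F s * W s\<close>, where
  \<open>F\<close> is odd. Pairing \<open>s\<close> with \<open>- s\<close> turns twice the latter
  into the sum of \<open>F s * (W s - W (- s))\<close>, and the weights of \<open>s\<close> and
  \<open>- s\<close> nearly agree.\<close>

lemma cross_sum_bound:
  fixes g :: "real \<Rightarrow> real"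
  assumes N: "N > 0" and y: "y > 0"
    and g: "mono g" "\<And>z. 0 \<le> g z \<and> g z \<le> T" "\<And>z. z \<le> 2 \<Longrightarrow> g z = 0"
  shows "\<bar>\<Sum>(a, q, p)\<in>conv_triples N y. g (real_of_int N / real_of_int (q * y)) * conv_sum g y (- tail_res N a q p y)\<bar>
    \<le> omega_pow (nat N) * T * (\<Sum>s\<in>units_mod y. \<bar>conv_sum g y s\<bar>)"
proof -
  define F where "F = conv_sum g y"
  define W where "W = denom_weight g N y"
  define G where "G = (\<lambda>(s, q). g (real_of_int N / real_of_int (q * y)) * F (- s))"
  have fin: "finite (tail_denoms N y s)" for s
  proof (rule finite_subset)
    show "tail_denoms N y s \<subseteq> {0..N}"
    proof
      fix q assume "q \<in> tail_denoms N y s"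
      then have q: "q > 0" "2 * (q * y) < N" by (auto simp: tail_denoms_def)
      have "q * 1 \<le> q * y" using y q by (intro mult_left_mono) auto
      then have "q \<le> N" using q by linarith
      then show "q \<in> {0..N}" using q by auto
    qed
  qed auto
  have "(\<Sum>(a, q, p)\<in>conv_triples N y. g (real_of_int N / real_of_int (q * y)) * F (- tail_res N a q p y)) =
      (\<Sum>t\<in>conv_triples N y. G ((\<lambda>(a, q, p). (tail_res N a q p y, q)) t))"
    by (simp add: G_def case_prod_beta)
  also have "\<dots> = (\<Sum>t\<in>Sigma (units_mod y) (tail_denoms N y). G t)"
    by (rule sum.reindex_bij_betw[OF bij_betw_conv_triples[OF N y]])
  also have "\<dots> = (\<Sum>s\<in>units_mod y. \<Sum>q\<in>tail_denoms N y s. G (s, q))"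
    using fin by (subst sum.Sigma) auto
  also have "\<dots> = (\<Sum>s\<in>units_mod y. - F s * W s)"
    by (simp add: G_def W_def denom_weight_def sum_distrib_left F_def conv_sum_uminus sum_negf mult.commute)
  finally have S1: "(\<Sum>(a, q, p)\<in>conv_triples N y. g (real_of_int N / real_of_int (q * y)) * F (- tail_res N a q p y))
      = - (\<Sum>s\<in>units_mod y. F s * W s)" by (simp add: sum_negf)
  have "(\<Sum>s\<in>units_mod y. F s * W s) = (\<Sum>s\<in>units_mod y. F ((- s) mod y) * W ((- s) mod y))"
    by (rule sum.reindex_bij_betw[OF bij_betw_units_mod_uminus[OF y], symmetric])
  also have "\<dots> = - (\<Sum>s\<in>units_mod y. F s * W ((- s) mod y))"
    by (simp add: F_def conv_sum_mod conv_sum_uminus sum_negf)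
  finally have "2 * (\<Sum>s\<in>units_mod y. F s * W s) = (\<Sum>s\<in>units_mod y. F s * W s) - (\<Sum>s\<in>units_mod y. F s * W ((- s) mod y))"
    by simp
  also have "\<dots> = (\<Sum>s\<in>units_mod y. F s * (W s - W ((- s) mod y)))"
    by (simp add: sum_subtractf right_diff_distrib)
  finally have "\<bar>2 * (\<Sum>s\<in>units_mod y. F s * W s)\<bar> \<le> (\<Sum>s\<in>units_mod y. \<bar>F s * (W s - W ((- s) mod y))\<bar>)"
    by simp
  also have "\<dots> \<le> (\<Sum>s\<in>units_mod y. \<bar>F s\<bar> * (omega_pow (nat N) * T))"
  proof (intro sum_mono)
    fix s assume s: "s \<in> units_mod y"
    then have "(- s) mod y \<in> units_mod y" using bij_betw_units_mod_uminus[OF y] by (auto simp: bij_betw_def)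
    then have "\<bar>W s - W ((- s) mod y)\<bar> \<le> omega_pow (nat N) * T"
      unfolding W_def using s by (intro denom_weight_diff[OF N y _ _ g]) (auto simp: units_mod_def)
    then show "\<bar>F s * (W s - W ((- s) mod y))\<bar> \<le> \<bar>F s\<bar> * (omega_pow (nat N) * T)"
      unfolding abs_mult by (intro mult_left_mono) auto
  qed
  also have "\<dots> = omega_pow (nat N) * T * (\<Sum>s\<in>units_mod y. \<bar>F s\<bar>)"
    by (simp add: sum_distrib_left mult.commute)
  finally show ?thesis using S1 unfolding F_def by linarith
qed

lemma lattice_res_eqD:
  assumes "fst v = fst v'" "lattice_res N a v = lattice_res N a v'" "N > 0"
  shows "v = v'"
proof -
  have "snd v * N = snd v' * N" using assms(1,2) by (simp add: lattice_res_def)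
  then show ?thesis using assms(1,3) by (simp add: prod_eq_iff)
qed

section \<open>Moments\<close>

text \<open>For fixed \<open>|r|\<close>, large quality is just a bound on the denominator, which
  the lattice pair counts can handle.\<close>

lemma quality_ge_iff:
  assumes "v \<in> conv_vecs (int N) a" "i > 0" "\<bar>lattice_res (int N) a v\<bar> = int y"
  shows "real i \<le> quality (int N) a v \<longleftrightarrow> fst v \<le> int (N div (i * y))"
proof -
  note D = conv_vecsD[OF assms(1)]
  define q where "q = nat (fst v)"
  have q: "fst v = int q" "q > 0" using D by (auto simp: q_def)
  have y: "y > 0" using D assms by auto
  have "real i \<le> quality (int N) a v \<longleftrightarrow> real i * (real q * real y) \<le> real N"
    unfolding quality_def assms(3) q using q y by (simp add: le_divide_eq)
  also have "\<dots> \<longleftrightarrow> q * (i * y) \<le> N"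
    by (metis (no_types, opaque_lifting) mult.left_commute of_nat_le_iff of_nat_mult)
  also have "\<dots> \<longleftrightarrow> q \<le> N div (i * y)" using assms y by (simp add: less_eq_div_iff_mult_less_eq)
  finally show ?thesis using q by simp
qed

lemma uminus_in_totatives:
  assumes "a \<in> totatives N" "N > 1"
  shows "N - a \<in> totatives N"
proof -
  have a: "0 < a" "a < N" "coprime a N" using assms totatives_less by (auto simp: in_totatives_iff)
  have "coprime (N - a) N" using gcd_diff2_nat[of a N] a by (simp only: coprime_iff_gcd_eq_1)
  then show ?thesis using a by (auto simp: in_totatives_iff)
qed

text \<open>Reflecting \<open>a\<close> when the residue is negative makes both signs instances of
  the same congruence with \<open>y > 0\<close>.\<close>

lemma conv_vecs_congruence:
  assumes N: "N > 1" and a: "a \<in> totatives N" and e: "e = 1 \<or> e = (-1::int)"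
    and v: "lattice_res (int N) (int a) v = e * int y" "fst v = int q"
  shows "(if e = 1 then a else N - a) \<in> totatives N" "[(if e = 1 then a else N - a) * q = y] (mod N)"
proof -
  define b where "b = (if e = 1 then a else N - a)"
  have lt: "a < N" using a N totatives_less by blast
  show "(if e = 1 then a else N - a) \<in> totatives N" using a uminus_in_totatives[OF a N] by simp
  have eq: "int a * int q - snd v * int N = e * int y" using v by (simp add: lattice_res_def)
  have "[int b * int q = int y] (mod int N)"
  proof (cases "e = 1")
    case True
    then have "int b * int q - int y = int N * snd v" using eq by (simp add: b_def algebra_simps)
    then show ?thesis by (simp add: cong_iff_dvd_diff)
  next
    case False
    then have "e = -1" using e by simp
    then have "int b * int q - int y = int N * (int q - snd v)" using eq lt
      by (simp add: b_def of_nat_diff algebra_simps)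
    then show ?thesis by (simp add: cong_iff_dvd_diff)
  qed
  then have "[b * q = y] (mod N)" by (simp flip: of_nat_mult add: cong_int_iff)
  then show "[(if e = 1 then a else N - a) * q = y] (mod N)" by (simp add: b_def)
qed

lemma card_conv_vecs_res_le:
  assumes N: "N > 1" and y: "y > 0" and e: "e = 1 \<or> e = (-1::int)"
  shows "real (card {(a, v). a \<in> totatives N \<and> v \<in> conv_vecs (int N) (int a) \<and>
      lattice_res (int N) (int a) v = e * int y \<and> fst v \<le> int n})
    \<le> real (totient N) * real n / real N + real (gcd y N) * omega_pow N"
proof -
  define A where "A = {(a, v). a \<in> totatives N \<and> v \<in> conv_vecs (int N) (int a) \<and>
      lattice_res (int N) (int a) v = e * int y \<and> fst v \<le> int n}"
  define B where "B = {aq \<in> totatives N \<times> {1..n}. [fst aq * snd aq = y] (mod N)}"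
  define f where "f = (\<lambda>(a, v::int\<times>int). (if e = 1 then a else N - a, nat (fst v)))"
  have lt: "a < N" if "a \<in> totatives N" for a using that N totatives_less by blast
  have "inj_on f A"
  proof (rule inj_onI)
    fix x x' assume xx: "x \<in> A" "x' \<in> A" "f x = f x'"
    obtain a v where x: "x = (a, v)" by (cases x)
    obtain a' v' where x': "x' = (a', v')" by (cases x')
    have aa: "a \<in> totatives N" "a' \<in> totatives N" and v: "v \<in> conv_vecs (int N) (int a)" "v' \<in> conv_vecs (int N) (int a')"
      and r: "lattice_res (int N) (int a) v = e * int y" "lattice_res (int N) (int a') v' = e * int y"
      using xx x x' by (auto simp: A_def)
    have a: "a = a'" using xx(3) x x' lt[OF aa(1)] lt[OF aa(2)] by (auto simp: f_def split: if_splits)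
    have "fst v = fst v'" using xx(3) x x' conv_vecsD(1)[OF v(1)] conv_vecsD(1)[OF v(2)]
      by (auto simp: f_def)
    then have "v = v'" using r a N by (intro lattice_res_eqD[of v v' "int N" "int a"]) auto
    then show "x = x'" using a x x' by simp
  qed
  moreover have "f ` A \<subseteq> B"
  proof
    fix z assume "z \<in> f ` A"
    then obtain a v where z: "z = f (a, v)" and a: "a \<in> totatives N" and v: "v \<in> conv_vecs (int N) (int a)"
      and r: "lattice_res (int N) (int a) v = e * int y" and n: "fst v \<le> int n"
      by (auto simp: A_def)
    define q where "q = nat (fst v)"
    have q: "fst v = int q" "q \<ge> 1" using conv_vecsD(1)[OF v] by (auto simp: q_def)
    show "z \<in> B" using z conv_vecs_congruence[OF N a e r q(1)] q n by (auto simp: f_def B_def)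
  qed
  moreover have "finite B" by (rule finite_subset[of _ "totatives N \<times> {1..n}"]) (auto simp: B_def)
  ultimately have "card A \<le> card B" by (rule card_inj_on_le)
  also have "real (card B) \<le> real (totient N) * real n / real N + real (gcd y N) * omega_pow N"
    unfolding B_def using N y by (intro card_lattice_pairs_le) auto
  finally show ?thesis by (simp add: A_def)
qed

lemma finite_conv_pairs: "finite {(a, v). a \<in> totatives N \<and> v \<in> conv_vecs (int N) (int a) \<and> P a v}"
  by (rule finite_subset[of _ "Sigma (totatives N) (\<lambda>a. conv_vecs (int N) (int a))"]) auto

text \<open>Layer cake: \<open>h\<close> is dominated by steps of height \<open>w i\<close> at the
  integers \<open>i\<close>. Vectors with \<open>|r| = y\<close> and quality at least
  \<open>i\<close> have \<open>q \<le> N / (i * y)\<close>, so the lattice pair count applies; the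
  factor 2 is for the two signs.\<close>

lemma moment_bound:
  fixes h :: "real \<Rightarrow> real" and w :: "nat \<Rightarrow> real"
  assumes N: "N > 1" and Y: "finite Y" "\<And>y. y \<in> Y \<Longrightarrow> y > 0"
    and w: "\<And>i. w i \<ge> 0" and h: "\<And>z. h z \<le> (\<Sum>i=1..T. w i * of_bool (real i \<le> z))"
  shows "(\<Sum>a\<in>totatives N. \<Sum>v | v \<in> conv_vecs (int N) (int a) \<and> nat \<bar>lattice_res (int N) (int a) v\<bar> \<in> Y.
      h (quality (int N) (int a) v)) \<le>
    2 * (\<Sum>y\<in>Y. \<Sum>i=1..T. w i * (real (totient N) / (real i * real y) + real (gcd y N) * omega_pow N))"
proof -
  let ?r = "\<lambda>a v. lattice_res (int N) (int a) v"
  let ?z = "\<lambda>a v. quality (int N) (int a) v"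
  define A where "A = {(a, v). a \<in> totatives N \<and> v \<in> conv_vecs (int N) (int a) \<and> nat \<bar>?r a v\<bar> \<in> Y}"
  define C where "C = (\<lambda>i (e, y). {(a, v). a \<in> totatives N \<and> v \<in> conv_vecs (int N) (int a) \<and>
      ?r a v = e * int y \<and> fst v \<le> int (N div (i * y))})"
  have finA: "finite A" unfolding A_def by (rule finite_conv_pairs)
  have finC: "finite (C i ey)" for i ey unfolding C_def by (cases ey) (simp, rule finite_conv_pairs)
  have "(\<Sum>a\<in>totatives N. \<Sum>v | v \<in> conv_vecs (int N) (int a) \<and> nat \<bar>?r a v\<bar> \<in> Y. h (?z a v)) =
      (\<Sum>(a, v)\<in>Sigma (totatives N) (\<lambda>a. {v. v \<in> conv_vecs (int N) (int a) \<and> nat \<bar>?r a v\<bar> \<in> Y}). h (?z a v))"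
    by (subst sum.Sigma) auto
  also have "Sigma (totatives N) (\<lambda>a. {v. v \<in> conv_vecs (int N) (int a) \<and> nat \<bar>?r a v\<bar> \<in> Y}) = A"
    by (auto simp: A_def)
  also have "(\<Sum>(a, v)\<in>A. h (?z a v)) \<le> (\<Sum>(a, v)\<in>A. \<Sum>i=1..T. w i * of_bool (real i \<le> ?z a v))"
    using h by (intro sum_mono) auto
  also have "\<dots> = (\<Sum>i=1..T. w i * (\<Sum>(a, v)\<in>A. of_bool (real i \<le> ?z a v)))"
    unfolding case_prod_beta by (subst sum.swap) (simp add: sum_distrib_left)
  also have "\<dots> = (\<Sum>i=1..T. w i * real (card {(a, v) \<in> A. real i \<le> ?z a v}))"
  proof -
    have "(\<Sum>(a, v)\<in>A. of_bool (real i \<le> ?z a v)) = real (card {(a, v) \<in> A. real i \<le> ?z a v})" for i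
    proof -
      have "(\<Sum>x\<in>A. of_bool (real i \<le> ?z (fst x) (snd x))) = real (card (A \<inter> {x. real i \<le> ?z (fst x) (snd x)}))"
        using finA by (simp add: sum_of_bool_eq)
      also have "A \<inter> {x. real i \<le> ?z (fst x) (snd x)} = {(a, v) \<in> A. real i \<le> ?z a v}" by auto
      finally show ?thesis by (simp add: case_prod_beta)
    qed
    then show ?thesis by simp
  qed
  also have "\<dots> \<le> (\<Sum>i=1..T. w i * (\<Sum>ey\<in>{1, -1} \<times> Y. real (card (C i ey))))"
  proof (intro sum_mono mult_left_mono w)
    fix i assume i: "i \<in> {1..T}"
    have "{(a, v) \<in> A. real i \<le> ?z a v} \<subseteq> (\<Union>ey\<in>{1, -1} \<times> Y. C i ey)"
    proof
      fix x assume x: "x \<in> {(a, v) \<in> A. real i \<le> ?z a v}"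
      obtain a v where xe: "x = (a, v)" by (cases x)
      have a: "a \<in> totatives N" "v \<in> conv_vecs (int N) (int a)" "nat \<bar>?r a v\<bar> \<in> Y" "real i \<le> ?z a v"
        using x xe by (auto simp: A_def)
      define y where "y = nat \<bar>?r a v\<bar>"
      have "fst v \<le> int (N div (i * y))" using quality_ge_iff[OF a(2), of i y] i a(4) by (simp add: y_def)
      moreover have "?r a v = sgn (?r a v) * int y" by (simp add: y_def mult.commute[of "sgn _"] abs_mult_sgn)
      moreover have "sgn (?r a v) \<in> {1, -1}" using conv_vecsD(3)[OF a(2)] by (auto simp: sgn_if)
      ultimately show "x \<in> (\<Union>ey\<in>{1, -1} \<times> Y. C i ey)"
        using a xe by (intro UN_I[of "(sgn (?r a v), y)"]) (auto simp: C_def y_def)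
    qed
    then have "card {(a, v) \<in> A. real i \<le> ?z a v} \<le> card (\<Union>ey\<in>{1, -1} \<times> Y. C i ey)"
      using finC Y by (intro card_mono) auto
    also have "\<dots> \<le> (\<Sum>ey\<in>{1, -1} \<times> Y. card (C i ey))" using Y by (intro card_UN_le) auto
    finally have "real (card {(a, v) \<in> A. real i \<le> ?z a v}) \<le> real (\<Sum>ey\<in>{1, -1} \<times> Y. card (C i ey))"
      by (simp only: of_nat_le_iff)
    then show "real (card {(a, v) \<in> A. real i \<le> ?z a v}) \<le> (\<Sum>ey\<in>{1, -1} \<times> Y. real (card (C i ey)))"
      by (simp only: of_nat_sum)
  qed
  also have "\<dots> \<le> (\<Sum>i=1..T. w i * (\<Sum>ey\<in>{1, -1::int} \<times> Y. real (totient N) / (real i * real (snd ey)) + real (gcd (snd ey) N) * omega_pow N))"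
  proof (intro sum_mono mult_left_mono w)
    fix i ey assume i: "i \<in> {1..T}" and ey: "ey \<in> {1, -1::int} \<times> Y"
    obtain e y where eye: "ey = (e, y)" by (cases ey)
    have y: "y > 0" "e = 1 \<or> e = -1" using ey eye Y by auto
    have "real (card (C i ey)) \<le> real (totient N) * real (N div (i * y)) / real N + real (gcd y N) * omega_pow N"
      unfolding C_def eye prod.case by (rule card_conv_vecs_res_le[OF N y])
    also have "real (totient N) * real (N div (i * y)) / real N \<le> real (totient N) * (real N / real (i * y)) / real N"
      using real_div_bounds(1)[of N "i * y"] by (intro divide_right_mono mult_left_mono) auto
    also have "\<dots> = real (totient N) / (real i * real y)" using N by simp
    finally show "real (card (C i ey)) \<le> real (totient N) / (real i * real (snd ey)) + real (gcd (snd ey) N) * omega_pow N"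
      using eye by simp
  qed
  also have "\<dots> = (\<Sum>i=1..T. w i * (2 * (\<Sum>y\<in>Y. real (totient N) / (real i * real y) + real (gcd y N) * omega_pow N)))"
  proof -
    have *: "(\<Sum>ey\<in>{1, -1::int} \<times> Y. f (snd ey)) = 2 * (\<Sum>y\<in>Y. f y)" for f :: "nat \<Rightarrow> real"
    proof -
      have "(\<Sum>ey\<in>{1, -1::int} \<times> Y. f (snd ey)) = (\<Sum>e\<in>{1, -1::int}. \<Sum>y\<in>Y. f y)"
        by (simp only: sum.cartesian_product case_prod_unfold)
      then show ?thesis by simp
    qed
    show ?thesis
    proof (rule sum.cong[OF refl])
      fix i
      show "w i * (\<Sum>ey\<in>{1, -1::int} \<times> Y. real (totient N) / (real i * real (snd ey)) + real (gcd (snd ey) N) * omega_pow N) =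
          w i * (2 * (\<Sum>y\<in>Y. real (totient N) / (real i * real y) + real (gcd y N) * omega_pow N))"
        using *[of "\<lambda>y. real (totient N) / (real i * real y) + real (gcd y N) * omega_pow N"] by simp
    qed
  qed
  also have "\<dots> = 2 * (\<Sum>y\<in>Y. \<Sum>i=1..T. w i * (real (totient N) / (real i * real y) + real (gcd y N) * omega_pow N))"
    by (subst sum.swap) (simp add: sum_distrib_left mult.left_commute)
  finally show ?thesis .
qed

section \<open>The second moment of the late vectors\<close>

lemma square_sum_ordered:
  fixes x :: "'a \<Rightarrow> real" and k :: "'a \<Rightarrow> int"
  assumes "finite A" "inj_on k A"
  shows "(\<Sum>v\<in>A. x v)\<^sup>2 = (\<Sum>v\<in>A. (x v)\<^sup>2) + 2 * (\<Sum>v\<in>A. x v * (\<Sum>v' | v' \<in> A \<and> k v' > k v. x v'))"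
proof -
  have split: "(\<Sum>v'\<in>A. x v') = x v + (\<Sum>v' | v' \<in> A \<and> k v' > k v. x v') + (\<Sum>v' | v' \<in> A \<and> k v' < k v. x v')"
    if v: "v \<in> A" for v
  proof -
    have "k v' < k v \<or> k v' > k v" if "v' \<in> A" "v' \<noteq> v" for v'
      using that v assms(2) by (metis inj_onD neq_iff)
    then have "A = {v} \<union> {v' \<in> A. k v' > k v} \<union> {v' \<in> A. k v' < k v}" using v by blast
    then have "(\<Sum>v'\<in>A. x v') = (\<Sum>v'\<in>{v} \<union> {v' \<in> A. k v' > k v} \<union> {v' \<in> A. k v' < k v}. x v')"
      by (rule sum.cong) simp
    also have "\<dots> = (\<Sum>v'\<in>{v} \<union> {v' \<in> A. k v' > k v}. x v') + (\<Sum>v' | v' \<in> A \<and> k v' < k v. x v')"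
      using assms(1) by (intro sum.union_disjoint) auto
    also have "(\<Sum>v'\<in>{v} \<union> {v' \<in> A. k v' > k v}. x v') = x v + (\<Sum>v' | v' \<in> A \<and> k v' > k v. x v')"
      using assms(1) by (subst sum.union_disjoint) auto
    finally show ?thesis .
  qed
  have swap: "(\<Sum>v\<in>A. x v * (\<Sum>v' | v' \<in> A \<and> k v' < k v. x v')) = (\<Sum>v\<in>A. x v * (\<Sum>v' | v' \<in> A \<and> k v' > k v. x v'))"
  proof -
    have "(\<Sum>v\<in>A. x v * (\<Sum>v' | v' \<in> A \<and> k v' < k v. x v')) = (\<Sum>v\<in>A. \<Sum>v'\<in>A. if k v' < k v then x v * x v' else 0)"
      using assms(1) by (intro sum.cong refl) (simp add: sum_distrib_left sum.inter_filter[symmetric])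
    also have "\<dots> = (\<Sum>v'\<in>A. \<Sum>v\<in>A. if k v' < k v then x v * x v' else 0)" by (rule sum.swap)
    also have "\<dots> = (\<Sum>v\<in>A. x v * (\<Sum>v' | v' \<in> A \<and> k v' > k v. x v'))"
      using assms(1) by (intro sum.cong refl) (simp add: sum_distrib_left sum.inter_filter[symmetric] mult.commute)
    finally show ?thesis .
  qed
  have "(\<Sum>v\<in>A. x v)\<^sup>2 = (\<Sum>v\<in>A. x v * (\<Sum>v'\<in>A. x v'))" by (simp add: power2_eq_square sum_distrib_right)
  also have "\<dots> = (\<Sum>v\<in>A. (x v)\<^sup>2 + x v * (\<Sum>v' | v' \<in> A \<and> k v' > k v. x v') + x v * (\<Sum>v' | v' \<in> A \<and> k v' < k v. x v'))"
    by (rule sum.cong[OF refl]) (subst split, auto simp: power2_eq_square distrib_left)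
  also have "\<dots> = (\<Sum>v\<in>A. (x v)\<^sup>2) + 2 * (\<Sum>v\<in>A. x v * (\<Sum>v' | v' \<in> A \<and> k v' > k v. x v'))"
    unfolding sum.distrib swap by simp
  finally show ?thesis .
qed

lemma int_totatives:
  assumes "N > 1"
  shows "int ` totatives N = units_mod (int N)"
proof (intro equalityI subsetI)
  fix s assume "s \<in> int ` totatives N"
  then obtain a where "s = int a" "a \<in> totatives N" by auto
  then show "s \<in> units_mod (int N)" using assms totatives_less[of a N]
    by (auto simp: units_mod_def in_totatives_iff)
next
  fix s assume s: "s \<in> units_mod (int N)"
  then have s': "s = int (nat s)" "coprime (int (nat s)) (int N)" "nat s \<le> N" by (auto simp: units_mod_def)
  have c: "coprime (nat s) N" using s'(2) coprime_int_iff by blast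
  then have "nat s > 0" using assms by (intro Nat.gr0I) auto
  then have "nat s \<in> totatives N" using c s' by (simp add: in_totatives_iff)
  then show "s \<in> int ` totatives N" using s'(1) by blast
qed

text \<open>Residues shrink as denominators grow, so this set contains all successors of its
  members. Inner sums of the ordered square are therefore full tails.\<close>

definition late_vecs :: "nat \<Rightarrow> nat \<Rightarrow> nat \<Rightarrow> (int \<times> int) set" where
  "late_vecs N R a = {v. v \<in> conv_vecs (int N) (int a) \<and> nat \<bar>lattice_res (int N) (int a) v\<bar> \<in> {1..R}}"

lemma finite_late_vecs [simp, intro]: "finite (late_vecs N R a)"
  by (rule finite_subset[of _ "conv_vecs (int N) (int a)"]) (auto simp: late_vecs_def)

text \<open>The off-diagonal terms of positive residue \<open>y\<close>, with each tail replaced by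
  its approximation from \<open>tail_sum_approx\<close>.\<close>

definition cross_sum :: "(real \<Rightarrow> real) \<Rightarrow> int \<Rightarrow> int \<Rightarrow> real" where
  "cross_sum g N y = (\<Sum>(a, q, p)\<in>conv_triples N y.
     g (real_of_int N / real_of_int (q * y)) * conv_sum g y (- tail_res N a q p y))"

text \<open>The square is expanded with the vectors ordered by denominator. A factor 2 comes from
  the ordering and a factor 2 from the sign of the residue, whence 4 on the cross sums; the tail
  error 4 per vector raises this to 16 on the first moment.\<close>

lemma second_moment:
  fixes g :: "real \<Rightarrow> real"
  assumes N: "N > 1" and g: "\<And>x y. \<bar>g x - g y\<bar> \<le> \<bar>x - y\<bar>" "\<And>x. x \<le> 2 \<Longrightarrow> g x = 0" "\<And>z. 0 \<le> g z"
  shows "(\<Sum>a\<in>totatives N. (\<Sum>v\<in>late_vecs N R a. signed_term g (int N) (int a) v)\<^sup>2) \<le>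
     (\<Sum>a\<in>totatives N. \<Sum>v\<in>late_vecs N R a. (g (quality (int N) (int a) v))\<^sup>2)
   + 16 * (\<Sum>a\<in>totatives N. \<Sum>v\<in>late_vecs N R a. g (quality (int N) (int a) v))
   + 4 * (\<Sum>y=1..R. \<bar>cross_sum g (int N) (int y)\<bar>)"
proof -
  let ?r = "\<lambda>a v. lattice_res (int N) (int a) v"
  let ?z = "\<lambda>a v. quality (int N) (int a) v"
  let ?st = "\<lambda>a v. signed_term g (int N) (int a) v"
  define tail where "tail = (\<lambda>(a::nat) (v::int \<times> int). \<Sum>v' | v' \<in> conv_vecs (int N) (int a) \<and> fst v' > fst v. ?st a v')"
  have lt: "a < N" if "a \<in> totatives N" for a using that N totatives_less by blast
  have sq: "(\<Sum>v\<in>late_vecs N R a. ?st a v)\<^sup>2 =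
      (\<Sum>v\<in>late_vecs N R a. (g (?z a v))\<^sup>2) + 2 * (\<Sum>v\<in>late_vecs N R a. ?st a v * tail a v)" for a
  proof -
    have inj: "inj_on fst (late_vecs N R a)"
      by (rule inj_on_subset[OF conv_vecs_inj_fst]) (auto simp: late_vecs_def)
    have e1: "(?st a v)\<^sup>2 = (g (?z a v))\<^sup>2" if "v \<in> late_vecs N R a" for v
    proof -
      have "?r a v \<noteq> 0" using that conv_vecsD(3) by (fastforce simp: late_vecs_def)
      then have "sgn (?r a v) = 1 \<or> sgn (?r a v) = -1" by (auto simp: sgn_if)
      then show ?thesis by (auto simp: signed_term_def)
    qed
    have e2: "(\<Sum>v' | v' \<in> late_vecs N R a \<and> fst v' > fst v. ?st a v') = tail a v" if v: "v \<in> late_vecs N R a" for v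
      unfolding tail_def
    proof (rule sum.cong)
      show "{v' \<in> late_vecs N R a. fst v < fst v'} = {v' \<in> conv_vecs (int N) (int a). fst v < fst v'}"
      proof -
        have "v' \<in> late_vecs N R a" if v': "v' \<in> conv_vecs (int N) (int a)" "fst v < fst v'" for v'
        proof -
          have "\<bar>?r a v'\<bar> < \<bar>?r a v\<bar>" using v v' by (intro conv_vecs_res_decreasing) (auto simp: late_vecs_def)
          moreover have "1 \<le> \<bar>?r a v'\<bar>" using conv_vecsD(3)[OF v'(1)] .
          ultimately show ?thesis using v v' by (auto simp: late_vecs_def)
        qed
        then show ?thesis by (auto simp: late_vecs_def)
      qed
    qed simp
    show ?thesis unfolding square_sum_ordered[OF finite_late_vecs inj] using e1 e2 by simp
  qed
  define X where "X = (\<lambda>(a, v). ?st a v * tail a v)"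
  define Pos where "Pos = {(a, v). a \<in> totatives N \<and> v \<in> conv_vecs (int N) (int a) \<and> v \<in> late_vecs N R a \<and> ?r a v > 0}"
  define Neg where "Neg = {(a, v). a \<in> totatives N \<and> v \<in> conv_vecs (int N) (int a) \<and> v \<in> late_vecs N R a \<and> ?r a v < 0}"
  have fin: "finite Pos" "finite Neg" unfolding Pos_def Neg_def by (rule finite_conv_pairs)+
  have all: "(\<Sum>a\<in>totatives N. \<Sum>v\<in>late_vecs N R a. f a v) = (\<Sum>(a, v)\<in>Pos. f a v) + (\<Sum>(a, v)\<in>Neg. f a v)"
    for f :: "nat \<Rightarrow> int \<times> int \<Rightarrow> real"
  proof -
    have "(\<Sum>a\<in>totatives N. \<Sum>v\<in>late_vecs N R a. f a v) = (\<Sum>(a, v)\<in>Sigma (totatives N) (late_vecs N R). f a v)"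
      by (subst sum.Sigma) auto
    also have "Sigma (totatives N) (late_vecs N R) = Pos \<union> Neg"
      by (auto simp: Pos_def Neg_def late_vecs_def)
    also have "(\<Sum>(a, v)\<in>Pos \<union> Neg. f a v) = (\<Sum>(a, v)\<in>Pos. f a v) + (\<Sum>(a, v)\<in>Neg. f a v)"
      using fin by (intro sum.union_disjoint) (auto simp: Pos_def Neg_def)
    finally show ?thesis .
  qed
  \<comment> \<open>Reflection negates both the term of a vector and its tail, so their product is
    unchanged.\<close>
  have negpos: "(\<Sum>x\<in>Neg. X x) = (\<Sum>x\<in>Pos. X x)"
  proof (rule sum.reindex_bij_witness[where i = "\<lambda>(a, v). (N - a, flip_vec v)" and j = "\<lambda>(a, v). (N - a, flip_vec v)"])
    have inv: "(N - (N - a), flip_vec (flip_vec v)) = (a, v)" if "a \<in> totatives N" for a v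
      using lt[OF that] by (simp add: flip_vec(2))
    have im: "int (N - a) = int N - int a" if "a \<in> totatives N" for a using lt[OF that] by (simp add: of_nat_diff)
    have late: "flip_vec v \<in> late_vecs N R (N - a)" if "a \<in> totatives N" "v \<in> late_vecs N R a" for a v
      using that flip_vec(4)[of v "int N" "int a"] flip_vec(3)[of "int N" "int a" v] im[OF that(1)]
      by (simp add: late_vecs_def)
    show "(\<lambda>(a, v). (N - a, flip_vec v)) ((\<lambda>(a, v). (N - a, flip_vec v)) x) = x" if "x \<in> Neg" for x
      using that inv by (auto simp: Neg_def)
    show "(\<lambda>(a, v). (N - a, flip_vec v)) ((\<lambda>(a, v). (N - a, flip_vec v)) x) = x" if "x \<in> Pos" for x
      using that inv by (auto simp: Pos_def)
    have flip: "flip_vec v \<in> conv_vecs (int N) (int (N - a))" "?r (N - a) (flip_vec v) = - ?r a v"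
      if "a \<in> totatives N" "v \<in> conv_vecs (int N) (int a)" for a v
      unfolding im[OF that(1)] using flip_vec(3,4) that(2) by auto
    show "(\<lambda>(a, v). (N - a, flip_vec v)) x \<in> Pos" if x: "x \<in> Neg" for x
    proof -
      obtain a v where xe: "x = (a, v)" by (cases x)
      have a: "a \<in> totatives N" "v \<in> conv_vecs (int N) (int a)" "v \<in> late_vecs N R a" "?r a v < 0"
        using x xe by (auto simp: Neg_def)
      show ?thesis using a late[OF a(1,3)] flip[OF a(1,2)] uminus_in_totatives[OF a(1) N]
        by (simp add: xe Pos_def)
    qed
    show "(\<lambda>(a, v). (N - a, flip_vec v)) x \<in> Neg" if x: "x \<in> Pos" for x
    proof -
      obtain a v where xe: "x = (a, v)" by (cases x)
      have a: "a \<in> totatives N" "v \<in> conv_vecs (int N) (int a)" "v \<in> late_vecs N R a" "?r a v > 0"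
        using x xe by (auto simp: Pos_def)
      show ?thesis using a late[OF a(1,3)] flip[OF a(1,2)] uminus_in_totatives[OF a(1) N]
        by (simp add: xe Neg_def)
    qed
    show "X ((\<lambda>(a, v). (N - a, flip_vec v)) x) = X x" if x: "x \<in> Neg" for x
    proof -
      obtain a v where xe: "x = (a, v)" by (cases x)
      have a: "a \<in> totatives N" using x xe by (simp add: Neg_def)
      have "tail (N - a) (flip_vec v) = - tail a v"
      proof -
        have "tail (N - a) (flip_vec v) = (\<Sum>v' \<in> {v' \<in> conv_vecs (int N) (int N - int a). fst v' > fst v}. signed_term g (int N) (int N - int a) v')"
          by (simp add: tail_def im[OF a] flip_vec)
        also have "\<dots> = (\<Sum>v' \<in> {v' \<in> conv_vecs (int N) (int a). fst v' > fst v}. signed_term g (int N) (int N - int a) (flip_vec v'))"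
          by (rule sum.reindex_bij_betw[OF bij_betw_flip_vec, symmetric])
        finally show ?thesis by (simp add: tail_def flip_vec sum_negf)
      qed
      then show ?thesis using xe by (simp add: X_def im[OF a] flip_vec)
    qed
  qed
  have pos: "\<bar>\<Sum>x\<in>Pos. X x\<bar> \<le> (\<Sum>y=1..R. \<bar>cross_sum g (int N) (int y)\<bar>) + 4 * (\<Sum>(a, v)\<in>Pos. g (?z a v))"
  proof -
    define c where "c = (\<lambda>(a, v). g (?z a v) * conv_sum g (?r a v) (- tail_res (int N) (int a) (fst v) (snd v) (?r a v)))"
    have err: "\<bar>X x - c x\<bar> \<le> 4 * (\<lambda>(a, v). g (?z a v)) x" if x: "x \<in> Pos" for x
    proof -
      obtain a v where xe: "x = (a, v)" by (cases x)
      have v: "v \<in> conv_vecs (int N) (int a)" and r: "?r a v > 0" using x xe by (auto simp: Pos_def)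
      obtain q p where vq: "v = (q, p)" by (cases v)
      have rq: "?r a v = int a * q - p * int N" by (simp add: vq lattice_res_def)
      note B = bezout_pair[of q p "int a" "int N" "?r a v"]
      have cop: "coprime q p" using conv_vecsD(2)[OF v] vq by simp
      have "\<bar>tail a v - conv_sum g (?r a v) (- tail_res (int N) (int a) q p (?r a v))\<bar> \<le> 4"
        unfolding tail_def using tail_sum_approx[OF g(1,2) v[unfolded vq] rq r B(1)[OF cop rq[symmetric] r], of "tail_res (int N) (int a) q p (?r a v)"]
        by (simp add: vq tail_res_def)
      then have "g (?z a v) * \<bar>tail a v - conv_sum g (?r a v) (- tail_res (int N) (int a) q p (?r a v))\<bar> \<le> g (?z a v) * 4"
        using g(3) by (intro mult_left_mono)
      moreover have "X x - c x = g (?z a v) * (tail a v - conv_sum g (?r a v) (- tail_res (int N) (int a) q p (?r a v)))"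
        using r by (simp add: xe X_def c_def signed_term_def vq right_diff_distrib)
      ultimately show ?thesis using g(3) by (simp add: abs_mult xe)
    qed
    have "(\<Sum>x\<in>Pos. c x) = (\<Sum>y=1..R. cross_sum g (int N) (int y))"
    proof -
      define D where "D = (\<lambda>y. {(a, v). a \<in> totatives N \<and> v \<in> conv_vecs (int N) (int a) \<and> ?r a v = int y})"
      have "Pos = (\<Union>y\<in>{1..R}. D y)"
      proof (intro equalityI subsetI)
        fix x assume "x \<in> Pos"
        then show "x \<in> (\<Union>y\<in>{1..R}. D y)"
          by (auto simp: Pos_def D_def late_vecs_def intro!: bexI[of _ "nat \<bar>?r (fst x) (snd x)\<bar>"])
      qed (auto simp: Pos_def D_def late_vecs_def)
      then have "(\<Sum>x\<in>Pos. c x) = (\<Sum>x\<in>(\<Union>y\<in>{1..R}. D y). c x)" by simp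
      also have "\<dots> = (\<Sum>y=1..R. \<Sum>x\<in>D y. c x)"
      proof (rule sum.UNION_disjoint)
        show "\<forall>y\<in>{1..R}. finite (D y)" unfolding D_def by (intro ballI finite_conv_pairs)
      qed (auto simp: D_def)
      also have "\<dots> = (\<Sum>y=1..R. cross_sum g (int N) (int y))"
      proof (intro sum.cong refl)
        fix y assume y: "y \<in> {1..R}"
        show "(\<Sum>x\<in>D y. c x) = cross_sum g (int N) (int y)"
          unfolding cross_sum_def
        proof (rule sum.reindex_bij_witness[where i = "\<lambda>(a, q, p). (nat a, (q, p))" and j = "\<lambda>(a, (q, p)). (int a, q, p)"])
          fix x assume x: "x \<in> D y"
          obtain a q p where xe: "x = (a, (q, p))" by (cases x) auto
          have a: "a \<in> totatives N" and v: "(q, p) \<in> conv_vecs (int N) (int a)" and r: "?r a (q, p) = int y"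
            using x xe by (auto simp: D_def)
          have "int a \<in> units_mod (int N)" using a int_totatives[OF N] by blast
          moreover have "2 * (q * int y) < int N" "q > 0" "coprime q p" using conv_vecsD[OF v] r by auto
          ultimately show "(\<lambda>(a, (q, p)). (int a, q, p)) x \<in> conv_triples (int N) (int y)"
            using r by (simp add: xe conv_triples_def lattice_res_def)
          show "(\<lambda>(a, q, p). (nat a, (q, p))) ((\<lambda>(a, (q, p)). (int a, q, p)) x) = x" by (simp add: xe)
          show "(case (\<lambda>(a, (q, p)). (int a, q, p)) x of (a, q, p) \<Rightarrow> g (real_of_int (int N) / real_of_int (q * int y)) * conv_sum g (int y) (- tail_res (int N) a q p (int y))) = c x"
            using r by (simp add: xe c_def quality_def)
        next
          fix t assume t: "t \<in> conv_triples (int N) (int y)"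
          obtain a q p where te: "t = (a, q, p)" by (cases t) auto
          have T: "a \<in> units_mod (int N)" "q > 0" "coprime q p" "a * q - p * int N = int y" "2 * (q * int y) < int N"
            using t te by (auto simp: conv_triples_def)
          obtain b where b: "b \<in> totatives N" "a = int b" using T(1) int_totatives[OF N] by blast
          show "(\<lambda>(a, q, p). (nat a, (q, p))) t \<in> D y"
            using T b y by (simp add: te D_def conv_vecs_def lattice_res_def)
          show "(\<lambda>(a, (q, p)). (int a, q, p)) ((\<lambda>(a, q, p). (nat a, (q, p))) t) = t"
            using b by (simp add: te)
        qed
      qed
      finally show ?thesis .
    qed
    moreover have "\<bar>(\<Sum>x\<in>Pos. X x) - (\<Sum>x\<in>Pos. c x)\<bar> \<le> 4 * (\<Sum>(a, v)\<in>Pos. g (?z a v))"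
    proof -
      have "\<bar>(\<Sum>x\<in>Pos. X x) - (\<Sum>x\<in>Pos. c x)\<bar> \<le> (\<Sum>x\<in>Pos. \<bar>X x - c x\<bar>)"
        unfolding sum_subtractf[symmetric] by (rule sum_abs)
      also have "\<dots> \<le> (\<Sum>x\<in>Pos. 4 * (\<lambda>(a, v). g (?z a v)) x)" using err by (intro sum_mono)
      finally show ?thesis by (simp add: sum_distrib_left)
    qed
    moreover have "\<bar>\<Sum>y=1..R. cross_sum g (int N) (int y)\<bar> \<le> (\<Sum>y=1..R. \<bar>cross_sum g (int N) (int y)\<bar>)"
      by (rule sum_abs)
    ultimately show ?thesis by linarith
  qed
  have Xall: "(\<Sum>a\<in>totatives N. \<Sum>v\<in>late_vecs N R a. ?st a v * tail a v) = 2 * (\<Sum>x\<in>Pos. X x)"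
    unfolding all using negpos by (simp add: X_def)
  have "(\<Sum>(a, v)\<in>Pos. g (?z a v)) \<le> (\<Sum>a\<in>totatives N. \<Sum>v\<in>late_vecs N R a. g (?z a v))"
    unfolding all using g(3) by (simp add: sum_nonneg case_prod_beta)
  then have bnd: "(\<Sum>x\<in>Pos. X x) \<le> (\<Sum>y=1..R. \<bar>cross_sum g (int N) (int y)\<bar>)
      + 4 * (\<Sum>a\<in>totatives N. \<Sum>v\<in>late_vecs N R a. g (?z a v))"
    using pos by linarith
  have "(\<Sum>a\<in>totatives N. (\<Sum>v\<in>late_vecs N R a. ?st a v)\<^sup>2) =
     (\<Sum>a\<in>totatives N. \<Sum>v\<in>late_vecs N R a. (g (?z a v))\<^sup>2) + 2 * (2 * (\<Sum>x\<in>Pos. X x))"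
    unfolding sq Xall[symmetric] by (simp add: sum.distrib sum_distrib_left)
  then show ?thesis using bnd by linarith
qed

section \<open>The total number of convergent vectors\<close>

lemma card_units_solving_le:
  assumes N: "N > 0"
  shows "card {a \<in> totatives N. [a * q = y] (mod N)} \<le> gcd q N"
    "{a \<in> totatives N. [a * q = y] (mod N)} \<noteq> {} \<Longrightarrow> gcd q N dvd y"
proof -
  define A where "A = {a \<in> totatives N. [a * q = y] (mod N)}"
  define d where "d = gcd q N"
  define M where "M = N div d"
  define x where "x = q div d"
  have d: "d > 0" "d dvd N" "d dvd q" using N by (auto simp: d_def)
  have NM: "N = d * M" "q = d * x" using d by (simp_all add: M_def x_def)
  have M: "M > 0" using N NM by (auto intro: Nat.gr0I)
  have "coprime x M" unfolding x_def M_def d_def using N by (intro div_gcd_coprime) auto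
  have cong: "[a = a'] (mod M)" if "a \<in> A" "a' \<in> A" for a a'
  proof -
    have "[a * q = a' * q] (mod N)" using that by (auto simp: A_def) (metis cong_sym cong_trans)
    then have "[d * (a * x) = d * (a' * x)] (mod (d * M))" by (simp add: NM mult_ac)
    then have "[a * x = a' * x] (mod M)" using d(1) by (simp add: Cong.cong_def mod_mult_mult1)
    then show ?thesis using \<open>coprime x M\<close> by (simp add: cong_mult_rcancel_nat)
  qed
  have "inj_on (\<lambda>a. (a - 1) div M) A"
  proof (rule inj_onI)
    fix a a' assume a: "a \<in> A" "a' \<in> A" "(a - 1) div M = (a' - 1) div M"
    have p: "a \<ge> 1" "a' \<ge> 1" using a by (auto simp: A_def in_totatives_iff)
    have "[(a - 1) + 1 = (a' - 1) + 1] (mod M)" using cong[OF a(1,2)] p by simp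
    then have "[a - 1 = a' - 1] (mod M)" by (simp only: cong_add_rcancel_nat)
    then have "(a - 1) mod M = (a' - 1) mod M" by (simp only: Cong.cong_def)
    then have "a - 1 = a' - 1" using a(3) by (metis div_mult_mod_eq)
    then show "a = a'" using p by simp
  qed
  moreover have "(\<lambda>a. (a - 1) div M) ` A \<subseteq> {..<d}"
  proof
    fix z assume "z \<in> (\<lambda>a. (a - 1) div M) ` A"
    then obtain a where a: "a \<in> A" "z = (a - 1) div M" by auto
    have "a - 1 < d * M" using a N by (auto simp: A_def in_totatives_iff NM(1)[symmetric])
    then show "z \<in> {..<d}" using a by (simp add: less_mult_imp_div_less)
  qed
  ultimately have "card A \<le> card {..<d}" by (intro card_inj_on_le) auto
  then show "card {a \<in> totatives N. [a * q = y] (mod N)} \<le> gcd q N" by (simp add: A_def d_def)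
  assume "{a \<in> totatives N. [a * q = y] (mod N)} \<noteq> {}"
  then obtain a where "[a * q = y] (mod N)" by auto
  then have "gcd (a * q) N = gcd y N" by (rule cong_gcd_eq)
  moreover have "gcd q N dvd gcd (a * q) N" by (simp add: dvd_mult)
  ultimately show "gcd q N dvd y" by (metis dvd_trans gcd_dvd1)
qed

text \<open>Only multiples \<open>r\<close> of \<open>d = gcd q N\<close> are attained, each for at
  most \<open>d\<close> units, and \<open>(m div d) * d \<le> m\<close>: the gcd is paid for
  exactly.\<close>

lemma card_lattice_pairs_fixed_le:
  assumes N: "N > 0"
  shows "card {ar \<in> totatives N \<times> {1..m}. [fst ar * q = snd ar] (mod N)} \<le> m"
proof -
  define d where "d = gcd q N"
  have d: "d > 0" using N by (simp add: d_def)
  define Q where "Q = {r \<in> {1..m}. d dvd r}"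
  have "{ar \<in> totatives N \<times> {1..m}. [fst ar * q = snd ar] (mod N)} \<subseteq>
      (\<Union>r\<in>Q. {a \<in> totatives N. [a * q = r] (mod N)} \<times> {r})"
    using card_units_solving_le(2)[OF N, of q] by (fastforce simp: Q_def d_def)
  then have "card {ar \<in> totatives N \<times> {1..m}. [fst ar * q = snd ar] (mod N)} \<le>
      card (\<Union>r\<in>Q. {a \<in> totatives N. [a * q = r] (mod N)} \<times> {r})"
    by (intro card_mono) (auto simp: Q_def)
  also have "\<dots> \<le> (\<Sum>r\<in>Q. card ({a \<in> totatives N. [a * q = r] (mod N)} \<times> {r}))"
    by (intro card_UN_le) (auto simp: Q_def)
  also have "\<dots> \<le> (\<Sum>r\<in>Q. d)"
    using card_units_solving_le(1)[OF N, of q] by (intro sum_mono) (simp add: card_cartesian_product d_def)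
  also have "\<dots> = (m div d) * d" unfolding Q_def using card_multiples[OF d, of m] by simp
  also have "\<dots> \<le> m" by simp
  finally show ?thesis .
qed

text \<open>For a given denominator \<open>q\<close> and sign, residues go up to
  \<open>N div (2 * q)\<close>, so at most that many pairs occur; two signs give
  \<open>N / q\<close>. In \<open>cross_sum_le\<close> it is applied with a residue \<open>y\<close>
  as the modulus.\<close>

lemma sum_card_conv_vecs_le:
  assumes N: "N > 1"
  shows "(\<Sum>a\<in>totatives N. real (card (conv_vecs (int N) (int a)))) \<le> real N * (\<Sum>q=1..N. 1 / real q)"
proof -
  let ?r = "\<lambda>a v. lattice_res (int N) (int a) v"
  define A where "A = Sigma (totatives N) (\<lambda>a. conv_vecs (int N) (int a))"
  define E where "E = (\<lambda>(q::nat, e::int). {(a, v). a \<in> totatives N \<and> v \<in> conv_vecs (int N) (int a) \<and> (fst v = int q \<and> sgn (?r a v) = e)})"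
  have lt: "a < N" if "a \<in> totatives N" for a using that N totatives_less by blast
  have E: "card (E (q, e)) \<le> N div (2 * q)" if e: "e = 1 \<or> e = -1" and q: "q \<ge> 1" for q e
  proof -
    define m where "m = N div (2 * q)"
    define B where "B = {ar \<in> totatives N \<times> {1..m}. [fst ar * q = snd ar] (mod N)}"
    define f where "f = (\<lambda>(a, v). (if e = 1 then a else N - a, nat \<bar>?r a v\<bar>))"
    have "inj_on f (E (q, e))"
    proof (rule inj_onI)
      fix x x' assume xx: "x \<in> E (q, e)" "x' \<in> E (q, e)" "f x = f x'"
      obtain a v where x: "x = (a, v)" by (cases x)
      obtain a' v' where x': "x' = (a', v')" by (cases x')
      have aa: "a \<in> totatives N" "a' \<in> totatives N" and f: "fst v = fst v'"
        and s: "sgn (?r a v) = e" "sgn (?r a' v') = e" using xx x x' by (auto simp: E_def)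
      have a: "a = a'" using xx(3) x x' lt[OF aa(1)] lt[OF aa(2)] by (auto simp: f_def split: if_splits)
      have "\<bar>?r a v\<bar> = \<bar>?r a' v'\<bar>" using xx(3) x x' by (simp add: f_def eq_nat_nat_iff)
      then have "?r a v = ?r a' v'" using s by (metis mult_sgn_abs)
      then have "v = v'" using f a N by (intro lattice_res_eqD[of v v' "int N" "int a"]) auto
      then show "x = x'" using a x x' by simp
    qed
    moreover have "f ` E (q, e) \<subseteq> B"
    proof
      fix z assume "z \<in> f ` E (q, e)"
      then obtain a v where z: "z = f (a, v)" and a: "a \<in> totatives N" and v: "v \<in> conv_vecs (int N) (int a)"
        and fv: "fst v = int q" and s: "sgn (?r a v) = e"
        by (auto simp: E_def)
      define y where "y = nat \<bar>?r a v\<bar>"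
      have ry: "?r a v = e * int y" using sgn_mult_abs[of "?r a v"] s by (simp add: y_def)
      have y1: "y \<ge> 1" using conv_vecsD(3)[OF v] by (simp add: y_def)
      have "2 * (int q * int y) < int N" using conv_vecsD(4)[OF v] fv by (simp add: y_def)
      then have "y * (2 * q) < N" by (simp add: mult_ac flip: of_nat_mult)
      then have ym: "y \<le> m" using q by (simp add: m_def less_eq_div_iff_mult_less_eq)
      show "z \<in> B" using z conv_vecs_congruence[OF N a e ry fv] y1 ym
        by (auto simp: f_def B_def y_def[symmetric])
    qed
    moreover have "finite B" by (rule finite_subset[of _ "totatives N \<times> {1..m}"]) (auto simp: B_def)
    ultimately have "card (E (q, e)) \<le> card B" by (rule card_inj_on_le)
    also have "\<dots> \<le> m" unfolding B_def using N by (intro card_lattice_pairs_fixed_le) auto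
    finally show ?thesis by (simp add: m_def)
  qed
  have "A \<subseteq> (\<Union>qe\<in>{1..N} \<times> {1, -1}. E qe)"
  proof
    fix x assume "x \<in> A"
    then obtain a v where x: "x = (a, v)" "a \<in> totatives N" "v \<in> conv_vecs (int N) (int a)" by (auto simp: A_def)
    have "nat (fst v) \<in> {1..N}" "int (nat (fst v)) = fst v" using conv_vecsD(1,5)[OF x(3)] by auto
    moreover have "sgn (?r a v) \<in> {1, -1}" using conv_vecsD(3)[OF x(3)] by (auto simp: sgn_if)
    ultimately show "x \<in> (\<Union>qe\<in>{1..N} \<times> {1, -1}. E qe)"
      using x by (intro UN_I[of "(nat (fst v), sgn (?r a v))"]) (auto simp: E_def)
  qed
  moreover have "finite (E qe)" for qe unfolding E_def by (cases qe) (simp, rule finite_conv_pairs)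
  ultimately have "card A \<le> card (\<Union>qe\<in>{1..N} \<times> {1, -1}. E qe)" by (intro card_mono) auto
  also have "\<dots> \<le> (\<Sum>qe\<in>{1..N} \<times> {1, -1}. card (E qe))" by (intro card_UN_le) auto
  also have "\<dots> \<le> (\<Sum>qe\<in>{1..N} \<times> {1, -1::int}. N div (2 * fst qe))"
  proof (intro sum_mono)
    fix qe assume "qe \<in> {1..N} \<times> {1, -1::int}"
    then show "card (E qe) \<le> N div (2 * fst qe)" using E[of "snd qe" "fst qe"] by auto
  qed
  finally have "real (card A) \<le> (\<Sum>qe\<in>{1..N} \<times> {1, -1::int}. real (N div (2 * fst qe)))"
    by (simp only: of_nat_sum[symmetric] of_nat_le_iff)
  also have "\<dots> \<le> (\<Sum>qe\<in>{1..N} \<times> {1, -1::int}. real N / (2 * real (fst qe)))"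
    using real_div_bounds(1)[of N] by (intro sum_mono) (metis of_nat_mult of_nat_numeral)
  also have "\<dots> = (\<Sum>q=1..N. \<Sum>e\<in>{1, -1::int}. real N / (2 * real q))"
    by (simp only: sum.cartesian_product case_prod_unfold)
  also have "\<dots> = real N * (\<Sum>q=1..N. 1 / real q)"
    by (simp add: sum_distrib_left)
  also have "real (card A) = (\<Sum>a\<in>totatives N. real (card (conv_vecs (int N) (int a))))"
    unfolding A_def by (subst card_SigmaI) auto
  finally show ?thesis .
qed

section \<open>Harmonic sums and the capped weight\<close>

lemma inverse_le_ln_diff:
  assumes "y \<ge> 2"
  shows "1 / real y \<le> ln (real y) - ln (real (y - 1))"
proof -
  have "ln (1 - 1 / real y) \<le> - (1 / real y)"
    using ln_le_minus_one[of "1 - 1 / real y"] assms by simp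
  moreover have "1 - 1 / real y = real (y - 1) / real y" using assms by (simp add: field_simps of_nat_diff)
  moreover have "ln (real (y - 1) / real y) = ln (real (y - 1)) - ln (real y)"
    using assms by (simp add: ln_div)
  ultimately show ?thesis by simp
qed

lemma sum_inverse_interval_le:
  assumes "m \<ge> 1" "m \<le> n"
  shows "(\<Sum>y=m+1..n. 1 / real y) \<le> ln (real n / real m)"
proof -
  have "(\<Sum>y=m+1..n. 1 / real y) \<le> ln (real n) - ln (real m)"
    using assms(2)
  proof (induction n rule: dec_induct)
    case (step n)
    have "(\<Sum>y=m+1..Suc n. 1 / real y) = (\<Sum>y=m+1..n. 1 / real y) + 1 / real (Suc n)"
      using step by (simp add: sum.cl_ivl_Suc)
    then show ?case using step.IH inverse_le_ln_diff[of "Suc n"] step assms by simp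
  qed simp
  then show ?thesis using assms by (simp add: ln_div)
qed

lemma sum_inverse_le:
  assumes "n \<ge> 1"
  shows "(\<Sum>y=1..n. 1 / real y) \<le> 1 + ln (real n)"
proof -
  have "(\<Sum>y=1..n. 1 / real y) = 1 + (\<Sum>y=1+1..n. 1 / real y)"
    using assms by (subst sum.atLeast_Suc_atMost) auto
  then show ?thesis using sum_inverse_interval_le[of 1 n] assms by simp
qed

text \<open>Agrees with the weight of \<open>dedekind_sum_conv_sum\<close> on qualities up to
  \<open>T\<close>, but is bounded. Subtracting 2 after taking the minimum keeps it monotone,
  1-Lipschitz and zero up to 2, as the tail and cross sum bounds require.\<close>

definition capped :: "nat \<Rightarrow> real \<Rightarrow> real" where
  "capped T z = max 0 (min z (real T) - 2)"

lemma capped: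
  "0 \<le> capped T z" "capped T z \<le> real T" "z \<le> 2 \<Longrightarrow> capped T z = 0" "mono (capped T)"
  "\<bar>capped T x - capped T y\<bar> \<le> \<bar>x - y\<bar>"
  by (auto simp: capped_def mono_def)

lemma capped_layer_cake:
  "capped T z \<le> (\<Sum>i=1..T. 1 * of_bool (real i \<le> z))"
  "(capped T z)\<^sup>2 \<le> (\<Sum>i=1..T. 2 * real i * of_bool (real i \<le> z))"
proof -
  \<comment> \<open>The number of steps active at \<open>z\<close>; it dominates the weight, and its
    square is at most \<open>k * (k + 1)\<close>, the sum of the step heights
    \<open>2 * i\<close>.\<close>
  define k where "k = min T (nat \<lfloor>z\<rfloor>)"
  have sub: "{1..k} \<subseteq> {1..T}" by (auto simp: k_def)
  have le: "real i \<le> z" if "i \<in> {1..k}" for i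
  proof -
    have "i \<le> nat \<lfloor>z\<rfloor>" "i \<ge> 1" using that by (auto simp: k_def)
    then have "int i \<le> \<lfloor>z\<rfloor>" by linarith
    then show ?thesis by (simp add: le_floor_iff)
  qed
  have ck: "capped T z \<le> real k"
  proof (cases "z \<le> 2")
    case False
    then have "z < real (nat \<lfloor>z\<rfloor>) + 1" by linarith
    then have "min z (real T) - 2 \<le> real k" by (auto simp: k_def min_def)
    then show ?thesis by (simp add: capped_def)
  qed (simp add: capped(3))
  have ge: "(\<Sum>i=1..k. w i) \<le> (\<Sum>i=1..T. w i * of_bool (real i \<le> z))" if "\<And>i. w i \<ge> 0" for w :: "nat \<Rightarrow> real"
  proof -
    have "(\<Sum>i=1..k. w i) = (\<Sum>i=1..k. w i * of_bool (real i \<le> z))" using le by (intro sum.cong) auto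
    also have "\<dots> \<le> (\<Sum>i=1..T. w i * of_bool (real i \<le> z))" using sub that by (intro sum_mono2) auto
    finally show ?thesis .
  qed
  show "capped T z \<le> (\<Sum>i=1..T. 1 * of_bool (real i \<le> z))" using ge[of "\<lambda>_. 1"] ck by simp
  have "(capped T z)\<^sup>2 \<le> (real k)\<^sup>2" using ck capped(1) by (intro power_mono)
  also have "\<dots> \<le> real k * (real k + 1)" by (simp add: power2_eq_square algebra_simps)
  also have "\<dots> = (\<Sum>i=1..k. 2 * real i)" by (simp only: sum_twice_real)
  also have "\<dots> \<le> (\<Sum>i=1..T. 2 * real i * of_bool (real i \<le> z))" by (rule ge) simp
  finally show "(capped T z)\<^sup>2 \<le> (\<Sum>i=1..T. 2 * real i * of_bool (real i \<le> z))" .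
qed

text \<open>In \<open>cross_sum_bound\<close> each conv sum is at most \<open>T\<close> times its
  number of vectors, and those are few on average over the units modulo \<open>y\<close>. Modulus 1
  has no convergent vectors.\<close>

lemma cross_sum_le:
  assumes N: "N > 1" and y: "y \<ge> 1"
  shows "\<bar>cross_sum (capped T) (int N) (int y)\<bar> \<le> omega_pow N * (real T)\<^sup>2 * real y * (1 + ln (real y))"
proof -
  have "(\<Sum>s\<in>units_mod (int y). \<bar>conv_sum (capped T) (int y) s\<bar>) \<le> real T * (real y * (1 + ln (real y)))"
  proof (cases "y = 1")
    case True
    have "conv_vecs (int y) s = {}" for s using True conv_vecsD(1,5)[of _ "int y" s] by fastforce
    then show ?thesis using True by (simp add: conv_sum_def)
  next
    case False
    then have y1: "y > 1" using y by simp
    have "(\<Sum>s\<in>units_mod (int y). \<bar>conv_sum (capped T) (int y) s\<bar>) = (\<Sum>a\<in>totatives y. \<bar>conv_sum (capped T) (int y) (int a)\<bar>)"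
      unfolding int_totatives[OF y1, symmetric] by (subst sum.reindex) auto
    also have "\<dots> \<le> (\<Sum>a\<in>totatives y. real T * real (card (conv_vecs (int y) (int a))))"
    proof (intro sum_mono)
      fix a
      have "\<bar>conv_sum (capped T) (int y) (int a)\<bar> \<le> (\<Sum>v\<in>conv_vecs (int y) (int a). \<bar>signed_term (capped T) (int y) (int a) v\<bar>)"
        unfolding conv_sum_def by (rule sum_abs)
      also have "\<dots> \<le> (\<Sum>v\<in>conv_vecs (int y) (int a). real T)"
      proof (intro sum_mono)
        fix v
        have "\<bar>real_of_int (sgn (lattice_res (int y) (int a) v))\<bar> \<le> 1" by (simp add: sgn_if)
        then have "\<bar>signed_term (capped T) (int y) (int a) v\<bar> \<le> 1 * real T"
          unfolding signed_term_def abs_mult using capped(1,2) by (intro mult_mono) auto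
        then show "\<bar>signed_term (capped T) (int y) (int a) v\<bar> \<le> real T" by simp
      qed
      finally show "\<bar>conv_sum (capped T) (int y) (int a)\<bar> \<le> real T * real (card (conv_vecs (int y) (int a)))"
        by (simp add: mult.commute)
    qed
    also have "\<dots> = real T * (\<Sum>a\<in>totatives y. real (card (conv_vecs (int y) (int a))))" by (simp add: sum_distrib_left)
    also have "\<dots> \<le> real T * (real y * (\<Sum>q=1..y. 1 / real q))" using sum_card_conv_vecs_le[OF y1] by (intro mult_left_mono) auto
    also have "\<dots> \<le> real T * (real y * (1 + ln (real y)))" using sum_inverse_le[OF y] by (intro mult_left_mono) auto
    finally show ?thesis .
  qed
  then have "omega_pow N * real T * (\<Sum>s\<in>units_mod (int y). \<bar>conv_sum (capped T) (int y) s\<bar>) \<le>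
      omega_pow N * real T * (real T * (real y * (1 + ln (real y))))"
    by (intro mult_left_mono) (auto simp: omega_pow_def)
  moreover have "\<bar>cross_sum (capped T) (int N) (int y)\<bar> \<le> omega_pow (nat (int N)) * real T * (\<Sum>s\<in>units_mod (int y). \<bar>conv_sum (capped T) (int y) s\<bar>)"
    unfolding cross_sum_def using N y capped by (intro cross_sum_bound) auto
  ultimately show ?thesis by (simp add: power2_eq_square mult_ac)
qed

text \<open>The double sum factors: \<open>W1\<close> accompanies the main term and
  \<open>W0\<close> the gcd errors, whose sum over \<open>y\<close> is at most
  \<open>n * ndiv N\<close>.\<close>

lemma moment_bound_explicit:
  fixes h :: "real \<Rightarrow> real" and w :: "nat \<Rightarrow> real"
  assumes N: "N > 1" and Y: "Y \<subseteq> {1..n}"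
    and w: "\<And>i. w i \<ge> 0" and h: "\<And>z. h z \<le> (\<Sum>i=1..T. w i * of_bool (real i \<le> z))"
    and A: "(\<Sum>y\<in>Y. 1 / real y) \<le> A" and W1: "(\<Sum>i=1..T. w i / real i) \<le> W1" and W0: "(\<Sum>i=1..T. w i) \<le> W0"
  shows "(\<Sum>a\<in>totatives N. \<Sum>v | v \<in> conv_vecs (int N) (int a) \<and> nat \<bar>lattice_res (int N) (int a) v\<bar> \<in> Y.
      h (quality (int N) (int a) v)) \<le>
    2 * (real (totient N) * A * W1 + omega_pow N * (real n * real (ndiv N)) * W0)"
proof -
  have finY: "finite Y" using Y finite_subset by auto
  have pos: "omega_pow N \<ge> 0" by (simp add: omega_pow_def)
  have "(\<Sum>y\<in>Y. \<Sum>i=1..T. w i * (real (totient N) / (real i * real y) + real (gcd y N) * omega_pow N)) =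
      (\<Sum>y\<in>Y. \<Sum>i=1..T. real (totient N) * ((1 / real y) * (w i / real i)) + omega_pow N * (real (gcd y N) * w i))"
    by (intro sum.cong refl) (simp add: algebra_simps)
  also have "\<dots> = real (totient N) * (\<Sum>y\<in>Y. \<Sum>i=1..T. (1 / real y) * (w i / real i)) +
      omega_pow N * (\<Sum>y\<in>Y. \<Sum>i=1..T. real (gcd y N) * w i)"
    by (simp only: sum.distrib sum_distrib_left)
  also have "\<dots> = real (totient N) * ((\<Sum>y\<in>Y. 1 / real y) * (\<Sum>i=1..T. w i / real i)) +
      omega_pow N * ((\<Sum>y\<in>Y. real (gcd y N)) * (\<Sum>i=1..T. w i))"
    by (simp only: sum_product)
  also have "\<dots> \<le> real (totient N) * (A * W1) + omega_pow N * ((real n * real (ndiv N)) * W0)"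
  proof -
    have "(\<Sum>y\<in>Y. gcd y N) \<le> (\<Sum>y=1..n. gcd y N)" using Y by (intro sum_mono2) auto
    also have "\<dots> \<le> n * ndiv N" using N by (intro sum_gcd_le) auto
    finally have "real (\<Sum>y\<in>Y. gcd y N) \<le> real (n * ndiv N)" by (simp only: of_nat_le_iff)
    then have G: "(\<Sum>y\<in>Y. real (gcd y N)) \<le> real n * real (ndiv N)" by simp
    have 0: "0 \<le> (\<Sum>y\<in>Y. 1 / real y)" "0 \<le> (\<Sum>i=1..T. w i / real i)" "0 \<le> (\<Sum>i=1..T. w i)"
      using w by (auto intro!: sum_nonneg)
    have "(\<Sum>y\<in>Y. 1 / real y) * (\<Sum>i=1..T. w i / real i) \<le> A * W1"
      by (rule mult_mono[OF A W1]) (use 0 A in linarith)+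
    moreover have "(\<Sum>y\<in>Y. real (gcd y N)) * (\<Sum>i=1..T. w i) \<le> (real n * real (ndiv N)) * W0"
      by (rule mult_mono[OF G W0]) (use 0 in simp_all)
    ultimately show ?thesis using pos by (intro add_mono mult_left_mono) auto
  qed
  finally have "(\<Sum>y\<in>Y. \<Sum>i=1..T. w i * (real (totient N) / (real i * real y) + real (gcd y N) * omega_pow N)) \<le>
     real (totient N) * A * W1 + omega_pow N * (real n * real (ndiv N)) * W0" by (simp add: mult.assoc)
  note le = this
  show ?thesis
  proof (rule order_trans[OF moment_bound[OF N finY _ w h]])
    show "y > 0" if "y \<in> Y" for y using that Y by auto
  qed (use le in \<open>simp only: mult_le_cancel_left_pos zero_less_numeral\<close>)
qed

text \<open>Step heights \<open>2 * i\<close> give \<open>W1 = 2 * T\<close>, so the diagonal has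
  size \<open>T * totient N * log R\<close>. For the first moment the crude bound \<open>T\<close>
  on the harmonic sum suffices, since the diagonal is already that large. The coefficient 36 of the
  main term is \<open>4 + 32\<close>.\<close>

lemma late_second_moment:
  assumes N: "N > 1" and R: "R \<ge> 1" and T: "T \<ge> 1"
  shows "(\<Sum>a\<in>totatives N. (\<Sum>v\<in>late_vecs N R a. signed_term (capped T) (int N) (int a) v)\<^sup>2) \<le>
    36 * real T * real (totient N) * (1 + ln (real R)) + 36 * (real T)\<^sup>2 * omega_pow N * real R * real (ndiv N)
    + 4 * omega_pow N * (real T)\<^sup>2 * (real R)\<^sup>2 * (1 + ln (real R))"
proof -
  define H where "H = 1 + ln (real R)"
  define \<Omega> where "\<Omega> = omega_pow N"
  have H: "H \<ge> 1" using R by (simp add: H_def)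
  have \<Omega>: "\<Omega> \<ge> 0" by (simp add: \<Omega>_def omega_pow_def)
  have T1: "real T \<ge> 1" using T by simp
  have HR: "(\<Sum>y\<in>{1..R}. 1 / real y) \<le> H" unfolding H_def using R by (rule sum_inverse_le)
  have HT: "(\<Sum>i=1..T. 1 / real i) \<le> real T"
  proof -
    have "(\<Sum>i=1..T. 1 / real i) \<le> (\<Sum>i=1..T. 1)" by (intro sum_mono) auto
    then show ?thesis by simp
  qed
  have M2: "(\<Sum>a\<in>totatives N. \<Sum>v\<in>late_vecs N R a. (capped T (quality (int N) (int a) v))\<^sup>2) \<le>
      2 * (real (totient N) * H * (2 * real T) + \<Omega> * (real R * real (ndiv N)) * (real T * (real T + 1)))"
    unfolding late_vecs_def \<Omega>_def
  proof (rule moment_bound_explicit[OF N order_refl _ capped_layer_cake(2) HR])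
    have "(\<Sum>i=1..T. 2 * real i / real i) = (\<Sum>i=1..T. 2)" by (intro sum.cong) auto
    then show "(\<Sum>i=1..T. 2 * real i / real i) \<le> 2 * real T" by simp
    show "(\<Sum>i=1..T. 2 * real i) \<le> real T * (real T + 1)" by (simp only: sum_twice_real)
  qed auto
  have M1: "(\<Sum>a\<in>totatives N. \<Sum>v\<in>late_vecs N R a. capped T (quality (int N) (int a) v)) \<le>
      2 * (real (totient N) * H * real T + \<Omega> * (real R * real (ndiv N)) * real T)"
    unfolding late_vecs_def \<Omega>_def
    by (rule moment_bound_explicit[OF N order_refl _ capped_layer_cake(1) HR]) (use HT in auto)
  have Cr: "(\<Sum>y=1..R. \<bar>cross_sum (capped T) (int N) (int y)\<bar>) \<le> \<Omega> * (real T)\<^sup>2 * (real R)\<^sup>2 * H"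
  proof -
    have "(\<Sum>y=1..R. \<bar>cross_sum (capped T) (int N) (int y)\<bar>) \<le> (\<Sum>y=1..R. \<Omega> * (real T)\<^sup>2 * real R * H)"
    proof (intro sum_mono)
      fix y assume y: "y \<in> {1..R}"
      have "\<bar>cross_sum (capped T) (int N) (int y)\<bar> \<le> \<Omega> * (real T)\<^sup>2 * real y * (1 + ln (real y))"
        unfolding \<Omega>_def using y by (intro cross_sum_le N) auto
      also have "\<dots> \<le> \<Omega> * (real T)\<^sup>2 * real R * H"
        unfolding H_def using y \<Omega> by (intro mult_mono mult_left_mono add_mono) auto
      finally show "\<bar>cross_sum (capped T) (int N) (int y)\<bar> \<le> \<Omega> * (real T)\<^sup>2 * real R * H" .
    qed
    then show ?thesis by (simp add: power2_eq_square mult_ac)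
  qed
  have sm: "(\<Sum>a\<in>totatives N. (\<Sum>v\<in>late_vecs N R a. signed_term (capped T) (int N) (int a) v)\<^sup>2) \<le>
     2 * (real (totient N) * H * (2 * real T) + \<Omega> * (real R * real (ndiv N)) * (real T * (real T + 1)))
   + 16 * (2 * (real (totient N) * H * real T + \<Omega> * (real R * real (ndiv N)) * real T))
   + 4 * (\<Omega> * (real T)\<^sup>2 * (real R)\<^sup>2 * H)"
    by (rule order_trans[OF second_moment[OF N capped(5) capped(3) capped(1)]]) (use M1 M2 Cr in linarith)+
  define P where "P = \<Omega> * (real R * real (ndiv N))"
  have P: "P \<ge> 0" using \<Omega> by (simp add: P_def)
  have "P * real T \<le> P * (real T)\<^sup>2"
    using P T1 by (intro mult_left_mono) (auto simp: power2_eq_square)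
  then have "2 * (P * (real T * (real T + 1))) + 32 * (P * real T) \<le> 36 * (P * (real T)\<^sup>2)"
    by (simp add: power2_eq_square algebra_simps)
  then show ?thesis using sm unfolding P_def H_def[symmetric] \<Omega>_def[symmetric] by (simp add: algebra_simps)
qed

section \<open>From moments to counts\<close>

lemma chebyshev_count:
  fixes f :: "'a \<Rightarrow> real"
  assumes "finite A" "X > 0" "(\<Sum>a\<in>A. (f a)\<^sup>2) \<le> E"
  shows "real (card {a \<in> A. \<bar>f a\<bar> \<ge> X}) \<le> E / X\<^sup>2"
proof -
  have "real (card {a \<in> A. \<bar>f a\<bar> \<ge> X}) * X\<^sup>2 = (\<Sum>a | a \<in> A \<and> \<bar>f a\<bar> \<ge> X. X\<^sup>2)" by simp
  also have "\<dots> \<le> (\<Sum>a | a \<in> A \<and> \<bar>f a\<bar> \<ge> X. (f a)\<^sup>2)"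
    using assms(2) by (intro sum_mono) (auto simp: abs_le_square_iff[symmetric])
  also have "\<dots> \<le> (\<Sum>a\<in>A. (f a)\<^sup>2)" using assms(1) by (intro sum_mono2) auto
  finally show ?thesis using assms by (simp add: le_divide_eq)
qed

lemma markov_count:
  fixes f :: "'a \<Rightarrow> real"
  assumes "finite A" "X > 0" "(\<Sum>a\<in>A. f a) \<le> E" "\<And>a. a \<in> A \<Longrightarrow> f a \<ge> 0"
  shows "real (card {a \<in> A. f a \<ge> X}) \<le> E / X"
proof -
  have "real (card {a \<in> A. f a \<ge> X}) * X = (\<Sum>a | a \<in> A \<and> f a \<ge> X. X)" by simp
  also have "\<dots> \<le> (\<Sum>a | a \<in> A \<and> f a \<ge> X. f a)" by (intro sum_mono) auto
  also have "\<dots> \<le> (\<Sum>a\<in>A. f a)" using assms(1,4) by (intro sum_mono2) auto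
  finally show ?thesis using assms by (simp add: le_divide_eq)
qed

lemma large_quality_count:
  assumes N: "N > 1" and T: "T \<ge> 1" and S: "S \<ge> 1"
  shows "real (card {a \<in> totatives N. \<exists>v\<in>late_vecs N S a. quality (int N) (int a) v \<ge> real T}) \<le>
    2 * (real (totient N) * (1 + ln (real S)) / real T + omega_pow N * (real S * real (ndiv N)))"
proof -
  let ?z = "\<lambda>a v. quality (int N) (int a) v"
  define h where "h = (\<lambda>z. of_bool (real T \<le> z) :: real)"
  \<comment> \<open>A single step at height \<open>T\<close>, so \<open>W1\<close> is
    \<open>1 / T\<close>: this is the gain in Markov's inequality.\<close>
  define w where "w = (\<lambda>i. of_bool (i = T) :: real)"
  have *: "(\<Sum>i=1..T. w i * f i) = f T" for f :: "nat \<Rightarrow> real"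
  proof -
    have "(\<Sum>i=1..T. w i * f i) = (\<Sum>i=1..T. if i = T then f i else 0)" by (intro sum.cong) (auto simp: w_def)
    then show ?thesis using T by simp
  qed
  have "(\<Sum>a\<in>totatives N. \<Sum>v\<in>late_vecs N S a. h (?z a v)) \<le>
      2 * (real (totient N) * (1 + ln (real S)) * (1 / real T) + omega_pow N * (real S * real (ndiv N)) * 1)"
    unfolding late_vecs_def
  proof (rule moment_bound_explicit[OF N order_refl, where w = w and T = T])
    show "(\<Sum>y\<in>{1..S}. 1 / real y) \<le> 1 + ln (real S)" using S by (rule sum_inverse_le)
    show "(\<Sum>i=1..T. w i / real i) \<le> 1 / real T" using *[of "\<lambda>i. 1 / real i"] by simp
    show "(\<Sum>i=1..T. w i) \<le> 1" using *[of "\<lambda>i. 1"] by simp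
    show "h z \<le> (\<Sum>i=1..T. w i * of_bool (real i \<le> z))" for z using *[of "\<lambda>i. of_bool (real i \<le> z)"] by (simp add: h_def)
  qed (auto simp: w_def)
  then have "real (card {a \<in> totatives N. (\<Sum>v\<in>late_vecs N S a. h (?z a v)) \<ge> 1}) \<le>
      2 * (real (totient N) * (1 + ln (real S)) * (1 / real T) + omega_pow N * (real S * real (ndiv N)) * 1) / 1"
    by (intro markov_count) (auto intro!: sum_nonneg simp: h_def)
  moreover have "card {a \<in> totatives N. \<exists>v\<in>late_vecs N S a. ?z a v \<ge> real T} \<le>
      card {a \<in> totatives N. (\<Sum>v\<in>late_vecs N S a. h (?z a v)) \<ge> 1}"
  proof (intro card_mono subsetI)
    fix a assume "a \<in> {a \<in> totatives N. \<exists>v\<in>late_vecs N S a. ?z a v \<ge> real T}"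
    then obtain v where a: "a \<in> totatives N" and v: "v \<in> late_vecs N S a" "?z a v \<ge> real T" by auto
    have "h (?z a v) \<le> (\<Sum>v\<in>late_vecs N S a. h (?z a v))"
      using v by (intro member_le_sum) (auto simp: h_def)
    then show "a \<in> {a \<in> totatives N. (\<Sum>v\<in>late_vecs N S a. h (?z a v)) \<ge> 1}" using a v by (simp add: h_def)
  qed auto
  ultimately show ?thesis by simp
qed

text \<open>Here the sharper \<open>1 + ln T\<close> for the harmonic sum matters: it multiplies
  \<open>ln (n / R)\<close>, the logarithmic length of the range.\<close>

lemma middle_first_moment:
  assumes N: "N > 1" and R: "R \<ge> 1" and T: "T \<ge> 1" and n: "R \<le> n"
  shows "(\<Sum>a\<in>totatives N. \<Sum>v | v \<in> conv_vecs (int N) (int a) \<and> nat \<bar>lattice_res (int N) (int a) v\<bar> \<in> {R+1..n}.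
      capped T (quality (int N) (int a) v)) \<le>
    2 * (real (totient N) * ln (real n / real R) * (1 + ln (real T)) + omega_pow N * (real n * real (ndiv N)) * real T)"
proof (rule moment_bound_explicit[OF N _ _ capped_layer_cake(1)])
  show "(\<Sum>y\<in>{R+1..n}. 1 / real y) \<le> ln (real n / real R)" using R n by (rule sum_inverse_interval_le)
  show "(\<Sum>i=1..T. 1 / real i) \<le> 1 + ln (real T)" using T by (rule sum_inverse_le)
qed auto

section \<open>Exchanging \<open>a\<close> with its inverse modulo \<open>N\<close>\<close>

lemma totatives_inverse:
  assumes "N > 1" "a \<in> totatives N"
  obtains b where "b \<in> totatives N" "[a * b = 1] (mod N)"
proof -
  obtain c where c: "[a * c = 1] (mod N)" using assms cong_solve_coprime_nat[of a N] by (auto simp: in_totatives_iff)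
  define b where "b = c mod N"
  have ab: "[a * b = 1] (mod N)" using c by (simp add: b_def Cong.cong_def mod_mult_right_eq)
  then have "coprime b N" by (metis coprime_iff_invertible_nat mult.commute One_nat_def)
  moreover from this have "b > 0" using assms by (intro Nat.gr0I) auto
  moreover have "b \<le> N" using assms by (simp add: b_def less_imp_le)
  ultimately show ?thesis using ab that by (auto simp: in_totatives_iff)
qed

lemma card_le_by_inverse:
  assumes N: "N > 1"
    and PQ: "\<And>a b c. a \<in> totatives N \<Longrightarrow> b \<in> totatives N \<Longrightarrow> int a * int b = 1 + c * int N \<Longrightarrow> P a \<Longrightarrow> Q b"
  shows "card {a \<in> totatives N. P a} \<le> card {b \<in> totatives N. Q b}"
proof -
  define f where "f = (\<lambda>a. SOME b. b \<in> totatives N \<and> [a * b = 1] (mod N))"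
  have f: "f a \<in> totatives N \<and> [a * f a = 1] (mod N)" if "a \<in> totatives N" for a
  proof -
    obtain b where "b \<in> totatives N" "[a * b = 1] (mod N)" using totatives_inverse[OF N \<open>a \<in> totatives N\<close>] .
    then show ?thesis unfolding f_def
      by (intro someI[of "\<lambda>b. b \<in> totatives N \<and> [a * b = 1] (mod N)" b]) simp
  qed
  show ?thesis
  proof (rule card_inj_on_le[where f = f])
    show "inj_on f {a \<in> totatives N. P a}"
    proof (rule inj_onI)
      fix a a' assume a: "a \<in> {a \<in> totatives N. P a}" "a' \<in> {a \<in> totatives N. P a}" "f a = f a'"
      then have "[a * f a = a' * f a] (mod N)" using f[of a] f[of a'] by (auto) (metis cong_sym cong_trans)
      moreover have "coprime (f a) N" using f[of a] a by (simp add: in_totatives_iff)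
      ultimately have "[a = a'] (mod N)" by (simp add: cong_mult_rcancel_nat)
      moreover have "a < N" "a' < N" using a N totatives_less by auto
      ultimately show "a = a'" by (simp add: Cong.cong_def)
    qed
    show "f ` {a \<in> totatives N. P a} \<subseteq> {b \<in> totatives N. Q b}"
    proof
      fix b assume "b \<in> f ` {a \<in> totatives N. P a}"
      then obtain a where a: "a \<in> totatives N" "P a" "b = f a" by auto
      have "[int (a * f a) = int 1] (mod int N)" using f[OF a(1)] by (simp only: cong_int_iff)
      then have "int N dvd int (a * f a) - int 1" by (simp only: cong_iff_dvd_diff)
      then obtain c where "int (a * f a) - int 1 = int N * c" by (auto elim: dvdE)
      then have "int a * int (f a) = 1 + c * int N" by (simp add: algebra_simps)
      then show "b \<in> {b \<in> totatives N. Q b}" using PQ[of a "f a" c] f[OF a(1)] a by blast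
    qed
  qed auto
qed

definition early_vecs :: "nat \<Rightarrow> nat \<Rightarrow> nat \<Rightarrow> (int \<times> int) set" where
  "early_vecs N R a = {v. v \<in> conv_vecs (int N) (int a) \<and> fst v \<le> int R}"

lemma bij_betw_early_late:
  assumes "int a * int b = 1 + c * int N"
  shows "bij_betw (invert_vec (int N) (int a) (int b) c) (early_vecs N R a) (late_vecs N R b)"
proof -
  have "{v \<in> conv_vecs (int N) (int a). fst v \<le> int R} = early_vecs N R a" by (simp add: early_vecs_def)
  moreover have "{v \<in> conv_vecs (int N) (int b). \<bar>lattice_res (int N) (int b) v\<bar> \<le> int R} = late_vecs N R b"
    using conv_vecsD(3)[of _ "int N" "int b"] by (fastforce simp: late_vecs_def)
  ultimately show ?thesis
    using bij_betw_invert_vec[OF assms, of "\<lambda>q r. q \<le> int R"] by simp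
qed

lemma early_sum_eq_late_sum:
  assumes "int a * int b = 1 + c * int N"
  shows "(\<Sum>v\<in>early_vecs N R a. signed_term g (int N) (int a) v) = (\<Sum>v\<in>late_vecs N R b. signed_term g (int N) (int b) v)"
proof -
  have "(\<Sum>v\<in>early_vecs N R a. signed_term g (int N) (int b) (invert_vec (int N) (int a) (int b) c v)) =
      (\<Sum>v\<in>late_vecs N R b. signed_term g (int N) (int b) v)"
    by (rule sum.reindex_bij_betw[OF bij_betw_early_late[OF assms]])
  then show ?thesis using signed_term_invert_vec[OF assms] by (simp add: early_vecs_def)
qed

lemma quality_invert_vec:
  assumes "int a * int b = 1 + c * int N" "v \<in> conv_vecs (int N) (int a)"
  shows "quality (int N) (int b) (invert_vec (int N) (int a) (int b) c v) = quality (int N) (int a) v"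
proof -
  have "\<bar>sgn (lattice_res (int N) (int a) v) * fst v\<bar> = fst v"
    using conv_vecsD[OF assms(2)] by (auto simp: sgn_if)
  then show ?thesis unfolding quality_def invert_vec(2,3)[OF assms] by (simp add: mult.commute)
qed

section \<open>The tail estimate\<close>

lemma sum_split_parts:
  fixes g :: "real \<Rightarrow> real"
  assumes R: "R \<ge> 1" and disj: "early_vecs N R a \<inter> late_vecs N R a = {}"
    and g: "\<And>z. g z \<ge> 0"
  shows "\<bar>conv_sum g (int N) (int a)\<bar> \<le> \<bar>\<Sum>v\<in>early_vecs N R a. signed_term g (int N) (int a) v\<bar> +
     \<bar>\<Sum>v\<in>late_vecs N R a. signed_term g (int N) (int a) v\<bar> +
     (\<Sum>v | v \<in> conv_vecs (int N) (int a) \<and> nat \<bar>lattice_res (int N) (int a) v\<bar> \<in> {R+1..N div (2 * R)}. g (quality (int N) (int a) v))"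
proof -
  let ?r = "\<lambda>v. lattice_res (int N) (int a) v"
  let ?st = "\<lambda>v. signed_term g (int N) (int a) v"
  define V where "V = conv_vecs (int N) (int a)"
  define M where "M = V - (early_vecs N R a \<union> late_vecs N R a)"
  define M' where "M' = {v. v \<in> conv_vecs (int N) (int a) \<and> nat \<bar>?r v\<bar> \<in> {R+1..N div (2 * R)}}"
  have fin: "finite V" "finite M" "finite M'" "finite (early_vecs N R a)"
    by (auto simp: V_def M_def M'_def early_vecs_def)
  have VV: "V = (early_vecs N R a \<union> late_vecs N R a) \<union> M"
    by (auto simp: M_def V_def early_vecs_def late_vecs_def)
  have "conv_sum g (int N) (int a) = (\<Sum>v\<in>(early_vecs N R a \<union> late_vecs N R a) \<union> M. ?st v)"
    unfolding conv_sum_def V_def[symmetric] using VV by simp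
  also have "\<dots> = (\<Sum>v\<in>early_vecs N R a \<union> late_vecs N R a. ?st v) + (\<Sum>v\<in>M. ?st v)"
    using fin by (intro sum.union_disjoint) (auto simp: M_def)
  also have "(\<Sum>v\<in>early_vecs N R a \<union> late_vecs N R a. ?st v) = (\<Sum>v\<in>early_vecs N R a. ?st v) + (\<Sum>v\<in>late_vecs N R a. ?st v)"
    using fin disj by (intro sum.union_disjoint) auto
  finally have e: "conv_sum g (int N) (int a) = (\<Sum>v\<in>early_vecs N R a. ?st v) + (\<Sum>v\<in>late_vecs N R a. ?st v) + (\<Sum>v\<in>M. ?st v)" .
  have "\<bar>\<Sum>v\<in>M. ?st v\<bar> \<le> (\<Sum>v\<in>M. \<bar>?st v\<bar>)" by (rule sum_abs)
  also have "\<dots> \<le> (\<Sum>v\<in>M. g (quality (int N) (int a) v))"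
  proof (intro sum_mono)
    fix v
    have "\<bar>real_of_int (sgn (?r v))\<bar> \<le> 1" by (simp add: sgn_if)
    then have "\<bar>?st v\<bar> \<le> 1 * g (quality (int N) (int a) v)"
      unfolding signed_term_def abs_mult using g by (intro mult_mono) auto
    then show "\<bar>?st v\<bar> \<le> g (quality (int N) (int a) v)" by simp
  qed
  also have "\<dots> \<le> (\<Sum>v\<in>M'. g (quality (int N) (int a) v))"
  proof (rule sum_mono2)
    \<comment> \<open>Neither early nor late means \<open>q > R\<close> and \<open>|r| > R\<close>;
      then \<open>2 * q * |r| < N\<close> also bounds \<open>|r|\<close> by
      \<open>N div (2 * R)\<close>.\<close>
    show "M \<subseteq> M'"
    proof
      fix v assume v: "v \<in> M"
      then have vc: "v \<in> conv_vecs (int N) (int a)" and q: "fst v > int R" and r: "nat \<bar>?r v\<bar> \<notin> {1..R}"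
        by (auto simp: M_def V_def early_vecs_def late_vecs_def)
      note D = conv_vecsD[OF vc]
      define y where "y = nat \<bar>?r v\<bar>"
      have y: "int y = \<bar>?r v\<bar>" "y \<ge> R + 1" using D(3) r by (auto simp: y_def)
      have "int R * int y \<le> fst v * int y" using q by (intro mult_right_mono) auto
      then have "2 * (int R * int y) < int N" using D(4) y by simp
      then have "y * (2 * R) \<le> N" by (simp add: mult_ac flip: of_nat_mult)
      then have "y \<le> N div (2 * R)" using R by (simp add: less_eq_div_iff_mult_less_eq)
      then show "v \<in> M'" using vc y by (simp add: M'_def y_def)
    qed
  qed (use fin g in auto)
  finally show ?thesis using e unfolding M'_def by linarith
qed

text \<open>Outside five exceptional sets all qualities stay below \<open>T\<close> and the early,
  late and middle sums are each below \<open>X\<close>, so the conv sum is below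
  \<open>3 * X\<close>, too small for \<open>|D| \<ge> Y\<close>. Inversion bounds the two early
  sets by the late ones, hence the factors 2.\<close>

lemma count_bound:
  assumes N: "N > 1" and R: "R \<ge> 1" and T: "T \<ge> 1" and S: "S \<ge> 1" "N < (S + 1) * (S + 1)"
    and RT: "R * R * T \<le> N" and X: "X > 0" "6 * log 2 (real N) + 3 * X \<le> 12 * Y"
    and E: "(\<Sum>a\<in>totatives N. (\<Sum>v\<in>late_vecs N R a. signed_term (capped T) (int N) (int a) v)\<^sup>2) \<le> E"
    and M: "(\<Sum>a\<in>totatives N. \<Sum>v | v \<in> conv_vecs (int N) (int a) \<and>
      nat \<bar>lattice_res (int N) (int a) v\<bar> \<in> {R+1..N div (2 * R)}. capped T (quality (int N) (int a) v)) \<le> M"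
    and B: "real (card {a \<in> totatives N. \<exists>v\<in>late_vecs N S a. quality (int N) (int a) v \<ge> real T}) \<le> B"
  shows "real (card {a \<in> totatives N. \<bar>dedekind_sum a N\<bar> \<ge> Y}) \<le> 2 * B + 2 * (E / X\<^sup>2) + M / X"
proof -
  let ?r = "\<lambda>a v. lattice_res (int N) (int a) v"
  let ?z = "\<lambda>a v. quality (int N) (int a) v"
  let ?g = "capped T"
  define late where "late = (\<lambda>a. \<Sum>v\<in>late_vecs N R a. signed_term ?g (int N) (int a) v)"
  define early where "early = (\<lambda>a. \<Sum>v\<in>early_vecs N R a. signed_term ?g (int N) (int a) v)"
  define mid where "mid = (\<lambda>a. \<Sum>v | v \<in> conv_vecs (int N) (int a) \<and> nat \<bar>?r a v\<bar> \<in> {R+1..N div (2 * R)}. ?g (?z a v))"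
  define B1 where "B1 = {a \<in> totatives N. \<exists>v\<in>late_vecs N S a. ?z a v \<ge> real T}"
  define B2 where "B2 = {a \<in> totatives N. \<exists>v\<in>early_vecs N S a. ?z a v \<ge> real T}"
  define L1 where "L1 = {a \<in> totatives N. \<bar>late a\<bar> \<ge> X}"
  define L2 where "L2 = {a \<in> totatives N. \<bar>early a\<bar> \<ge> X}"
  define Mi where "Mi = {a \<in> totatives N. mid a \<ge> X}"
  have sub: "{a \<in> totatives N. \<bar>dedekind_sum a N\<bar> \<ge> Y} \<subseteq> B1 \<union> B2 \<union> L1 \<union> L2 \<union> Mi"
  proof
    fix a assume a: "a \<in> {a \<in> totatives N. \<bar>dedekind_sum a N\<bar> \<ge> Y}"
    show "a \<in> B1 \<union> B2 \<union> L1 \<union> L2 \<union> Mi"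
    proof (rule ccontr)
      assume no: "a \<notin> B1 \<union> B2 \<union> L1 \<union> L2 \<union> Mi"
      have at: "a \<in> totatives N" "coprime a N" using a by (auto simp: in_totatives_iff)
      \<comment> \<open>\<open>S\<close> is at least the integer part of \<open>sqrt N\<close>, so a
        convergent vector has \<open>q \<le> S\<close> or \<open>|r| \<le> S\<close>, and one of
        \<open>B1\<close>, \<open>B2\<close> catches every large quality.\<close>
      have zT: "?z a v < real T" if v: "v \<in> conv_vecs (int N) (int a)" for v
      proof (rule ccontr)
        assume nz: "\<not> ?z a v < real T"
        have "v \<notin> late_vecs N S a" "v \<notin> early_vecs N S a" using no nz at by (auto simp: B1_def B2_def)
        then have "fst v \<ge> int S + 1" "\<bar>?r a v\<bar> \<ge> int S + 1"
          using v conv_vecsD(3)[OF v] by (auto simp: late_vecs_def early_vecs_def)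
        then have "(int S + 1) * (int S + 1) \<le> fst v * \<bar>?r a v\<bar>" by (intro mult_mono) auto
        also have "\<dots> < int N" using conv_vecsD(1,3,4)[OF v] by (smt (verit) mult_pos_pos)
        finally have "int ((S + 1) * (S + 1)) < int N" by (simp add: algebra_simps)
        then show False using S(2) by linarith
      qed
      \<comment> \<open>A vector both early and late has
        \<open>q * |r| \<le> R * R \<le> N / T\<close>, hence quality at least \<open>T\<close>,
        which \<open>zT\<close> excludes.\<close>
      have disj: "early_vecs N R a \<inter> late_vecs N R a = {}"
      proof (rule ccontr)
        assume "early_vecs N R a \<inter> late_vecs N R a \<noteq> {}"
        then obtain v where "v \<in> early_vecs N R a" "v \<in> late_vecs N R a" by blast
        then have v: "v \<in> conv_vecs (int N) (int a)" "fst v \<le> int R" "\<bar>?r a v\<bar> \<le> int R"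
          by (simp_all add: early_vecs_def late_vecs_def nat_le_iff)
        note D = conv_vecsD[OF v(1)]
        have pos: "fst v * \<bar>?r a v\<bar> > 0" using D by (intro mult_pos_pos) auto
        have "fst v * \<bar>?r a v\<bar> \<le> int R * int R" using v D by (intro mult_mono) auto
        then have "fst v * \<bar>?r a v\<bar> * int T \<le> int (R * R * T)" by (simp add: mult_right_mono)
        also have "\<dots> \<le> int N" using RT by (simp only: of_nat_le_iff)
        finally have "real_of_int (fst v * \<bar>?r a v\<bar> * int T) \<le> real_of_int (int N)" by (simp only: of_int_le_iff)
        then have "real T * real_of_int (fst v * \<bar>?r a v\<bar>) \<le> real_of_int (int N)" by (simp add: mult_ac)
        moreover have "real_of_int (fst v * \<bar>?r a v\<bar>) > 0" using pos by (simp only: of_int_0_less_iff)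
        ultimately have "real T \<le> ?z a v" unfolding quality_def by (simp add: le_divide_eq)
        then show False using zT[OF v(1)] by simp
      qed
      have "conv_sum (\<lambda>z. max 0 (z - 2)) (int N) (int a) = conv_sum ?g (int N) (int a)"
        unfolding conv_sum_def using zT
        by (intro sum.cong refl) (simp add: signed_term_def capped_def min_def less_imp_le)
      then have "\<bar>12 * dedekind_sum a N - conv_sum ?g (int N) (int a)\<bar> \<le> 6 * log 2 (real N)"
        using dedekind_sum_conv_sum[of N a] at N by simp
      moreover have "\<bar>dedekind_sum a N\<bar> \<ge> Y" using a by simp
      ultimately have big: "\<bar>conv_sum ?g (int N) (int a)\<bar> \<ge> 3 * X" using X(2) by linarith
      have "\<bar>conv_sum ?g (int N) (int a)\<bar> \<le> \<bar>early a\<bar> + \<bar>late a\<bar> + mid a"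
        unfolding early_def late_def mid_def by (rule sum_split_parts[OF R disj capped(1)])
      moreover have "\<bar>early a\<bar> < X" "\<bar>late a\<bar> < X" "mid a < X" using no at by (auto simp: L1_def L2_def Mi_def)
      ultimately show False using big by linarith
    qed
  qed
  have fin: "finite (totatives N)" by simp
  have cL1: "real (card L1) \<le> E / X\<^sup>2"
    unfolding L1_def by (rule chebyshev_count[OF fin X(1)]) (use E in \<open>simp add: late_def\<close>)
  have cL2: "card L2 \<le> card L1"
    unfolding L1_def L2_def by (rule card_le_by_inverse[OF N]) (simp add: early_def late_def early_sum_eq_late_sum)
  have cB2: "card B2 \<le> card B1"
    unfolding B1_def B2_def
  proof (rule card_le_by_inverse[OF N])
    fix a b c assume ab: "int a * int b = 1 + c * int N" and ex: "\<exists>v\<in>early_vecs N S a. real T \<le> ?z a v"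
    then obtain v where v: "v \<in> early_vecs N S a" "real T \<le> ?z a v" by auto
    have "invert_vec (int N) (int a) (int b) c v \<in> late_vecs N S b"
      using bij_betw_early_late[OF ab, of S] v(1) by (auto simp: bij_betw_def)
    moreover have "?z b (invert_vec (int N) (int a) (int b) c v) = ?z a v"
      using v(1) by (intro quality_invert_vec[OF ab]) (simp add: early_vecs_def)
    ultimately show "\<exists>v\<in>late_vecs N S b. real T \<le> ?z b v" using v(2) by (intro bexI) auto
  qed
  have cM: "real (card Mi) \<le> M / X"
    unfolding Mi_def by (rule markov_count[OF fin X(1)]) (use M in \<open>auto simp: mid_def intro!: sum_nonneg capped(1)\<close>)
  have "card {a \<in> totatives N. \<bar>dedekind_sum a N\<bar> \<ge> Y} \<le> card (B1 \<union> B2 \<union> L1 \<union> L2 \<union> Mi)"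
    using sub by (intro card_mono) (auto simp: B1_def B2_def L1_def L2_def Mi_def)
  also have "\<dots> \<le> card B1 + card B2 + card L1 + card L2 + card Mi"
    by (intro order_trans[OF card_Un_le] add_mono order_refl)
  finally have "real (card {a \<in> totatives N. \<bar>dedekind_sum a N\<bar> \<ge> Y}) \<le> 2 * real (card B1) + 2 * real (card L1) + real (card Mi)"
    using cL2 cB2 by linarith
  then show ?thesis using cL1 cM B unfolding B1_def[symmetric] by linarith
qed

section \<open>Size of the parameters as \<open>N\<close> grows\<close>

lemma eventually_divisor_asymptotics:
  fixes C :: real
  assumes "C > 0"
  defines "\<beta> \<equiv> \<lambda>u. sqrt u * ln (1 + 2 * u) + 2 * u / ln u"
    and "\<tau> \<equiv> \<lambda>u. 1 + (C + 1) * ln u"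
  shows "eventually (\<lambda>u. 2 * \<tau> u + 4 * \<beta> u \<le> u / 2) at_top"
    "eventually (\<lambda>u. (1 + \<tau> u) * (1 + 2 * \<beta> u + 2 * \<tau> u) \<le> 8 * (C + 1) * u) at_top"
proof -
  \<comment> \<open>With \<open>u = ln N\<close>, \<open>\<beta>\<close> bounds
    \<open>ln d(N)\<close> and \<open>\<tau>\<close> bounds \<open>ln T\<close>; the quantity is the
    logarithm of \<open>T^2 * d(N)^4\<close>, to be compared with \<open>sqrt N\<close>.\<close>
  have "((\<lambda>u. (2 * \<tau> u + 4 * \<beta> u) / u) \<longlongrightarrow> 0) at_top"
    unfolding \<beta>_def \<tau>_def by real_asymp
  then have "eventually (\<lambda>u. (2 * \<tau> u + 4 * \<beta> u) / u < 1 / 2) at_top"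
    by (rule order_tendstoD) simp
  then show "eventually (\<lambda>u. 2 * \<tau> u + 4 * \<beta> u \<le> u / 2) at_top"
    using eventually_gt_at_top[of 0] by eventually_elim (simp add: field_simps)
  \<comment> \<open>The leading product is \<open>(C + 1) * ln u\<close> times
    \<open>4 * u / ln u\<close>, where the logarithms cancel; \<open>8 * (C + 1)\<close> is twice
    the limit.\<close>
  have "((\<lambda>u. ((1 + \<tau> u) * (1 + 2 * \<beta> u + 2 * \<tau> u)) / u) \<longlongrightarrow> 4 * (C + 1)) at_top"
    unfolding \<beta>_def \<tau>_def using assms(1) by real_asymp
  then have "eventually (\<lambda>u. ((1 + \<tau> u) * (1 + 2 * \<beta> u + 2 * \<tau> u)) / u < 8 * (C + 1)) at_top"
    by (rule order_tendstoD) (use assms(1) in simp)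
  then show "eventually (\<lambda>u. (1 + \<tau> u) * (1 + 2 * \<beta> u + 2 * \<tau> u) \<le> 8 * (C + 1) * u) at_top"
    using eventually_gt_at_top[of 0] by eventually_elim (simp add: field_simps)
qed

lemma ln_ge_1: "N \<ge> 3 \<Longrightarrow> ln (real N) \<ge> 1"
  using exp_le by (subst ln_ge_iff) auto

lemma log2_le_2_ln:
  assumes "ln (real N) \<ge> 0"
  shows "log 2 (real N) \<le> 2 * ln (real N)"
proof -
  have l2: "ln 2 \<ge> (1/2 :: real)" using ln_le_minus_one[of "1/2 :: real"] by (simp add: ln_div)
  have "ln (real N) / ln 2 \<le> ln (real N) / (1/2)" using l2 assms by (intro divide_left_mono) auto
  then show ?thesis by (simp add: log_def)
qed

lemma ndiv_pos: "N > 0 \<Longrightarrow> ndiv N > 0"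
  unfolding ndiv_def by (subst card_gt_0_iff) auto

text \<open>\<open>h1\<close> absorbs the sieve and gcd errors, \<open>h2\<close> is the cost of the
  middle range. With \<open>X = Y = t * u\<close> the three exceptional bounds contribute
  \<open>2 * 6\<close>, \<open>2 * 232\<close> and \<open>2 * K1 + 2\<close>, which gives
  \<open>478 + 2 * K1\<close>.\<close>

lemma count_estimate:
  fixes N :: nat and t K1 :: real
  defines "u \<equiv> ln (real N)" and "B \<equiv> real (ndiv N)"
  defines "T \<equiv> nat \<lceil>t * u\<rceil>"
  assumes N: "N \<ge> 3" and t: "t \<ge> 2"
    and h1: "(real T)\<^sup>2 * B ^ 4 \<le> sqrt (real N)"
    and h2: "(1 + ln (real T)) * (1 + 2 * ln B + 2 * ln (real T)) \<le> K1 * u"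
  shows "real (card {a \<in> totatives N. \<bar>dedekind_sum a N\<bar> \<ge> t * u}) \<le> (478 + 2 * K1) * (real (totient N) / t)"
proof -
  define \<phi> where "\<phi> = real (totient N)"
  define \<Omega> where "\<Omega> = omega_pow N"
  define s where "s = sqrt (real N)"
  define \<rho> where "\<rho> = s / (B * real T)"
  define R where "R = nat \<lfloor>\<rho>\<rfloor>"
  define S where "S = nat \<lfloor>s\<rfloor>"
  define n where "n = N div (2 * R)"
  have ss: "s * s = real N" by (simp add: s_def)
  have u1: "u \<ge> 1" unfolding u_def using N by (rule ln_ge_1)
  have tu: "t * u \<ge> 2" using t u1 by (smt (verit) mult_le_cancel_left1 mult_right_mono)
  have T: "t * u \<le> real T" "real T \<le> 2 * (t * u)" "real T \<ge> 2" using tu unfolding T_def by linarith+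
  have \<Omega>: "1 \<le> \<Omega>" "\<Omega> \<le> B" using N omega_pow_le_ndiv[of N] by (simp_all add: \<Omega>_def B_def) (simp add: omega_pow_def)
  have B2: "B \<ge> 2"
  proof -
    have "{1, N} \<subseteq> {d. d dvd N}" by auto
    then have "card {1, N} \<le> ndiv N" unfolding ndiv_def using N by (intro card_mono finite_divisors_nat) auto
    then show ?thesis using N by (simp add: B_def)
  qed
  have \<phi>: "real N \<le> B * \<phi>"
  proof -
    have "real N \<le> \<Omega> * \<phi>" using N totient_lower[of N] by (simp add: \<Omega>_def \<phi>_def)
    also have "\<dots> \<le> B * \<phi>" using \<Omega> by (intro mult_right_mono) (auto simp: \<phi>_def)
    finally show ?thesis .
  qed
  have \<phi>0: "\<phi> > 0" using N by (simp add: \<phi>_def)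
  have s0: "s > 0" using N by (simp add: s_def)
  have BT: "B * real T \<ge> 4" using B2 T(3) mult_mono[of 2 B 2 "real T"] by simp
  \<comment> \<open>Error terms below take the form \<open>B ^ i * T ^ j * s\<close>;
    \<open>h1\<close> turns them into at most \<open>s * s = N \<le> B * \<phi>\<close>, after one
    factor \<open>B\<close> was put in.\<close>
  have key: "B ^ i * real T ^ j \<le> s" if "i \<le> 4" "j \<le> 2" for i j
  proof -
    have "B ^ i * real T ^ j \<le> B ^ 4 * real T ^ 2"
      using that B2 T(3) by (intro mult_mono power_increasing) auto
    then show ?thesis using h1 by (simp add: s_def mult.commute)
  qed
  have \<rho>1: "\<rho> \<ge> 1" using key[of 1 1] BT unfolding \<rho>_def by (simp add: le_divide_eq)
  have \<rho>s: "\<rho> * (B * real T) = s" using B2 T(3) by (auto simp: \<rho>_def)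
  have "\<lfloor>\<rho>\<rfloor> \<ge> 1" using \<rho>1 by simp
  then have R1: "R \<ge> 1" "real R \<le> \<rho>" "\<rho> \<le> 2 * real R" unfolding R_def by linarith+
  have RR: "real R * (B * real T) \<le> s" using R1(2) BT \<rho>s mult_right_mono[of "real R" \<rho> "B * real T"] by simp
  have R2: "s \<le> 2 * real R * (B * real T)" using R1(3) BT \<rho>s mult_right_mono[of \<rho> "2 * real R" "B * real T"] by simp
  have sqR: "(real R)\<^sup>2 * (B * real T)\<^sup>2 \<le> real N"
  proof -
    have "(real R * (B * real T)) * (real R * (B * real T)) \<le> s * s" using RR BT s0 by (intro mult_mono) auto
    then show ?thesis using ss by (simp add: power2_eq_square mult_ac)
  qed
  have s1: "s \<ge> 1" using N by (simp add: s_def)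
  have S: "S \<ge> 1" "real S \<le> s" "s < real S + 1" using s1 unfolding S_def by linarith+
  have SN: "N < (S + 1) * (S + 1)"
  proof -
    have "s * s < (real S + 1) * (real S + 1)" using S s0 by (intro mult_strict_mono) auto
    then have "real N < real ((S + 1) * (S + 1))" using ss by (simp add: algebra_simps)
    then show ?thesis by (simp only: of_nat_less_iff)
  qed
  have sN: "s \<le> real N" using ss s1 s0 mult_left_mono[of 1 s s] by simp
  have lnS: "1 + ln (real S) \<le> 2 * u"
  proof -
    have "ln (real S) \<le> u" unfolding u_def using S sN by (intro ln_mono) auto
    then show ?thesis using u1 by simp
  qed
  have Rs: "real R \<le> s"
  proof -
    have "real R * 1 \<le> real R * (B * real T)" using BT by (intro mult_left_mono) auto
    then show ?thesis using RR by simp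
  qed
  have lnR: "1 + ln (real R) \<le> 2 * u"
  proof -
    have "ln (real R) \<le> u" unfolding u_def using R1 Rs sN by (intro ln_mono) auto
    then show ?thesis using u1 by simp
  qed
  have RT: "R * R * T \<le> N"
  proof -
    have "1 * real T \<le> (B * B * real T) * real T"
    proof (rule mult_right_mono)
      have "1 * 1 \<le> B * B" using B2 by (intro mult_mono) auto
      then have "1 * 1 \<le> (B * B) * real T" using T(3) by (intro mult_mono) auto
      then show "1 \<le> B * B * real T" by simp
    qed simp
    then have "(real R)\<^sup>2 * real T \<le> (real R)\<^sup>2 * (B * real T)\<^sup>2"
      by (intro mult_left_mono) (auto simp: power2_eq_square mult_ac)
    then have "real (R * R * T) \<le> real N" using sqR by (simp add: power2_eq_square)
    then show ?thesis by (simp only: of_nat_le_iff)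
  qed
  have Rn: "R \<le> n"
  proof -
    have "4\<^sup>2 \<le> (B * real T)\<^sup>2" using BT by (intro power_mono) auto
    then have "2 \<le> (B * real T)\<^sup>2" by simp
    then have "(real R)\<^sup>2 * 2 \<le> (real R)\<^sup>2 * (B * real T)\<^sup>2" by (intro mult_left_mono) auto
    then have "real (R * (2 * R)) \<le> real N" using sqR by (simp add: power2_eq_square)
    then have "R * (2 * R) \<le> N" by (simp only: of_nat_le_iff)
    then show ?thesis unfolding n_def using R1 by (simp add: less_eq_div_iff_mult_less_eq)
  qed
  have nle: "real n \<le> s * (B * real T)"
  proof -
    have "real n \<le> real N / real (2 * R)" unfolding n_def by (rule real_div_bounds)
    also have "\<dots> \<le> s * (B * real T)"
    proof -
      have "s * s \<le> s * (2 * real R * (B * real T))" using R2 s0 by (intro mult_left_mono) auto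
      then have "real N \<le> s * (2 * real R * (B * real T))" using ss by simp
      then show ?thesis using R1 by (simp add: divide_le_eq mult_ac)
    qed
    finally show ?thesis .
  qed
  have lnn: "ln (real n / real R) \<le> 1 + 2 * ln B + 2 * ln (real T)"
  proof -
    have "real n / real R \<le> s * (B * real T) / real R" using nle by (intro divide_right_mono) auto
    also have "\<dots> \<le> 2 * real R * (B * real T) * (B * real T) / real R"
      using R2 BT by (intro divide_right_mono mult_right_mono) auto
    also have "\<dots> = 2 * (B * real T)\<^sup>2" using R1 by (simp add: power2_eq_square)
    finally have "ln (real n / real R) \<le> ln (2 * (B * real T)\<^sup>2)" using Rn R1 by (intro ln_mono) auto
    also have "\<dots> = ln 2 + 2 * (ln B + ln (real T))"
      using B2 T(3) by (simp add: ln_mult ln_realpow)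
    also have "\<dots> \<le> 1 + 2 * ln B + 2 * ln (real T)" using ln_2_less_1 by simp
    finally show ?thesis .
  qed
  have N1: "N > 1" and T1: "T \<ge> 1" using N T(3) by auto
  have lnT: "ln (real T) \<ge> 0" using T(3) by simp
  define E where "E = 232 * t * u\<^sup>2 * \<phi>"
  define Mm where "Mm = 2 * (\<phi> * (K1 * u) + \<phi>)"
  define Bb where "Bb = 6 * (\<phi> / t)"
  have "real (card {a \<in> totatives N. \<bar>dedekind_sum a N\<bar> \<ge> t * u}) \<le> 2 * Bb + 2 * (E / (t * u)\<^sup>2) + Mm / (t * u)"
  proof (rule count_bound[OF N1 R1(1) T1 S(1) SN RT])
    show "0 < t * u" using tu by simp
    \<comment> \<open>The assumption \<open>t \<ge> 2\<close> lets the main term outweigh the error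
      of the reciprocity law: \<open>6 * log 2 N \<le> 12 * u \<le> 6 * t * u\<close>.\<close>
    show "6 * log 2 (real N) + 3 * (t * u) \<le> 12 * (t * u)"
    proof -
      have "6 * log 2 (real N) \<le> 12 * u" using log2_le_2_ln[of N] u1 by (simp add: u_def)
      moreover have "2 * u \<le> t * u" using t u1 by (intro mult_right_mono) auto
      ultimately show ?thesis using u1 by linarith
    qed
    show "(\<Sum>a\<in>totatives N. (\<Sum>v\<in>late_vecs N R a. signed_term (capped T) (int N) (int a) v)\<^sup>2) \<le> E"
    proof (rule order_trans[OF late_second_moment[OF N1 R1(1) T1]])
      have a1: "36 * real T * \<phi> * (1 + ln (real R)) \<le> 36 * real T * \<phi> * (2 * u)"
        using lnR \<phi>0 by (intro mult_left_mono) auto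
      have a2: "(real T)\<^sup>2 * \<Omega> * real R * B \<le> real T * \<phi>"
      proof -
        have "(real T)\<^sup>2 * \<Omega> * real R * B \<le> (real T)\<^sup>2 * B * real R * B"
          using \<Omega> B2 by (intro mult_right_mono mult_left_mono) auto
        also have "\<dots> = real T * (B * (real R * (B * real T)))" by (simp add: power2_eq_square mult_ac)
        also have "\<dots> \<le> real T * (B * s)" using RR B2 by (intro mult_left_mono) auto
        also have "\<dots> \<le> real T * \<phi>"
        proof (intro mult_left_mono)
          have "B * (B * s) \<le> s * s" using key[of 2 0] s0 by (simp add: power2_eq_square mult.assoc[symmetric])
          then have "B * (B * s) \<le> B * \<phi>" using ss \<phi> by simp
          then show "B * s \<le> \<phi>" using B2 by simp
        qed auto
        finally show ?thesis .
      qed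
      have a3: "\<Omega> * (real T)\<^sup>2 * (real R)\<^sup>2 \<le> \<phi>"
      proof -
        have "B * (\<Omega> * (real T)\<^sup>2 * (real R)\<^sup>2) \<le> B * (B * (real T)\<^sup>2 * (real R)\<^sup>2)"
          using \<Omega> B2 by (intro mult_right_mono mult_left_mono) auto
        also have "\<dots> = (real R)\<^sup>2 * (B * real T)\<^sup>2" by (simp add: power2_eq_square mult_ac)
        also have "\<dots> \<le> B * \<phi>" using sqR \<phi> by simp
        finally show ?thesis using B2 by simp
      qed
      have a4: "4 * \<Omega> * (real T)\<^sup>2 * (real R)\<^sup>2 * (1 + ln (real R)) \<le> 4 * \<phi> * (2 * u)"
      proof -
        have "(\<Omega> * (real T)\<^sup>2 * (real R)\<^sup>2) * (1 + ln (real R)) \<le> \<phi> * (2 * u)"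
          using a3 lnR R1 \<phi>0 by (intro mult_mono) auto
        then show ?thesis by (simp add: mult_ac)
      qed
      have "1 * (\<phi> * u) \<le> real T * (\<phi> * u)" "(real T * \<phi>) * 1 \<le> (real T * \<phi>) * u"
        using T(3) \<phi>0 u1 by (intro mult_right_mono mult_left_mono; simp)+
      then have a5: "\<phi> * u \<le> real T * \<phi> * u" "real T * \<phi> \<le> real T * \<phi> * u" by (simp_all add: mult.assoc)
      \<comment> \<open>All three parts are brought to multiples of \<open>T * \<phi> * u\<close>,
        with coefficients 72, 36 and 8; replacing \<open>T\<close> by \<open>2 * t * u\<close> then
        doubles 116 to 232.\<close>
      have "36 * real T * \<phi> * (1 + ln (real R)) + 36 * (real T)\<^sup>2 * \<Omega> * real R * B
          + 4 * \<Omega> * (real T)\<^sup>2 * (real R)\<^sup>2 * (1 + ln (real R)) \<le> 116 * (real T * \<phi> * u)"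
      proof -
        have "36 * real T * \<phi> * (1 + ln (real R)) \<le> 72 * (real T * \<phi> * u)" using a1 by (simp add: mult_ac)
        moreover have "36 * (real T)\<^sup>2 * \<Omega> * real R * B \<le> 36 * (real T * \<phi>)" using a2 by (simp add: mult_ac)
        moreover have "4 * \<phi> * (2 * u) = 8 * (\<phi> * u)" by simp
        ultimately show ?thesis using a4 a5 by linarith
      qed
      also have "\<dots> \<le> 116 * (2 * (t * u) * \<phi> * u)" using T(2) \<phi>0 u1 by (intro mult_left_mono mult_right_mono) auto
      also have "\<dots> = E" by (simp add: E_def power2_eq_square mult_ac)
      finally show "36 * real T * real (totient N) * (1 + ln (real R)) + 36 * (real T)\<^sup>2 * omega_pow N * real R * real (ndiv N)
          + 4 * omega_pow N * (real T)\<^sup>2 * (real R)\<^sup>2 * (1 + ln (real R)) \<le> E"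
        by (simp add: \<phi>_def \<Omega>_def B_def)
    qed
    show "(\<Sum>a\<in>totatives N. \<Sum>v | v \<in> conv_vecs (int N) (int a) \<and>
      nat \<bar>lattice_res (int N) (int a) v\<bar> \<in> {R+1..N div (2 * R)}. capped T (quality (int N) (int a) v)) \<le> Mm"
    proof (rule order_trans[OF middle_first_moment[OF N1 R1(1) T1 Rn[unfolded n_def]]])
      have b1: "\<phi> * ln (real n / real R) * (1 + ln (real T)) \<le> \<phi> * (K1 * u)"
      proof -
        have "ln (real n / real R) * (1 + ln (real T)) \<le> (1 + 2 * ln B + 2 * ln (real T)) * (1 + ln (real T))"
          using lnn lnT by (intro mult_right_mono) auto
        also have "\<dots> \<le> K1 * u" using h2 by (simp add: mult.commute)
        finally show ?thesis using \<phi>0 by (simp add: mult.assoc)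
      qed
      \<comment> \<open>The tightest error term: \<open>n\<close> may exceed \<open>sqrt N\<close>
        by the factor \<open>B * T\<close>, so the full strength of \<open>h1\<close> is spent
        here.\<close>
      have b2: "\<Omega> * (real n * B) * real T \<le> \<phi>"
      proof -
        have "B * (\<Omega> * (real n * B) * real T) \<le> B * (B * (s * (B * real T) * B) * real T)"
          using \<Omega> B2 nle by (intro mult_left_mono mult_right_mono mult_mono) auto
        also have "\<dots> = (B ^ 4 * real T ^ 2) * s" by (simp add: power2_eq_square power4_eq_xxxx mult_ac)
        also have "\<dots> \<le> s * s" using key[of 4 2] s0 by (intro mult_right_mono) auto
        also have "\<dots> \<le> B * \<phi>" using ss \<phi> by simp
        finally show ?thesis using B2 by simp
      qed
      show "2 * (real (totient N) * ln (real (N div (2 * R)) / real R) * (1 + ln (real T)) +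
          omega_pow N * (real (N div (2 * R)) * real (ndiv N)) * real T) \<le> Mm"
        unfolding \<phi>_def[symmetric] \<Omega>_def[symmetric] B_def[symmetric] n_def[symmetric] Mm_def
        using add_mono[OF b1 b2] by simp
    qed
    show "real (card {a \<in> totatives N. \<exists>v\<in>late_vecs N S a. quality (int N) (int a) v \<ge> real T}) \<le> Bb"
    proof (rule order_trans[OF large_quality_count[OF N1 T1 S(1)]])
      have c1: "\<phi> * (1 + ln (real S)) / real T \<le> 2 * (\<phi> / t)"
      proof -
        have "\<phi> * (1 + ln (real S)) / real T \<le> \<phi> * (2 * u) / (t * u)"
          using lnS T tu \<phi>0 u1 by (intro frac_le mult_left_mono) auto
        also have "\<dots> = 2 * (\<phi> / t)" using u1 by simp
        finally show ?thesis .
      qed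
      have c2: "\<Omega> * (real S * B) \<le> \<phi> / t"
      proof -
        have "t * 1 \<le> t * u" using t u1 by (intro mult_left_mono) auto
        then have tT: "t \<le> real T" using T(1) by simp
        have "B * (t * (\<Omega> * (real S * B))) \<le> B * (real T * (B * (s * B)))"
          using \<Omega> B2 S tT t by (intro mult_left_mono mult_right_mono mult_mono) auto
        also have "\<dots> = (B ^ 3 * real T ^ 1) * s" by (simp add: power3_eq_cube mult_ac)
        also have "\<dots> \<le> s * s" using key[of 3 1] s0 by (intro mult_right_mono) auto
        also have "\<dots> \<le> B * \<phi>" using ss \<phi> by simp
        finally have "t * (\<Omega> * (real S * B)) \<le> \<phi>" using B2 by simp
        then show ?thesis using t by (simp add: le_divide_eq mult.commute)
      qed
      show "2 * (real (totient N) * (1 + ln (real S)) / real T + omega_pow N * (real S * real (ndiv N))) \<le> Bb"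
        unfolding \<phi>_def[symmetric] \<Omega>_def[symmetric] B_def[symmetric] Bb_def
        using add_mono[OF c1 c2] by simp
    qed
  qed
  also have "\<dots> \<le> (478 + 2 * K1) * (\<phi> / t)"
  proof -
    have "E / (t * u)\<^sup>2 = 232 * (\<phi> / t)" using t u1 by (simp add: E_def power2_eq_square)
    moreover have "Mm / (t * u) \<le> (2 * K1 + 2) * (\<phi> / t)"
    proof -
      have "Mm \<le> 2 * (\<phi> * (K1 * u) + \<phi> * u)" unfolding Mm_def using \<phi>0 u1 by simp
      then have "Mm / (t * u) \<le> 2 * (\<phi> * (K1 * u) + \<phi> * u) / (t * u)" using tu by (intro divide_right_mono) auto
      also have "\<dots> = (2 * K1 + 2) * (\<phi> / t)" using t u1 by (simp add: field_simps)
      finally show ?thesis .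
    qed
    moreover have "(478 + 2 * K1) * x = 2 * (6 * x) + 2 * (232 * x) + (2 * K1 + 2) * x" for x :: real
      by (simp add: algebra_simps)
    note this[of "\<phi> / t"]
    ultimately show ?thesis unfolding Bb_def by (simp only: add_left_mono)
  qed
  finally show ?thesis by (simp add: \<phi>_def)
qed

text \<open>With threshold \<open>x = sqrt u\<close>, the small primes contribute about
  \<open>sqrt u * ln u\<close>, and \<open>log x N = 2 * u / ln u\<close> dominates.\<close>

lemma ln_ndiv_le:
  assumes "ln (real N) > 1"
  shows "ln (real (ndiv N)) \<le> sqrt (ln (real N)) * ln (1 + 2 * ln (real N)) + 2 * ln (real N) / ln (ln (real N))"
proof -
  define u where "u = ln (real N)"
  have u: "u > 1" using assms by (simp add: u_def)
  have N: "N > 0" using assms by (intro Nat.gr0I) auto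
  define x where "x = sqrt u"
  have x: "x > 1" using u by (simp add: x_def)
  have nd: "real (ndiv N) > 0" using ndiv_pos[OF N] by simp
  have lg: "0 \<le> log 2 (real N)" "log 2 (real N) \<le> 2 * u"
    using N u log2_le_2_ln[of N] by (simp_all add: u_def)
  have "ln (real (ndiv N)) \<le> ln ((1 + log 2 (real N)) powr x * 2 powr (log x (real N)))"
    using ndiv_bound[OF N x] nd by (intro ln_mono) auto
  also have "\<dots> = x * ln (1 + log 2 (real N)) + log x (real N) * ln 2"
    using lg by (simp add: ln_mult ln_powr)
  also have "\<dots> \<le> x * ln (1 + 2 * u) + 2 * u / ln u"
  proof (rule add_mono)
    show "x * ln (1 + log 2 (real N)) \<le> x * ln (1 + 2 * u)"
      using lg x by (intro mult_left_mono ln_mono) auto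
    have "log x (real N) = u / (ln u / 2)" using u by (simp add: log_def u_def x_def ln_sqrt)
    then have "log x (real N) * ln 2 = (2 * u / ln u) * ln 2" by simp
    also have "\<dots> \<le> (2 * u / ln u) * 1" using u ln_2_less_1 by (intro mult_left_mono) auto
    finally show "log x (real N) * ln 2 \<le> 2 * u / ln u" by simp
  qed
  finally show ?thesis by (simp add: u_def x_def)
qed

text \<open>The bound on \<open>T\<close> is what \<open>T \<le> 2 * t * ln N\<close> and
  \<open>t \<le> (ln N)^C\<close> give; the conclusions are the hypotheses \<open>h1\<close> and
  \<open>h2\<close> of \<open>count_estimate\<close> with \<open>K1 = 8 * (C + 1)\<close>.\<close>

lemma eventually_parameters:
  fixes C :: real
  assumes C: "C > 0"
  shows "\<exists>N0. \<forall>N\<ge>N0. \<forall>T. T \<ge> (1::nat) \<longrightarrow> real T \<le> 2 * ln (real N) powr (C + 1) \<longrightarrow>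
     (real T)\<^sup>2 * real (ndiv N) ^ 4 \<le> sqrt (real N) \<and>
     (1 + ln (real T)) * (1 + 2 * ln (real (ndiv N)) + 2 * ln (real T)) \<le> 8 * (C + 1) * ln (real N)"
proof -
  define \<beta> where "\<beta> = (\<lambda>u::real. sqrt u * ln (1 + 2 * u) + 2 * u / ln u)"
  define \<tau> where "\<tau> = (\<lambda>u::real. 1 + (C + 1) * ln u)"
  have "eventually (\<lambda>u. 2 * \<tau> u + 4 * \<beta> u \<le> u / 2 \<and> (1 + \<tau> u) * (1 + 2 * \<beta> u + 2 * \<tau> u) \<le> 8 * (C + 1) * u \<and> u > 1) at_top"
    unfolding \<beta>_def \<tau>_def
    by (intro eventually_conj eventually_divisor_asymptotics[OF C] eventually_gt_at_top)
  moreover have "filterlim (\<lambda>N. ln (real N)) at_top at_top" by real_asymp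
  ultimately have "eventually (\<lambda>N. 2 * \<tau> (ln (real N)) + 4 * \<beta> (ln (real N)) \<le> ln (real N) / 2 \<and>
      (1 + \<tau> (ln (real N))) * (1 + 2 * \<beta> (ln (real N)) + 2 * \<tau> (ln (real N))) \<le> 8 * (C + 1) * ln (real N) \<and> ln (real N) > 1) at_top"
    by (rule eventually_compose_filterlim)
  then obtain N0 where N0: "\<And>N. N \<ge> N0 \<Longrightarrow> 2 * \<tau> (ln (real N)) + 4 * \<beta> (ln (real N)) \<le> ln (real N) / 2 \<and>
      (1 + \<tau> (ln (real N))) * (1 + 2 * \<beta> (ln (real N)) + 2 * \<tau> (ln (real N))) \<le> 8 * (C + 1) * ln (real N) \<and> ln (real N) > 1"
    by (auto simp: eventually_at_top_linorder)
  show ?thesis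
  proof (intro exI[of _ N0] allI impI)
    fix N T :: nat assume NT: "N \<ge> N0" "T \<ge> 1" "real T \<le> 2 * ln (real N) powr (C + 1)"
    define u where "u = ln (real N)"
    have u: "2 * \<tau> u + 4 * \<beta> u \<le> u / 2" "(1 + \<tau> u) * (1 + 2 * \<beta> u + 2 * \<tau> u) \<le> 8 * (C + 1) * u" "u > 1"
      using N0[OF NT(1)] by (auto simp: u_def)
    have N: "N > 0" using u(3) by (intro Nat.gr0I) (auto simp: u_def)
    define B where "B = real (ndiv N)"
    have B1: "B \<ge> 1" using ndiv_pos[OF N] by (simp add: B_def Suc_le_eq)
    have lB: "ln B \<le> \<beta> u" unfolding B_def \<beta>_def u_def using u(3) by (intro ln_ndiv_le) (simp add: u_def)
    have lT: "ln (real T) \<le> \<tau> u"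
    proof -
      have "ln (real T) \<le> ln (2 * u powr (C + 1))" using NT by (intro ln_mono) (auto simp: u_def)
      also have "\<dots> = ln 2 + (C + 1) * ln u" using u(3) by (simp add: ln_mult ln_powr)
      also have "\<dots> \<le> \<tau> u" using ln_2_less_1 by (simp add: \<tau>_def)
      finally show ?thesis .
    qed
    have l0: "ln (real T) \<ge> 0" "ln B \<ge> 0" using NT B1 by auto
    have "ln ((real T)\<^sup>2 * B ^ 4) = 2 * ln (real T) + 4 * ln B"
      using NT B1 by (simp add: ln_mult ln_realpow)
    also have "\<dots> \<le> u / 2" using lB lT u(1) by linarith
    also have "\<dots> = ln (sqrt (real N))" using N by (simp add: ln_sqrt u_def)
    finally have "(real T)\<^sup>2 * B ^ 4 \<le> sqrt (real N)"
      using NT B1 N by (subst (asm) ln_le_cancel_iff) auto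
    moreover have "(1 + ln (real T)) * (1 + 2 * ln B + 2 * ln (real T)) \<le> (1 + \<tau> u) * (1 + 2 * \<beta> u + 2 * \<tau> u)"
      using lB lT l0 by (intro mult_mono) auto
    ultimately show "(real T)\<^sup>2 * real (ndiv N) ^ 4 \<le> sqrt (real N) \<and>
       (1 + ln (real T)) * (1 + 2 * ln (real (ndiv N)) + 2 * ln (real T)) \<le> 8 * (C + 1) * ln (real N)"
      using u(2) by (simp add: B_def u_def)
  qed
qed

theorem theorem4:
  fixes C :: real
  assumes "C > 0"
  shows "\<exists>K > 0. \<forall>N::nat. \<forall>t::real. N \<ge> 3 \<longrightarrow> 0 < t \<longrightarrow> t \<le> ln (real N) powr C \<longrightarrow>
           1 / real (totient N) *
             real (card {a \<in> totatives N. \<bar>dedekind_sum a N\<bar> \<ge> t * ln (real N)}) \<le> K * (1 / t)"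
proof -
  obtain N0 where N0: "\<And>N T. N \<ge> N0 \<Longrightarrow> T \<ge> (1::nat) \<Longrightarrow> real T \<le> 2 * ln (real N) powr (C + 1) \<Longrightarrow>
     (real T)\<^sup>2 * real (ndiv N) ^ 4 \<le> sqrt (real N) \<and>
     (1 + ln (real T)) * (1 + 2 * ln (real (ndiv N)) + 2 * ln (real T)) \<le> 8 * (C + 1) * ln (real N)"
    using eventually_parameters[OF assms] by blast
  \<comment> \<open>The fraction is at most 1, so \<open>t \<le> K\<close> is trivial. The first
    summand covers \<open>t < 2\<close> and the second \<open>N < N0\<close>, where \<open>t\<close>
    is bounded through \<open>ln N\<close>; the shift by 3 keeps that logarithm positive for every
    \<open>N0\<close>.\<close>
  define K where "K = 2 + ln (real N0 + 3) powr C + (478 + 16 * (C + 1))"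
  have K0: "K \<ge> 2" "K \<ge> ln (real N0 + 3) powr C" "K \<ge> 478 + 2 * (8 * (C + 1))"
    using assms by (auto simp: K_def add_nonneg_nonneg)
  show ?thesis
  proof (intro exI[of _ K] conjI allI impI)
    show "K > 0" using K0 by simp
    fix N :: nat and t :: real
    assume N: "N \<ge> 3" and t: "0 < t" "t \<le> ln (real N) powr C"
    define c where "c = real (card {a \<in> totatives N. \<bar>dedekind_sum a N\<bar> \<ge> t * ln (real N)})"
    have \<phi>: "real (totient N) > 0" using N by simp
    have "card {a \<in> totatives N. \<bar>dedekind_sum a N\<bar> \<ge> t * ln (real N)} \<le> card (totatives N)"
      by (intro card_mono) auto
    then have c1: "c \<le> real (totient N)" by (simp add: c_def totient_def)
    have trivial: "1 / real (totient N) * c \<le> K * (1 / t)" if "t \<le> K"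
    proof -
      have "1 / real (totient N) * c \<le> 1" using c1 \<phi> by (simp add: divide_le_eq)
      also have "1 \<le> K * (1 / t)" using that t by (simp add: le_divide_eq)
      finally show ?thesis .
    qed
    have "1 / real (totient N) * c \<le> K * (1 / t)"
    proof (cases "t < 2 \<or> N < N0")
      case True
      then show ?thesis
      proof
        assume "t < 2"
        then show ?thesis using K0 by (intro trivial) simp
      next
        assume "N < N0"
        then have "ln (real N) \<le> ln (real N0 + 3)" using N by (intro ln_mono) auto
        then have "ln (real N) powr C \<le> ln (real N0 + 3) powr C" using assms N by (intro powr_mono2) auto
        then show ?thesis using K0 t by (intro trivial) simp
      qed
    next
      case False
      define u where "u = ln (real N)"
      define T where "T = nat \<lceil>t * u\<rceil>"
      have u1: "u \<ge> 1" unfolding u_def using N by (rule ln_ge_1)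
      have "2 * 1 \<le> t * u" using False u1 by (intro mult_mono) auto
      then have T: "T \<ge> 1" "real T \<le> 2 * (t * u)" unfolding T_def by linarith+
      have "t * u \<le> u powr C * u" using t u1 by (intro mult_right_mono) (auto simp: u_def)
      also have "\<dots> = u powr (C + 1)" using u1 by (simp add: powr_add)
      finally have "real T \<le> 2 * u powr (C + 1)" using T(2) by linarith
      then have "(real T)\<^sup>2 * real (ndiv N) ^ 4 \<le> sqrt (real N) \<and>
         (1 + ln (real T)) * (1 + 2 * ln (real (ndiv N)) + 2 * ln (real T)) \<le> 8 * (C + 1) * ln (real N)"
        using False T(1) by (intro N0) (auto simp: u_def)
      then have "c \<le> (478 + 2 * (8 * (C + 1))) * (real (totient N) / t)"
        unfolding c_def using N False by (intro count_estimate) (auto simp: T_def u_def)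
      also have "\<dots> \<le> K * (real (totient N) / t)" using K0(3) t by (intro mult_right_mono) auto
      finally show ?thesis using \<phi> t by (simp add: field_simps)
    qed
    then show "1 / real (totient N) * real (card {a \<in> totatives N. \<bar>dedekind_sum a N\<bar> \<ge> t * ln (real N)}) \<le> K * (1 / t)"
      by (simp add: c_def)
  qed
qed

end
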